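(* Let $(G,\mathfrak S)$ be a hierarchically hyperbolic group. The following are equivalent. (i) $G$ is virtually abelian. (ii) For every eyrie $W$ of $(G,\mathfrak S)$, the space $\mathcal C W$ is a quasiline (quasiisometric to $\mathbb R$). (iii) For every domain $U\in\mathfrak S$, the space $\mathcal C U$ is either bounded or a quasiline. Moreover, in this case, the rank of an abelian finite-index subgroup of $G$ equals the number of eyries of $(G,\mathfrak S)$.
   Context: **Hierarchically hyperbolic spaces (HHSs).** Let $X$ be a quasigeodesic metric space. An HHS structure $(X,\mathfrak S)$ consists of a set $\mathfrak S$ of *domains*, a constant $E\ge 1$, and for each $U\in\mathfrak S$ a geodesic $E$-hyperbolic space $\mathcal C U$, with the following data and axioms. (Distance between sets means infimal distance. One writes $d_U$ for distance in $\mathcal C U$ and suppresses $\pi_U$: $d_U(x,y)=d_{\mathcal C U}(\pi_U(x),\pi_U(y))$ for $x,y\in X$, $d_U(x,A)=d_{\mathcal C U}(\pi_U(x),A)$ for $A\subseteq\mathcal C U$.) 1. *Projections.* Maps $\pi_U:X\to\mathcal C U$ with $d_U(x,y)\le E\,d_X(x,y)+E$, and every point of $\mathcal C U$ is within $E$ of $\pi_U(X)$. 2. *Nesting.* A partial order $\sqsubseteq$ on $\mathfrak S$ with a unique maximal element (if $\mathfrak S\neq\varnothing$). $V\sqsubset W$ means $V\sqsubseteq W$, $V\ne W$ ("properly nested"). $\mathfrak S_W=\{V:V\sqsubseteq W\}$. If $V\sqsubset W$ there are a specified nonempty $\rho^V_W\subseteq\mathcal C W$ of diameter $\le E$ and a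 map $\rho^W_V:\mathcal C W\to 2^{\mathcal C V}$. 3. *Orthogonality.* A symmetric antireflexive relation $\bot$. If $V\sqsubseteq W$ and $W\bot U$ then $V\bot U$. If $V\bot W$ then $V,W$ are not $\sqsubseteq$-comparable. For each $T\in\mathfrak S$ and $U\in\mathfrak S_T$ with $\{V\in\mathfrak S_T:V\bot U\}\ne\varnothing$ there is $W\in\mathfrak S_T\smallsetminus\{T\}$ such that $V\sqsubseteq W$ whenever $V\in\mathfrak S_T$, $V\bot U$. 4. *Transversality and consistency.* If $V,W$ are distinct, not orthogonal and not $\sqsubseteq$-comparable they are *transverse*, $V\pitchfork W$; then there are nonempty sets $\rho^V_W\subseteq\mathcal C W$, $\rho^W_V\subseteq\mathcal C V$ of diameter $\le E$ with $\min\{d_W(x,\rho^V_W),d_V(x,\rho^W_V)\}\le E$ for all $x\in X$. If $V\sqsubset W$ then $\min\{d_W(x,\rho^V_W),\operatorname{diam}(\{\pi_V(x)\}\cup\rho^W_V(\pi_W(x)))\}\le E$ for all $x\in X$. If $U\sqsubseteq V$ then $d_W(\rho^U_W,\rho^V_W)\le E$ whenever $V\sqsubset W$, or $V\pitchfork W$ and $W\not\perp U$. 5. *Finite complexity.* The cardinality of $\sqsubseteq$-chains is bounded; the maximum is the *complexity*. 6. *Large links.* For $W\in\mathfrak S$, $x,x'\in X$ let $N=E\,d_W(x,x')+E$. There are $T_1,\dots,T_{\lfloor N\rfloor}\in\mathfrak S_W\smallsetminus\{W\}$ such that each $T\in\mathfrak S_W\smallsetminus\{W\}$ is nested in some $T_i$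 or has $d_T(x,x')<E$; and $d_W(x,\rho^{T_i}_W)\le N$ for all $i$. 7. *Bounded geodesic image.* If $V\sqsubset W$ and $\gamma$ is a geodesic of $\mathcal C W$, then $\operatorname{diam}\rho^W_V(\gamma)\le E$ or $\gamma$ meets the $E$-neighbourhood of $\rho^V_W$. Moreover if $y,z\in X$ have $d_V(y,z)>E$ then $\rho^V_W$ is $E$-close to every geodesic $[\pi_W(y),\pi_W(z)]$. 8. *Partial realisation.* If $\{W_i\}$ are pairwise orthogonal and $p_i\in\mathcal C W_i$, there is $x\in X$ with $d_{W_i}(x,p_i)\le E$ for all $i$ and $d_V(x,\rho^{W_i}_V)\le E$ whenever $W_i\sqsubset V$ or $W_i\pitchfork V$. 9. *Uniqueness.* For each $\kappa$ there is $\theta_u(\kappa)$ such that if $d_X(x,y)>\theta_u(\kappa)$ then $d_U(x,y)>\kappa$ for some $U\in\mathfrak S$. **Hierarchically hyperbolic groups (HHGs).** A finitely generated group $G$ with an HHS structure $(G,\mathfrak S)$ on $G$ (with a word metric) is an HHG if: $G$ acts on $\mathfrak S$ with finitely many orbits, preserving $\sqsubseteq,\bot,\pitchfork$; for $g\in G$, $U\in\mathfrak S$ there is an isometry $g:\mathcal C U\to\mathcal C gU$, with the isometry of a product $gh$ equal to the composition; and $g\pi_U(x)=\pi_{gU}(gx)$, $g\rho^V_U=\rho^{gV}_{gU}$ for all $g,x\in G$ and $U,V$ with $U\pitchfork V$ or $V\sqsubset U$. By cofiniteness, $E$ is also chosen so that $\operatorname{diam}\mathcal C U>E$ implies $\operatorname{diam}\mathcal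 C U=\infty$. **Eyries.** A domain $U$ is *unbounded* if $\mathcal C U$ is unbounded. For every HHG $(G,\mathfrak S)$ there is a (necessarily unique) finite $G$-invariant set $\mathcal E(G)$ of pairwise orthogonal unbounded domains such that every unbounded domain is nested in an element of $\mathcal E(G)$; it is the set of $\sqsubseteq$-maximal unbounded domains. Its elements are the *eyries* of $(G,\mathfrak S)$. *)

theory Defs
  imports
    "HOL-Analysis.Abstract_Metric_Spaces"
    "HOL-Library.Extended_Nat"
    "HOL-Library.Extended_Nonnegative_Real"
    "HOL-Algebra.Generated_Groups"
    "HOL-Algebra.Group_Action"
    "HOL-Algebra.FiniteProduct"
begin

section \<open>Coarse geometry of metric spaces\<close>

text \<open>Infimal distance between sets. It is only meaningful for nonempty sets
  (\<^term>\<open>Inf {} :: real\<close> is unspecified).\<close>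

definition mset_dist :: "'p metric \<Rightarrow> 'p set \<Rightarrow> 'p set \<Rightarrow> real" where
  "mset_dist m A B = Inf ((\<lambda>(a, b). mdist m a b) ` (A \<times> B))"

text \<open>The diameter takes values in \<open>[0, \<infinity>]\<close>; the empty set has diameter 0.\<close>

definition mdiam :: "'p metric \<Rightarrow> 'p set \<Rightarrow> ennreal" where
  "mdiam m A = (SUP (a, b) \<in> A \<times> A. ennreal (mdist m a b))"

definition mnbhd :: "'p metric \<Rightarrow> real \<Rightarrow> 'p set \<Rightarrow> 'p set" where
  "mnbhd m r A = {p \<in> mspace m. mset_dist m {p} A \<le> r}"

definition bounded_space :: "'p metric \<Rightarrow> bool" where
  "bounded_space m \<longleftrightarrow> Metric_space.mbounded (mspace m) (mdist m) (mspace m)"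

definition qi_embedding_on ::
    "real \<Rightarrow> real \<Rightarrow> 'a metric \<Rightarrow> 'a set \<Rightarrow> 'b metric \<Rightarrow> ('a \<Rightarrow> 'b) \<Rightarrow> bool" where
  "qi_embedding_on K c m A m' f \<longleftrightarrow>
     K \<ge> 1 \<and> c \<ge> 0 \<and> A \<subseteq> mspace m \<and> f ` A \<subseteq> mspace m' \<and>
     (\<forall>x\<in>A. \<forall>y\<in>A. mdist m x y / K - c \<le> mdist m' (f x) (f y) \<and>
                   mdist m' (f x) (f y) \<le> K * mdist m x y + c)"

definition quasi_isometric :: "'a metric \<Rightarrow> 'b metric \<Rightarrow> bool" where
  "quasi_isometric m m' \<longleftrightarrow>
     (\<exists>K c f. qi_embedding_on K c m (mspace m) m' f \<and>
        (\<forall>q\<in>mspace m'. \<exists>p\<in>mspace m. mdist m' q (f p) \<le> c))"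

definition quasiline :: "'p metric \<Rightarrow> bool" where
  "quasiline m \<longleftrightarrow> quasi_isometric m (euclidean_metric :: real metric)"

definition quasigeodesic_space :: "'p metric \<Rightarrow> bool" where
  "quasigeodesic_space m \<longleftrightarrow>
     (\<exists>K c. \<forall>x\<in>mspace m. \<forall>y\<in>mspace m. \<exists>L\<ge>0. \<exists>\<gamma>.
        qi_embedding_on K c (euclidean_metric :: real metric) {0..L} m \<gamma> \<and> \<gamma> 0 = x \<and> \<gamma> L = y)"

definition geodesic_segment :: "'p metric \<Rightarrow> 'p \<Rightarrow> 'p \<Rightarrow> 'p set \<Rightarrow> bool" where
  "geodesic_segment m x y S \<longleftrightarrow>
     (\<exists>L\<ge>0. \<exists>\<gamma> :: real \<Rightarrow> 'p.
        \<gamma> ` {0..L} \<subseteq> mspace m \<and>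
        (\<forall>s\<in>{0..L}. \<forall>t\<in>{0..L}. mdist m (\<gamma> s) (\<gamma> t) = \<bar>s - t\<bar>) \<and>
        \<gamma> 0 = x \<and> \<gamma> L = y \<and> S = \<gamma> ` {0..L})"

definition geodesic_space :: "'p metric \<Rightarrow> bool" where
  "geodesic_space m \<longleftrightarrow> (\<forall>x\<in>mspace m. \<forall>y\<in>mspace m. \<exists>S. geodesic_segment m x y S)"

text \<open>Hyperbolicity is the slim-triangles condition. One side suffices, since the condition
  ranges over all triangles and segments are symmetric in their endpoints.\<close>

definition hyperbolic :: "real \<Rightarrow> 'p metric \<Rightarrow> bool" where
  "hyperbolic \<delta> m \<longleftrightarrow>
     (\<forall>x y z S1 S2 S3. geodesic_segment m x y S1 \<and> geodesic_segment m y z S2 \<and>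
        geodesic_segment m x z S3 \<longrightarrow> S1 \<subseteq> mnbhd m \<delta> (S2 \<union> S3))"


section \<open>Hierarchically hyperbolic spaces\<close>

definition pnested :: "('d \<Rightarrow> 'd \<Rightarrow> bool) \<Rightarrow> 'd \<Rightarrow> 'd \<Rightarrow> bool" where
  "pnested nest V W \<longleftrightarrow> nest V W \<and> V \<noteq> W"

definition transverse :: "('d \<Rightarrow> 'd \<Rightarrow> bool) \<Rightarrow> ('d \<Rightarrow> 'd \<Rightarrow> bool) \<Rightarrow> 'd \<Rightarrow> 'd \<Rightarrow> bool" where
  "transverse nest orth V W \<longleftrightarrow> V \<noteq> W \<and> \<not> orth V W \<and> \<not> nest V W \<and> \<not> nest W V"

text \<open>\<open>rho V W\<close> is the set \<open>\<rho>\<^sup>V\<^sub>W \<subseteq> C W\<close>, used when \<open>V\<close> is properly nested in, or transverse to,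
  \<open>W\<close>. When \<open>V\<close> is properly nested in \<open>W\<close>, \<open>rhomap W V\<close> is the map \<open>\<rho>\<^sup>W\<^sub>V : C W \<rightarrow> 2\<^sup>C\<^sup>V\<close>.\<close>

locale HHS =
  fixes X :: "'x metric"
    and \<SS> :: "'d set"
    and E :: real
    and C :: "'d \<Rightarrow> 'p metric"
    and \<pi> :: "'d \<Rightarrow> 'x \<Rightarrow> 'p"
    and nest :: "'d \<Rightarrow> 'd \<Rightarrow> bool"
    and orth :: "'d \<Rightarrow> 'd \<Rightarrow> bool"
    and rho :: "'d \<Rightarrow> 'd \<Rightarrow> 'p set"
    and rhomap :: "'d \<Rightarrow> 'd \<Rightarrow> 'p \<Rightarrow> 'p set"
  assumes quasigeodesic: "quasigeodesic_space X"
    and E_ge_1: "E \<ge> 1"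
    and geodesic: "U \<in> \<SS> \<Longrightarrow> geodesic_space (C U)"
    and hyperbolic: "U \<in> \<SS> \<Longrightarrow> hyperbolic E (C U)"
    and proj: "U \<in> \<SS> \<Longrightarrow> \<pi> U ` mspace X \<subseteq> mspace (C U)"
    and proj_lipschitz: "\<lbrakk>U \<in> \<SS>; x \<in> mspace X; y \<in> mspace X\<rbrakk> \<Longrightarrow>
          mdist (C U) (\<pi> U x) (\<pi> U y) \<le> E * mdist X x y + E"
    and proj_onto: "\<lbrakk>U \<in> \<SS>; p \<in> mspace (C U)\<rbrakk> \<Longrightarrow>
          mset_dist (C U) {p} (\<pi> U ` mspace X) \<le> E"
    and nest_refl: "reflp_on \<SS> nest"
    and nest_trans: "transp_on \<SS> nest"
    and nest_antisym: "antisymp_on \<SS> nest"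
    and nest_maximal: "\<SS> \<noteq> {} \<Longrightarrow> \<exists>!M. M \<in> \<SS> \<and> (\<forall>V\<in>\<SS>. nest M V \<longrightarrow> V = M)"
    and rho_nested: "\<lbrakk>V \<in> \<SS>; W \<in> \<SS>; pnested nest V W\<rbrakk> \<Longrightarrow>
          rho V W \<noteq> {} \<and> rho V W \<subseteq> mspace (C W) \<and> mdiam (C W) (rho V W) \<le> ennreal E"
    and rhomap: "\<lbrakk>V \<in> \<SS>; W \<in> \<SS>; pnested nest V W; p \<in> mspace (C W)\<rbrakk> \<Longrightarrow>
          rhomap W V p \<subseteq> mspace (C V)"
    and orth_sym: "symp_on \<SS> orth"
    and orth_irrefl: "irreflp_on \<SS> orth"
    and orth_nested: "\<lbrakk>U \<in> \<SS>; V \<in> \<SS>; W \<in> \<SS>; nest V W; orth W U\<rbrakk> \<Longrightarrow> orth V U"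
    and orth_incomparable: "\<lbrakk>V \<in> \<SS>; W \<in> \<SS>; orth V W\<rbrakk> \<Longrightarrow> \<not> nest V W \<and> \<not> nest W V"
    and orth_container: "\<lbrakk>T \<in> \<SS>; U \<in> \<SS>; nest U T; \<exists>V\<in>\<SS>. nest V T \<and> orth V U\<rbrakk> \<Longrightarrow>
          \<exists>W\<in>\<SS>. nest W T \<and> W \<noteq> T \<and> (\<forall>V\<in>\<SS>. nest V T \<and> orth V U \<longrightarrow> nest V W)"
    and rho_transverse: "\<lbrakk>V \<in> \<SS>; W \<in> \<SS>; transverse nest orth V W\<rbrakk> \<Longrightarrow>
          rho V W \<noteq> {} \<and> rho V W \<subseteq> mspace (C W) \<and> mdiam (C W) (rho V W) \<le> ennreal E"
    and consistency_transverse: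
      "\<lbrakk>V \<in> \<SS>; W \<in> \<SS>; transverse nest orth V W; x \<in> mspace X\<rbrakk> \<Longrightarrow>
          min (mset_dist (C W) {\<pi> W x} (rho V W)) (mset_dist (C V) {\<pi> V x} (rho W V)) \<le> E"
    and consistency_nested:
      "\<lbrakk>V \<in> \<SS>; W \<in> \<SS>; pnested nest V W; x \<in> mspace X\<rbrakk> \<Longrightarrow>
          min (ennreal (mset_dist (C W) {\<pi> W x} (rho V W)))
              (mdiam (C V) ({\<pi> V x} \<union> rhomap W V (\<pi> W x))) \<le> ennreal E"
    and consistency_rho:
      "\<lbrakk>U \<in> \<SS>; V \<in> \<SS>; W \<in> \<SS>; nest U V;
        pnested nest V W \<or> (transverse nest orth V W \<and> \<not> orth W U)\<rbrakk> \<Longrightarrow>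
          mset_dist (C W) (rho U W) (rho V W) \<le> E"
    and finite_complexity:
      "\<exists>n. \<forall>Ch\<subseteq>\<SS>. (\<forall>V\<in>Ch. \<forall>W\<in>Ch. nest V W \<or> nest W V) \<longrightarrow> finite Ch \<and> card Ch \<le> n"
    (* The list T_1, ..., T_floor(N) is a set of at most floor(N) domains: if W is
       nest-minimal there are no domains properly nested in W, and the set is empty. *)
    and large_links:
      "\<lbrakk>W \<in> \<SS>; x \<in> mspace X; x' \<in> mspace X; N = E * mdist (C W) (\<pi> W x) (\<pi> W x') + E\<rbrakk> \<Longrightarrow>
          \<exists>\<T>. \<T> \<subseteq> {T \<in> \<SS>. pnested nest T W} \<and> finite \<T> \<and> int (card \<T>) \<le> \<lfloor>N\<rfloor> \<and>
              (\<forall>T\<in>\<SS>. pnested nest T W \<longrightarrow>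
                 (\<exists>T'\<in>\<T>. nest T T') \<or> mdist (C T) (\<pi> T x) (\<pi> T x') < E) \<and>
              (\<forall>T\<in>\<T>. mset_dist (C W) {\<pi> W x} (rho T W) \<le> N)"
    and bounded_geodesic_image:
      "\<lbrakk>V \<in> \<SS>; W \<in> \<SS>; pnested nest V W; geodesic_segment (C W) p q \<gamma>\<rbrakk> \<Longrightarrow>
          mdiam (C V) (\<Union>r\<in>\<gamma>. rhomap W V r) \<le> ennreal E \<or> \<gamma> \<inter> mnbhd (C W) E (rho V W) \<noteq> {}"
    and bounded_geodesic_image':
      "\<lbrakk>V \<in> \<SS>; W \<in> \<SS>; pnested nest V W; y \<in> mspace X; z \<in> mspace X;
        mdist (C V) (\<pi> V y) (\<pi> V z) > E; geodesic_segment (C W) (\<pi> W y) (\<pi> W z) \<gamma>\<rbrakk> \<Longrightarrow>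
          mset_dist (C W) (rho V W) \<gamma> \<le> E"
    and partial_realisation:
      "\<lbrakk>\<W> \<subseteq> \<SS>; pairwise orth \<W>; \<And>W. W \<in> \<W> \<Longrightarrow> pts W \<in> mspace (C W)\<rbrakk> \<Longrightarrow>
          \<exists>x\<in>mspace X. (\<forall>W\<in>\<W>. mdist (C W) (\<pi> W x) (pts W) \<le> E) \<and>
            (\<forall>W\<in>\<W>. \<forall>V\<in>\<SS>. pnested nest W V \<or> transverse nest orth W V \<longrightarrow>
               mset_dist (C V) {\<pi> V x} (rho W V) \<le> E)"
    and uniqueness:
      "\<exists>\<theta> :: real. \<forall>x\<in>mspace X. \<forall>y\<in>mspace X. mdist X x y > \<theta> \<longrightarrow>
          (\<exists>U\<in>\<SS>. mdist (C U) (\<pi> U x) (\<pi> U y) > \<kappa>)"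


section \<open>Word metrics\<close>

definition word_length :: "('g, 'b) monoid_scheme \<Rightarrow> 'g set \<Rightarrow> 'g \<Rightarrow> nat" where
  "word_length G A g =
     (LEAST n. \<exists>w. length w = n \<and> set w \<subseteq> A \<union> m_inv G ` A \<and> foldr (mult G) w \<one>\<^bsub>G\<^esub> = g)"

text \<open>The value outside the carrier is immaterial, but \<^locale>\<open>Metric_space\<close> demands symmetry and
  nonnegativity on the whole type.\<close>

definition word_dist :: "('g, 'b) monoid_scheme \<Rightarrow> 'g set \<Rightarrow> 'g \<Rightarrow> 'g \<Rightarrow> real" where
  "word_dist G A g h =
     (if g \<in> carrier G \<and> h \<in> carrier G
      then real (word_length G A (inv\<^bsub>G\<^esub> g \<otimes>\<^bsub>G\<^esub> h)) else 0)"

definition word_metric :: "('g, 'b) monoid_scheme \<Rightarrow> 'g set \<Rightarrow> 'g metric" where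
  "word_metric G A = metric (carrier G, word_dist G A)"

context group
begin

lemma foldr_mult_closed: "set w \<subseteq> carrier G \<Longrightarrow> foldr (\<otimes>) w \<one> \<in> carrier G"
  by (induction w) auto

lemma foldr_mult_append:
  assumes "set v \<subseteq> carrier G" "set w \<subseteq> carrier G"
  shows "foldr (\<otimes>) (v @ w) \<one> = foldr (\<otimes>) v \<one> \<otimes> foldr (\<otimes>) w \<one>"
  using assms by (induction v) (auto simp: foldr_mult_closed m_assoc simp del: foldr_append
      simp: foldr_append[symmetric])

lemma foldr_mult_inv:
  assumes "set w \<subseteq> carrier G"
  shows "foldr (\<otimes>) (rev (map (m_inv G) w)) \<one> = inv (foldr (\<otimes>) w \<one>)"
  using assms
proof (induction w)
  case (Cons a w)
  have c: "set (rev (map (m_inv G) w)) \<subseteq> carrier G"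
    using Cons.prems by auto
  have "foldr (\<otimes>) (rev (map (m_inv G) (a # w))) \<one>
      = foldr (\<otimes>) (rev (map (m_inv G) w)) \<one> \<otimes> foldr (\<otimes>) [inv a] \<one>"
    unfolding list.map rev.simps using Cons.prems c by (intro foldr_mult_append) auto
  also have "\<dots> = inv (foldr (\<otimes>) (a # w) \<one>)"
    using Cons foldr_mult_closed[of w] by (auto simp: inv_mult_group)
  finally show ?case .
qed simp

lemma word_exists:
  assumes A: "A \<subseteq> carrier G" and g: "g \<in> generate G A"
  shows "\<exists>w. set w \<subseteq> A \<union> m_inv G ` A \<and> foldr (\<otimes>) w \<one> = g"
  using g
proof (induction rule: generate.induct)
  case one
  show ?case by (rule exI[of _ "[]"]) simp
next
  case (incl h)
  then show ?case using A by (intro exI[of _ "[h]"]) auto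
next
  case (inv h)
  then show ?case using A by (intro exI[of _ "[inv h]"]) auto
next
  case (eng h1 h2)
  then obtain w1 w2 where w: "set w1 \<subseteq> A \<union> m_inv G ` A" "foldr (\<otimes>) w1 \<one> = h1"
    "set w2 \<subseteq> A \<union> m_inv G ` A" "foldr (\<otimes>) w2 \<one> = h2" by blast
  moreover have "A \<union> m_inv G ` A \<subseteq> carrier G" using A by auto
  ultimately show ?case
    by (intro exI[of _ "w1 @ w2"]) (use foldr_mult_append[of w1 w2] in auto)
qed

lemma word_length_attained:
  assumes "A \<subseteq> carrier G" "generate G A = carrier G" "g \<in> carrier G"
  obtains w where "length w = word_length G A g" "set w \<subseteq> A \<union> m_inv G ` A" "foldr (\<otimes>) w \<one> = g"
proof -
  have "\<exists>n w. length w = n \<and> set w \<subseteq> A \<union> m_inv G ` A \<and> foldr (\<otimes>) w \<one> = g"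
    using word_exists[of A g] assms by auto
  then have "\<exists>w. length w = word_length G A g \<and> set w \<subseteq> A \<union> m_inv G ` A \<and> foldr (\<otimes>) w \<one> = g"
    unfolding word_length_def by (rule LeastI_ex)
  then show ?thesis using that by blast
qed

lemma word_length_le:
  assumes "set w \<subseteq> A \<union> m_inv G ` A" "foldr (\<otimes>) w \<one> = g"
  shows "word_length G A g \<le> length w"
  unfolding word_length_def using assms by (intro Least_le) blast

lemma Metric_space_word_dist:
  assumes A: "A \<subseteq> carrier G" and gen: "generate G A = carrier G"
  shows "Metric_space (carrier G) (word_dist G A)"
proof -
  have AA: "A \<union> m_inv G ` A \<subseteq> carrier G" using A by auto
  have inv_le: "word_length G A (inv g) \<le> word_length G A g" if g: "g \<in> carrier G" for g
  proof -
    obtain w where w: "length w = word_length G A g" "set w \<subseteq> A \<union> m_inv G ` A"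
      "foldr (\<otimes>) w \<one> = g" using word_length_attained[OF A gen g] by blast
    have inv_inv_A: "m_inv G ` m_inv G ` A \<subseteq> A"
      using A by (auto simp: subset_iff)
    have "set (rev (map (m_inv G) w)) = m_inv G ` set w" by simp
    also have "\<dots> \<subseteq> m_inv G ` (A \<union> m_inv G ` A)" using w(2) by (rule image_mono)
    also have "\<dots> = m_inv G ` A \<union> m_inv G ` m_inv G ` A" by (rule image_Un)
    also have "\<dots> \<subseteq> A \<union> m_inv G ` A" using inv_inv_A by blast
    finally have "set (rev (map (m_inv G) w)) \<subseteq> A \<union> m_inv G ` A" .
    moreover have "foldr (\<otimes>) (rev (map (m_inv G) w)) \<one> = inv g"
      using foldr_mult_inv[of w] w AA by auto
    ultimately have "word_length G A (inv g) \<le> length (rev (map (m_inv G) w))"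
      by (rule word_length_le)
    then show ?thesis using w by simp
  qed
  have inv_eq: "word_length G A (inv g) = word_length G A g" if "g \<in> carrier G" for g
    using inv_le[of g] inv_le[of "inv g"] that by simp
  have mult_le: "word_length G A (g \<otimes> h) \<le> word_length G A g + word_length G A h"
    if g: "g \<in> carrier G" and h: "h \<in> carrier G" for g h
  proof -
    obtain v where v: "length v = word_length G A g" "set v \<subseteq> A \<union> m_inv G ` A"
      "foldr (\<otimes>) v \<one> = g" using word_length_attained[OF A gen g] by blast
    obtain w where w: "length w = word_length G A h" "set w \<subseteq> A \<union> m_inv G ` A"
      "foldr (\<otimes>) w \<one> = h" using word_length_attained[OF A gen h] by blast
    have "foldr (\<otimes>) (v @ w) \<one> = g \<otimes> h" using foldr_mult_append[of v w] v w AA by auto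
    then show ?thesis using word_length_le[of "v @ w" A "g \<otimes> h"] v w by simp
  qed
  have zero: "word_length G A g = 0 \<longleftrightarrow> g = \<one>" if g: "g \<in> carrier G" for g
  proof
    assume "word_length G A g = 0"
    then show "g = \<one>" using word_length_attained[OF A gen g] by force
  next
    assume "g = \<one>"
    then show "word_length G A g = 0" using word_length_le[of "[]" A g] by simp
  qed
  have sym: "word_length G A (inv x \<otimes> y) = word_length G A (inv y \<otimes> x)"
    if "x \<in> carrier G" "y \<in> carrier G" for x y
    using inv_eq[of "inv x \<otimes> y"] that by (simp add: inv_mult_group)
  show ?thesis
  proof
    fix x y
    show "0 \<le> word_dist G A x y" by (simp add: word_dist_def)
    show "word_dist G A x y = word_dist G A y x" using sym by (auto simp: word_dist_def)
    show "word_dist G A x y = 0 \<longleftrightarrow> x = y" if "x \<in> carrier G" "y \<in> carrier G"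
    proof -
      have "inv x \<otimes> y = \<one> \<longleftrightarrow> x = y"
        using that by (metis inv_solve_left l_inv one_closed r_one)
      then show ?thesis using that zero[of "inv x \<otimes> y"] by (simp add: word_dist_def)
    qed
    show "word_dist G A x z \<le> word_dist G A x y + word_dist G A y z"
      if "x \<in> carrier G" "y \<in> carrier G" "z \<in> carrier G" for z
    proof -
      have "(inv x \<otimes> y) \<otimes> (inv y \<otimes> z) = inv x \<otimes> z"
        using that m_assoc[of y "inv y" z, symmetric] by (simp add: m_assoc)
      then show ?thesis
        using mult_le[of "inv x \<otimes> y" "inv y \<otimes> z"] that by (simp add: word_dist_def)
    qed
  qed
qed

lemma word_metric_simps:
  assumes "A \<subseteq> carrier G" "generate G A = carrier G"
  shows "mspace (word_metric G A) = carrier G" "mdist (word_metric G A) = word_dist G A"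
proof -
  interpret M: Metric_space "carrier G" "word_dist G A"
    by (rule Metric_space_word_dist[OF assms])
  show "mspace (word_metric G A) = carrier G" "mdist (word_metric G A) = word_dist G A"
    unfolding word_metric_def using M.mspace_Self M.mdist_Self unfolding M.Self_def by simp_all
qed

end


section \<open>Hierarchically hyperbolic groups and eyries\<close>

text \<open>\<open>A\<close> is the finite generating set whose word metric carries the HHS structure, \<open>act\<close> is the
  action on the domains and \<open>mv g U\<close> is the isometry from \<open>C U\<close> to \<open>C (act g U)\<close>.\<close>

locale HHG =
  group G +
  HHS "word_metric G A" \<SS> E C \<pi> nest orth rho rhomap +
  group_action G \<SS> act
  for G :: "('g, 'b) monoid_scheme" (structure)
    and A :: "'g set"
    and \<SS> :: "'d set"
    and E :: real
    and C :: "'d \<Rightarrow> 'p metric"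
    and \<pi> :: "'d \<Rightarrow> 'g \<Rightarrow> 'p"
    and nest :: "'d \<Rightarrow> 'd \<Rightarrow> bool"
    and orth :: "'d \<Rightarrow> 'd \<Rightarrow> bool"
    and rho :: "'d \<Rightarrow> 'd \<Rightarrow> 'p set"
    and rhomap :: "'d \<Rightarrow> 'd \<Rightarrow> 'p \<Rightarrow> 'p set"
    and act :: "'g \<Rightarrow> 'd \<Rightarrow> 'd"
    and mv :: "'g \<Rightarrow> 'd \<Rightarrow> 'p \<Rightarrow> 'p" +
  assumes gens_finite: "finite A"
    and gens_subset: "A \<subseteq> carrier G"
    and gens_generate: "generate G A = carrier G"
    and finite_orbits: "finite (orbits G \<SS> act)"
    and act_nest: "\<lbrakk>g \<in> carrier G; V \<in> \<SS>; W \<in> \<SS>\<rbrakk> \<Longrightarrow> nest (act g V) (act g W) \<longleftrightarrow> nest V W"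
    and act_orth: "\<lbrakk>g \<in> carrier G; V \<in> \<SS>; W \<in> \<SS>\<rbrakk> \<Longrightarrow> orth (act g V) (act g W) \<longleftrightarrow> orth V W"
    and act_transverse: "\<lbrakk>g \<in> carrier G; V \<in> \<SS>; W \<in> \<SS>\<rbrakk> \<Longrightarrow>
          transverse nest orth (act g V) (act g W) \<longleftrightarrow> transverse nest orth V W"
    and mv_bij: "\<lbrakk>g \<in> carrier G; U \<in> \<SS>\<rbrakk> \<Longrightarrow>
          bij_betw (mv g U) (mspace (C U)) (mspace (C (act g U)))"
    and mv_isometry: "\<lbrakk>g \<in> carrier G; U \<in> \<SS>; p \<in> mspace (C U); q \<in> mspace (C U)\<rbrakk> \<Longrightarrow>
          mdist (C (act g U)) (mv g U p) (mv g U q) = mdist (C U) p q"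
    and mv_mult: "\<lbrakk>g \<in> carrier G; h \<in> carrier G; U \<in> \<SS>; p \<in> mspace (C U)\<rbrakk> \<Longrightarrow>
          mv (g \<otimes> h) U p = mv g (act h U) (mv h U p)"
    and mv_proj: "\<lbrakk>g \<in> carrier G; x \<in> carrier G; U \<in> \<SS>\<rbrakk> \<Longrightarrow>
          mv g U (\<pi> U x) = \<pi> (act g U) (g \<otimes> x)"
    and mv_rho: "\<lbrakk>g \<in> carrier G; U \<in> \<SS>; V \<in> \<SS>;
          transverse nest orth U V \<or> pnested nest V U\<rbrakk> \<Longrightarrow>
          mv g U ` rho V U = rho (act g V) (act g U)"
    and E_unbounded: "\<lbrakk>U \<in> \<SS>; mdiam (C U) (mspace (C U)) > ennreal E\<rbrakk> \<Longrightarrow>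
          mdiam (C U) (mspace (C U)) = \<infinity>"

definition eyries :: "'d set \<Rightarrow> ('d \<Rightarrow> 'p metric) \<Rightarrow> ('d \<Rightarrow> 'd \<Rightarrow> bool) \<Rightarrow> 'd set" where
  "eyries \<SS> C nest =
     {U \<in> \<SS>. \<not> bounded_space (C U) \<and>
        (\<forall>V\<in>\<SS>. \<not> bounded_space (C V) \<and> nest U V \<longrightarrow> V = U)}"

text \<open>Eyries are also introduced as a set of pairwise orthogonal unbounded domains in which every
  unbounded domain is nested; any such set is the set of maximal unbounded domains.\<close>

lemma (in HHS) eyries_unique:
  assumes "\<E> \<subseteq> \<SS>" "pairwise orth \<E>" "\<And>U. U \<in> \<E> \<Longrightarrow> \<not> bounded_space (C U)"
    and "\<And>U. U \<in> \<SS> \<Longrightarrow> \<not> bounded_space (C U) \<Longrightarrow> \<exists>W\<in>\<E>. nest U W"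
  shows "\<E> = eyries \<SS> C nest"
proof (intro equalityI subsetI)
  fix U assume "U \<in> eyries \<SS> C nest"
  then have U: "U \<in> \<SS>" "\<not> bounded_space (C U)"
    and max: "\<And>V. \<lbrakk>V \<in> \<SS>; \<not> bounded_space (C V); nest U V\<rbrakk> \<Longrightarrow> V = U"
    unfolding eyries_def by blast+
  obtain W where "W \<in> \<E>" "nest U W" using assms(4) U by blast
  then show "U \<in> \<E>" using max[of W] assms(1,3) by auto
next
  fix W assume W: "W \<in> \<E>"
  have "V = W" if V: "V \<in> \<SS>" "\<not> bounded_space (C V)" "nest W V" for V
  proof -
    obtain W' where W': "W' \<in> \<E>" "nest V W'" using assms(4) V by blast
    have S: "W \<in> \<SS>" "W' \<in> \<SS>" using W W' assms(1) by auto
    have "nest W W'" using nest_trans V W' S by (meson transp_onD)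
    then have "W = W'" using orth_incomparable[of W W'] S W W' assms(2)
      unfolding pairwise_def by blast
    then show ?thesis using nest_antisym V W' S by (meson antisymp_onD)
  qed
  then show "W \<in> eyries \<SS> C nest" using W assms(1,3) unfolding eyries_def by blast
qed


section \<open>Virtually abelian groups and rank\<close>

definition abelian_finite_index :: "('g, 'b) monoid_scheme \<Rightarrow> 'g set \<Rightarrow> bool" where
  "abelian_finite_index G H \<longleftrightarrow>
     subgroup H G \<and> comm_group (G\<lparr>carrier := H\<rparr>) \<and> finite (rcosets\<^bsub>G\<^esub> H)"

definition virtually_abelian :: "('g, 'b) monoid_scheme \<Rightarrow> bool" where
  "virtually_abelian G \<longleftrightarrow> (\<exists>H. abelian_finite_index G H)"

definition int_independent :: "('g, 'b) monoid_scheme \<Rightarrow> 'g set \<Rightarrow> bool" where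
  "int_independent K B \<longleftrightarrow>
     B \<subseteq> carrier K \<and> finite B \<and>
     (\<forall>n :: 'g \<Rightarrow> int. finprod K (\<lambda>b. b [^]\<^bsub>K\<^esub> n b) B = \<one>\<^bsub>K\<^esub> \<longrightarrow> (\<forall>b\<in>B. n b = 0))"

text \<open>The rank of an abelian group, i.e. the dimension of its tensor product with the rationals;
  torsion does not contribute.\<close>

definition abelian_rank :: "('g, 'b) monoid_scheme \<Rightarrow> enat" where
  "abelian_rank K = (SUP B \<in> {B. int_independent K B}. enat (card B))"

end

theory Submission
  imports Defs
begin

text \<open>For a domain \<open>U\<close> let \<open>d\<^sub>U\<close> be the distance of projections to \<open>C U\<close>, and call an unbounded domain
  an eyrie if it is maximal among the unbounded ones.

  By large links and finite complexity, two points of the group are far apart in boundedly many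
  eyries (\<open>unbounded_cover\<close>, \<open>eyries_far_apart_bound\<close>). If an eyrie had an infinite orbit, a product of
  elements, separated by short elements that move their finite sets of eyries off each other, would
  move the base point far in arbitrarily many eyries (\<open>eyrie_orbit_finite\<close>). So eyries form a finite
  set, and a subgroup of finite index fixes all of them. If two of them were transverse, it would
  preserve the bounded set that one determines in the other, which is impossible for a
  coarsely dense orbit. Hence eyries are pairwise orthogonal (\<open>Eys_orthogonal\<close>).

  If \<open>G\<close> has an abelian subgroup of finite index, then such a subgroup acts with coarsely dense orbits
  on every eyrie \<open>W\<close>, and each of its elements moves all points of an orbit by the same
  amount. In a hyperbolic geodesic space this leaves room for a line only (\<open>line_coordinate\<close>).

  Suppose conversely that all eyries are quasilines. Then they are the only unbounded domains: for an
  unbounded domain \<open>U\<close> properly nested in an eyrie \<open>W\<close> there are elements that move the base point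
  arbitrarily far in \<open>U\<close> but little in \<open>W\<close>. As bounded sets of a quasiline are coarsely finite,
  infinitely many of them differ only by elements that fix \<open>U\<close> and a translate of \<open>U\<close> transverse to it,
  and these have bounded orbits in \<open>C U\<close> (\<open>no_unbounded_below_quasiline\<close>). So the uniqueness axiom
  shows that few elements move the base point little in all eyries. On each quasiline a subgroup of
  finite index acts by coarse translations, which commute up to bounded error. So
  this subgroup has finitely many commutators, and a finitely generated group with such a subgroup is
  virtually abelian (\<open>quasilines_imp_virtually_abelian\<close>).

  The coordinates on the \<open>n\<close> eyries embed \<open>G\<close> coarsely in \<open>n\<close>-dimensional space. Counting elements
  shows that balls grow at most like polynomials of degree \<open>n\<close>, which bounds the rank of an
  abelian subgroup from above (\<open>independent_card_le\<close>). As eyries are orthogonal, partial realisation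
  provides elements that translate far along any one of them and little along the others, which
  bounds the rank from below (\<open>independent_exists\<close>).\<close>

section \<open>Coarse geometry\<close>

lemma unbounded_far:
  assumes "\<not> bounded_space m" "p \<in> mspace m"
  obtains q where "q \<in> mspace m" "mdist m p q > B"
proof -
  interpret Metric_space "mspace m" "mdist m" by simp
  have "\<not> (\<forall>x\<in>mspace m. mdist m p x \<le> B)"
    using assms mbounded unfolding bounded_space_def by blast
  then show ?thesis using that by (auto simp: not_le)
qed

lemma bounded_spaceI:
  assumes "\<And>x y. x \<in> mspace m \<Longrightarrow> y \<in> mspace m \<Longrightarrow> mdist m x y \<le> B"
  shows "bounded_space m"
proof -
  interpret Metric_space "mspace m" "mdist m" by simp
  show ?thesis using assms mbounded_alt unfolding bounded_space_def by blast
qed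

lemma mset_dist_witness:
  assumes "A \<noteq> {}" "B \<noteq> {}" "mset_dist m A B < r"
  obtains a b where "a \<in> A" "b \<in> B" "mdist m a b < r"
proof -
  have "\<exists>x\<in>(\<lambda>(a, b). mdist m a b) ` (A \<times> B). x < r"
    using assms unfolding mset_dist_def by (intro cInf_lessD) auto
  then show ?thesis using that by auto
qed

lemma mdist_le_mdiam:
  assumes "mdiam m A \<le> ennreal r" "0 \<le> r" "a \<in> A" "b \<in> A"
  shows "mdist m a b \<le> r"
proof -
  have "ennreal (mdist m a b) \<le> mdiam m A"
    unfolding mdiam_def using assms by (intro SUP_upper2[of "(a,b)"]) auto
  then show ?thesis using assms by (meson ennreal_le_iff order_trans)
qed

lemma mdiam_le_dist:
  assumes "\<And>a b. a \<in> A \<Longrightarrow> b \<in> A \<Longrightarrow> mdist m a b \<le> r"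
  shows "mdiam m A \<le> ennreal r"
  unfolding mdiam_def using assms by (intro SUP_least) (auto intro!: ennreal_leI)

lemma geodesic_pathE:
  fixes m :: "'p metric"
  assumes "geodesic_space m" "x \<in> mspace m" "y \<in> mspace m"
  obtains \<gamma> :: "real \<Rightarrow> 'p" where
    "\<And>s. 0 \<le> s \<Longrightarrow> s \<le> mdist m x y \<Longrightarrow> \<gamma> s \<in> mspace m"
    "\<And>s t. 0 \<le> s \<Longrightarrow> s \<le> mdist m x y \<Longrightarrow> 0 \<le> t \<Longrightarrow> t \<le> mdist m x y \<Longrightarrow>
        mdist m (\<gamma> s) (\<gamma> t) = \<bar>s - t\<bar>"
    "\<gamma> 0 = x" "\<gamma> (mdist m x y) = y"
    "geodesic_segment m x y (\<gamma> ` {0..mdist m x y})"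
proof -
  obtain S where "geodesic_segment m x y S"
    using assms unfolding geodesic_space_def by blast
  then obtain L and \<gamma> :: "real \<Rightarrow> 'p" where \<gamma>: "L \<ge> 0" "\<gamma> ` {0..L} \<subseteq> mspace m"
    "\<forall>s\<in>{0..L}. \<forall>t\<in>{0..L}. mdist m (\<gamma> s) (\<gamma> t) = \<bar>s - t\<bar>" "\<gamma> 0 = x" "\<gamma> L = y"
    "S = \<gamma> ` {0..L}"
    unfolding geodesic_segment_def by blast
  have L: "mdist m x y = L" using \<gamma> by (metis abs_minus_commute abs_of_nonneg atLeastAtMost_iff
        diff_zero order_refl)
  show ?thesis
    by (rule that[of \<gamma>], unfold L) (use \<gamma> \<open>geodesic_segment m x y S\<close> in auto)
qed

lemma geodesic_segment_point:
  fixes m :: "'p metric"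
  assumes "geodesic_segment m x y S" "p \<in> S"
  shows "p \<in> mspace m" "mdist m x p + mdist m p y = mdist m x y"
proof -
  from assms(1) obtain L and \<gamma> :: "real \<Rightarrow> 'p" where \<gamma>: "L \<ge> 0" "\<gamma> ` {0..L} \<subseteq> mspace m"
    "\<forall>s\<in>{0..L}. \<forall>t\<in>{0..L}. mdist m (\<gamma> s) (\<gamma> t) = \<bar>s - t\<bar>" "\<gamma> 0 = x" "\<gamma> L = y"
    "S = \<gamma> ` {0..L}"
    unfolding geodesic_segment_def by blast
  obtain s where s: "s \<in> {0..L}" "p = \<gamma> s" using assms \<gamma> by auto
  show "p \<in> mspace m" using s \<gamma> by auto
  have "mdist m x p = s" "mdist m p y = L - s" "mdist m x y = L"
    using \<gamma>(3)[rule_format, of 0 s] \<gamma>(3)[rule_format, of s L] \<gamma>(3)[rule_format, of 0 L] s \<gamma>(1,4,5)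
    by auto
  then show "mdist m x p + mdist m p y = mdist m x y" by simp
qed

lemma geodesic_segment_ends:
  assumes "geodesic_segment m x y S"
  shows "x \<in> S" "y \<in> S"
  using assms unfolding geodesic_segment_def by force+

lemma geodesic_segment_sym:
  assumes "geodesic_segment m x y S"
  shows "geodesic_segment m y x S"
proof -
  from assms obtain L and \<gamma> :: "real \<Rightarrow> 'a" where \<gamma>: "L \<ge> 0" "\<gamma> ` {0..L} \<subseteq> mspace m"
    "\<forall>s\<in>{0..L}. \<forall>t\<in>{0..L}. mdist m (\<gamma> s) (\<gamma> t) = \<bar>s - t\<bar>" "\<gamma> 0 = x" "\<gamma> L = y"
    "S = \<gamma> ` {0..L}"
    unfolding geodesic_segment_def by blast
  define \<gamma>' where "\<gamma>' s = \<gamma> (L - s)" for s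
  have "(\<lambda>s. L - s) ` {0..L} = {0..L}" by simp
  then have im: "\<gamma>' ` {0..L} = \<gamma> ` {0..L}" unfolding \<gamma>'_def by (metis image_image)
  have "mdist m (\<gamma>' s) (\<gamma>' t) = \<bar>s - t\<bar>" if "s \<in> {0..L}" "t \<in> {0..L}" for s t
    unfolding \<gamma>'_def using \<gamma>(3)[rule_format, of "L - s" "L - t"] that by simp
  moreover have "\<gamma>' 0 = y" "\<gamma>' L = x" unfolding \<gamma>'_def using \<gamma>(4,5) by simp_all
  ultimately have "0 \<le> L \<and> \<gamma>' ` {0..L} \<subseteq> mspace m \<and>
      (\<forall>s\<in>{0..L}. \<forall>t\<in>{0..L}. mdist m (\<gamma>' s) (\<gamma>' t) = \<bar>s - t\<bar>) \<and>
      \<gamma>' 0 = y \<and> \<gamma>' L = x \<and> S = \<gamma>' ` {0..L}"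
    using \<gamma>(1,2,6) im by simp
  then show ?thesis unfolding geodesic_segment_def by blast
qed

text \<open>A discrete substitute for the connectedness of an interval: walking from \<open>0\<close> in unit
  steps, either \<open>P\<close> persists up to within one step of \<open>L\<close>, or some step leaves \<open>P\<close>.\<close>

lemma unit_step_crossing:
  fixes L :: real
  assumes "0 \<le> L" "P 0"
  shows "\<exists>s t. 0 \<le> s \<and> s \<le> L \<and> 0 \<le> t \<and> t \<le> L \<and> \<bar>s - t\<bar> \<le> 1 \<and> P s \<and> (t = L \<or> \<not> P t)"
proof (rule ccontr)
  assume neg: "\<not> ?thesis"
  have step: "t \<noteq> L \<and> P t" if "0 \<le> s" "s \<le> L" "0 \<le> t" "t \<le> L" "\<bar>s - t\<bar> \<le> 1" "P s" for s t
    using that neg by blast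
  have "real n \<le> L \<Longrightarrow> P (real n)" for n
  proof (induction n)
    case (Suc n)
    then show ?case using step[of "real n" "real (Suc n)"] by auto
  qed (use assms in simp)
  then have "real (nat \<lfloor>L\<rfloor>) \<le> L \<Longrightarrow> P (real (nat \<lfloor>L\<rfloor>))" by blast
  moreover have "real (nat \<lfloor>L\<rfloor>) \<le> L" "\<bar>real (nat \<lfloor>L\<rfloor>) - L\<bar> \<le> 1"
    using assms(1) by linarith+
  ultimately show False using step[of "real (nat \<lfloor>L\<rfloor>)" L] assms(1) by auto
qed

subsection \<open>The four-point inequality\<close>

lemma slim_witness:
  assumes "hyperbolic \<delta> m" "geodesic_segment m x y S1" "geodesic_segment m y z S2"
    "geodesic_segment m x z S3" "p \<in> S1"
  obtains r where "r \<in> S2 \<union> S3" "mdist m p r < \<delta> + 1"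
proof -
  have "p \<in> mnbhd m \<delta> (S2 \<union> S3)" using assms unfolding hyperbolic_def by blast
  then have "mset_dist m {p} (S2 \<union> S3) < \<delta> + 1" unfolding mnbhd_def by auto
  then show ?thesis using that mset_dist_witness[of "{p}" "S2 \<union> S3" m "\<delta> + 1"]
      geodesic_segment_ends[OF assms(3)] by blast
qed

text \<open>A point \<open>q\<close> of \<open>[x, z]\<close> that is close to both \<open>[x, w]\<close> and \<open>[z, w]\<close> realises, up to a constant,
  the Gromov product of \<open>x\<close> and \<open>z\<close> based at \<open>w\<close> as its distance from \<open>w\<close>. Slimness of a second
  triangle moves this point to another side \<open>[x, y]\<close> or \<open>[y, z]\<close>.\<close>

lemma hyperbolic_four_point:
  fixes m :: "'p metric"
  assumes geo: "geodesic_space m" and hyp: "hyperbolic \<delta> m"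
    and M: "x \<in> mspace m" "y \<in> mspace m" "z \<in> mspace m" "w \<in> mspace m"
  shows "mdist m x z + mdist m y w
    \<le> max (mdist m x y + mdist m z w) (mdist m y z + mdist m x w) + (6 * \<delta> + 8)"
proof -
  let ?d = "mdist m"
  obtain \<gamma> where \<gamma>: "\<And>s. 0 \<le> s \<Longrightarrow> s \<le> ?d x z \<Longrightarrow> \<gamma> s \<in> mspace m"
    "\<And>s t. 0 \<le> s \<Longrightarrow> s \<le> ?d x z \<Longrightarrow> 0 \<le> t \<Longrightarrow> t \<le> ?d x z \<Longrightarrow> ?d (\<gamma> s) (\<gamma> t) = \<bar>s - t\<bar>"
    "\<gamma> 0 = x" "\<gamma> (?d x z) = z" and S1: "geodesic_segment m x z (\<gamma> ` {0..?d x z})"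
    by (rule geodesic_pathE[OF geo M(1,3)]) blast
  have seg: "\<exists>S. geodesic_segment m p q S" if "p \<in> mspace m" "q \<in> mspace m" for p q
    using geo that unfolding geodesic_space_def by blast
  obtain S2 where S2: "geodesic_segment m z w S2" using seg M by blast
  obtain S3 where S3: "geodesic_segment m x w S3" using seg M by blast
  obtain S4 where S4: "geodesic_segment m x y S4" using seg M by blast
  obtain S5 where S5: "geodesic_segment m y z S5" using seg M by blast
  note S = S2 S3 S4 S5
  have dpos: "0 < \<delta> + 1"
  proof -
    obtain r where "r \<in> S2 \<union> S3" "?d x r < \<delta> + 1"
      using slim_witness[OF hyp S1 S(1,2)] geodesic_segment_ends[OF S1] by blast
    then show ?thesis using mdist_nonneg[of m x r] by linarith
  qed
  \<comment> \<open>Slimness puts every point of \<open>[x, z]\<close> near \<open>[x, w]\<close> or \<open>[z, w]\<close>; where the side changes,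
    a point is near both.\<close>
  define P where "P s \<longleftrightarrow> (\<exists>a\<in>S3. ?d (\<gamma> s) a < \<delta> + 1)" for s
  have zero: "?d p p = 0" if "p \<in> mspace m" for p using that by simp
  have "?d (\<gamma> 0) x < \<delta> + 1" unfolding \<gamma>(3) using zero[OF M(1)] dpos by linarith
  then have "P 0" unfolding P_def using geodesic_segment_ends(1)[OF S(2)] by blast
  then obtain s t where st: "0 \<le> s" "s \<le> ?d x z" "0 \<le> t" "t \<le> ?d x z" "\<bar>s - t\<bar> \<le> 1"
    "P s" "t = ?d x z \<or> \<not> P t"
    using unit_step_crossing[of "?d x z" P] by auto
  have "\<exists>b\<in>S2. ?d (\<gamma> t) b < \<delta> + 1"
  proof (cases "P t")
    case True
    then have tz: "\<gamma> t = z" using st(7) \<gamma>(4) by metis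
    have "?d (\<gamma> t) z < \<delta> + 1" unfolding tz using zero[OF M(3)] dpos by linarith
    then show ?thesis using geodesic_segment_ends(1)[OF S(1)] by blast
  next
    case False
    have "\<gamma> t \<in> \<gamma> ` {0..?d x z}" using st by auto
    from slim_witness[OF hyp S1 S(1,2) this] False show ?thesis unfolding P_def by blast
  qed
  then obtain b where b: "b \<in> S2" "?d (\<gamma> t) b < \<delta> + 1" by blast
  obtain a where a: "a \<in> S3" "?d (\<gamma> s) a < \<delta> + 1" using st P_def by blast
  define q where "q = \<gamma> s"
  have q: "q \<in> \<gamma> ` {0..?d x z}" "q \<in> mspace m" "\<gamma> t \<in> mspace m"
    using st \<gamma>(1) q_def by auto
  have aM: "a \<in> mspace m" "?d x a + ?d a w = ?d x w"
    using geodesic_segment_point[OF S(2) a(1)] by auto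
  have bM: "b \<in> mspace m" "?d z b + ?d b w = ?d z w"
    using geodesic_segment_point[OF S(1) b(1)] by auto
  have qz: "?d x q + ?d q z = ?d x z" using geodesic_segment_point[OF S1 q(1)] by auto
  have qt: "?d q (\<gamma> t) \<le> 1" using \<gamma>(2)[OF st(1-4)] st q_def by auto
  have qb: "?d q b < \<delta> + 2" using mdist_triangle[OF q(2,3) bM(1)] b(2) qt by linarith
  have qa: "?d q a < \<delta> + 1" using a(2) unfolding q_def .
  have "?d q w \<le> ?d q a + ?d a w" "?d x q \<le> ?d x a + ?d a q" "?d a q = ?d q a"
    using mdist_triangle[OF q(2) aM(1) M(4)] mdist_triangle[OF M(1) aM(1) q(2)] mdist_commute by auto
  then have i1: "?d x q + ?d q w \<le> ?d x w + 2 * \<delta> + 2" using qa aM(2) by linarith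
  have "?d q w \<le> ?d q b + ?d b w" "?d z q \<le> ?d z b + ?d b q" "?d b q = ?d q b" "?d z q = ?d q z"
    using mdist_triangle[OF q(2) bM(1) M(4)] mdist_triangle[OF M(3) bM(1) q(2)] mdist_commute by auto
  then have i2: "?d q z + ?d q w \<le> ?d z w + 2 * \<delta> + 4" using qb bM(2) by linarith
  have 1: "2 * ?d q w + ?d x z \<le> ?d x w + ?d z w + 4 * \<delta> + 6" using i1 i2 qz by linarith
  obtain r where r: "r \<in> S5 \<union> S4" "?d q r < \<delta> + 1"
    using slim_witness[OF hyp S1 geodesic_segment_sym[OF S5] S4 q(1)] by blast
  from r(1) show ?thesis
  proof
    assume "r \<in> S4"
    then have rM: "r \<in> mspace m" "?d x r + ?d r y = ?d x y"
      using geodesic_segment_point[OF S(3)] by auto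
    have "?d x w \<le> ?d x r + ?d r w" "?d y w \<le> ?d y r + ?d r w" "?d r w \<le> ?d r q + ?d q w"
      "?d r y = ?d y r" "?d r q = ?d q r"
      using mdist_triangle[OF M(1) rM(1) M(4)] mdist_triangle[OF M(2) rM(1) M(4)]
        mdist_triangle[OF rM(1) q(2) M(4)] mdist_commute by auto
    then have "?d x w + ?d y w \<le> ?d x y + 2 * ?d q w + 2 * \<delta> + 2" using r(2) rM(2) by linarith
    then have "?d x z + ?d y w \<le> ?d x y + ?d z w + (6 * \<delta> + 8)" using 1 by linarith
    then show ?thesis by linarith
  next
    assume "r \<in> S5"
    then have rM: "r \<in> mspace m" "?d y r + ?d r z = ?d y z"
      using geodesic_segment_point[OF S(4)] by auto
    have "?d z w \<le> ?d z r + ?d r w" "?d y w \<le> ?d y r + ?d r w" "?d r w \<le> ?d r q + ?d q w"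
      "?d r z = ?d z r" "?d r q = ?d q r"
      using mdist_triangle[OF M(3) rM(1) M(4)] mdist_triangle[OF M(2) rM(1) M(4)]
        mdist_triangle[OF rM(1) q(2) M(4)] mdist_commute by auto
    then have "?d z w + ?d y w \<le> ?d y z + 2 * ?d q w + 2 * \<delta> + 2" using r(2) rM(2) by linarith
    then have "?d x z + ?d y w \<le> ?d y z + ?d x w + (6 * \<delta> + 8)" using 1 by linarith
    then show ?thesis by linarith
  qed
qed

subsection \<open>Rough isometries to the line\<close>

text \<open>In a geodesic space quasiisometric to the line, a geodesic passes close to every point
  that lies between its ends, so distances are additive along the line up to a constant.
  Hence the signed distance from a base point preserves distances up to an additive error
  alone.\<close>

lemma quasiline_rough_isometry:
  fixes m :: "'p metric"
  assumes geo: "geodesic_space m" and ql: "quasiline m" and e: "e \<in> mspace m"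
  obtains f :: "'p \<Rightarrow> real" and C where "C \<ge> 0"
    "\<And>p q. p \<in> mspace m \<Longrightarrow> q \<in> mspace m \<Longrightarrow> \<bar>\<bar>f p - f q\<bar> - mdist m p q\<bar> \<le> C"
proof -
  let ?d = "mdist m"
  obtain K c and F :: "'p \<Rightarrow> real" where
    KF: "qi_embedding_on K c m (mspace m) (euclidean_metric :: real metric) F"
    using ql unfolding quasiline_def quasi_isometric_def by blast
  have K: "K \<ge> 1" "c \<ge> 0" using KF unfolding qi_embedding_on_def by auto
  have F: "?d x y / K - c \<le> \<bar>F x - F y\<bar>" "\<bar>F x - F y\<bar> \<le> K * ?d x y + c"
    if "x \<in> mspace m" "y \<in> mspace m" for x y
    using KF that unfolding qi_embedding_on_def by (auto simp: dist_real_def)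
  have Fle: "?d x y \<le> K * (\<bar>F x - F y\<bar> + c)" if "x \<in> mspace m" "y \<in> mspace m" for x y
    using F(1)[OF that] K by (simp add: field_simps)
  \<comment> \<open>A unit step along a geodesic changes \<open>F\<close> by at most \<open>K + c\<close>, so the geodesic has a point
    with almost the same value of \<open>F\<close> as \<open>r\<close>, and the quasiisometry bound makes it close to \<open>r\<close>.\<close>
  define C1 where "C1 = K * (K + 2 * c)"
  have between: "?d p r + ?d r q \<le> ?d p q + 2 * C1"
    if M: "p \<in> mspace m" "q \<in> mspace m" "r \<in> mspace m" and le: "F p \<le> F r" "F r \<le> F q" for p q r
  proof -
    obtain \<gamma> where \<gamma>: "\<And>s. 0 \<le> s \<Longrightarrow> s \<le> ?d p q \<Longrightarrow> \<gamma> s \<in> mspace m"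
      "\<And>s t. 0 \<le> s \<Longrightarrow> s \<le> ?d p q \<Longrightarrow> 0 \<le> t \<Longrightarrow> t \<le> ?d p q \<Longrightarrow> ?d (\<gamma> s) (\<gamma> t) = \<bar>s - t\<bar>"
      "\<gamma> 0 = p" "\<gamma> (?d p q) = q"
      by (rule geodesic_pathE[OF geo M(1,2)]) blast
    obtain s t where st: "0 \<le> s" "s \<le> ?d p q" "0 \<le> t" "t \<le> ?d p q" "\<bar>s - t\<bar> \<le> 1"
      "F (\<gamma> s) \<le> F r" "t = ?d p q \<or> \<not> F (\<gamma> t) \<le> F r"
      using unit_step_crossing[of "?d p q" "\<lambda>s. F (\<gamma> s) \<le> F r"] le(1) \<gamma>(3) by auto
    have "F (\<gamma> t) \<ge> F r" using st(7) \<gamma>(4) le by auto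
    moreover have "\<bar>F (\<gamma> s) - F (\<gamma> t)\<bar> \<le> K * 1 + c"
    proof -
      have "?d (\<gamma> s) (\<gamma> t) \<le> 1" using \<gamma>(2)[OF st(1-4)] st(5) by simp
      then have "K * ?d (\<gamma> s) (\<gamma> t) \<le> K * 1" using K(1) by (intro mult_left_mono) auto
      then show ?thesis using F(2)[OF \<gamma>(1)[OF st(1,2)] \<gamma>(1)[OF st(3,4)]] by linarith
    qed
    ultimately have "\<bar>F (\<gamma> s) - F r\<bar> \<le> K + c" using st(6) by linarith
    then have "K * (\<bar>F (\<gamma> s) - F r\<bar> + c) \<le> C1" unfolding C1_def
      using K by (intro mult_left_mono) auto
    then have dr: "?d (\<gamma> s) r \<le> C1" using Fle[of "\<gamma> s" r] \<gamma>(1)[OF st(1,2)] M by linarith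
    have "?d p (\<gamma> s) = s" "?d (\<gamma> s) q = ?d p q - s"
      using \<gamma>(2)[of 0 s] \<gamma>(2)[of s "?d p q"] \<gamma>(3,4) st by auto
    then show ?thesis
      using mdist_triangle[OF M(1) \<gamma>(1)[OF st(1,2)] M(3)] mdist_triangle[OF M(3) \<gamma>(1)[OF st(1,2)] M(2)]
        mdist_commute[of m r "\<gamma> s"] dr by linarith
  qed
  define f where "f p = (if F p \<ge> F e then ?d e p else - ?d e p)" for p
  show ?thesis
  proof (rule that[of "2 * C1" f])
    show "2 * C1 \<ge> 0" unfolding C1_def using K by simp
    fix p q assume M: "p \<in> mspace m" "q \<in> mspace m"
    have tr: "?d p q \<le> ?d e p + ?d e q" "?d e q \<le> ?d e p + ?d p q" "?d e p \<le> ?d e q + ?d p q"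
      "?d q p = ?d p q" "?d p e = ?d e p" "?d q e = ?d e q" "0 \<le> ?d e p" "0 \<le> ?d e q"
      if "p \<in> mspace m" "q \<in> mspace m" "e \<in> mspace m"
      using mdist_triangle[OF that(1,3,2)] mdist_triangle[OF that(3,1,2)]
        mdist_triangle[OF that(3,2,1)] mdist_commute[of m p e] mdist_commute[of m q p]
        mdist_commute[of m q e] mdist_nonneg[of m e p] mdist_nonneg[of m e q] by linarith+
    consider "F e \<le> F p" "F p \<le> F q" | "F e \<le> F q" "F q \<le> F p" | "F p \<le> F q" "F q < F e"
      | "F q \<le> F p" "F p < F e" | "F p < F e" "F e \<le> F q" | "F q < F e" "F e \<le> F p"
      by linarith
    then show "\<bar>\<bar>f p - f q\<bar> - ?d p q\<bar> \<le> 2 * C1"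
    proof cases
      case 1
      then have "f p = ?d e p" "f q = ?d e q" unfolding f_def by auto
      then show ?thesis using between[OF e M(2) M(1) 1] tr[OF M e] by linarith
    next
      case 2
      then have "f p = ?d e p" "f q = ?d e q" unfolding f_def by auto
      then show ?thesis using between[OF e M(1) M(2) 2] tr[OF M e] by linarith
    next
      case 3
      then have "f p = - ?d e p" "f q = - ?d e q" unfolding f_def by auto
      then show ?thesis using between[OF M(1) e M(2)] 3 tr[OF M e] by linarith
    next
      case 4
      then have "f p = - ?d e p" "f q = - ?d e q" unfolding f_def by auto
      then show ?thesis using between[OF M(2) e M(1)] 4 tr[OF M e] by linarith
    next
      case 5
      then have "f p = - ?d e p" "f q = ?d e q" unfolding f_def by auto
      then show ?thesis using between[OF M(1) M(2) e] 5 tr[OF M e] by linarith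
    next
      case 6
      then have "f p = ?d e p" "f q = - ?d e q" unfolding f_def by auto
      then show ?thesis using between[OF M(2) M(1) e] 6 tr[OF M e] by linarith
    qed
  qed
qed

lemma quasilineI:
  fixes f :: "'p \<Rightarrow> real"
  assumes "C \<ge> 0"
    and "\<And>p q. p \<in> mspace m \<Longrightarrow> q \<in> mspace m \<Longrightarrow> \<bar>\<bar>f p - f q\<bar> - mdist m p q\<bar> \<le> C"
    and "\<And>s. \<exists>p\<in>mspace m. \<bar>s - f p\<bar> \<le> C"
  shows "quasiline m"
proof -
  have "qi_embedding_on 1 C m (mspace m) (euclidean_metric :: real metric) f"
    unfolding qi_embedding_on_def
  proof (intro conjI ballI)
    fix x y assume M: "x \<in> mspace m" "y \<in> mspace m"
    show "mdist m x y / 1 - C \<le> mdist euclidean_metric (f x) (f y)"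
      "mdist euclidean_metric (f x) (f y) \<le> 1 * mdist m x y + C"
      using assms(2)[OF M] by (simp_all add: dist_real_def)
  qed (use assms(1) in auto)
  moreover have "\<forall>q\<in>mspace euclidean_metric. \<exists>p\<in>mspace m. mdist euclidean_metric q (f p) \<le> C"
    using assms(3) by (simp add: dist_real_def)
  ultimately show ?thesis unfolding quasiline_def quasi_isometric_def by blast
qed

section \<open>Abelian groups with a hyperbolic norm\<close>

text \<open>\<open>N\<close> is the distance from a base point to its translates under an abelian group of isometries of
  a hyperbolic geodesic space with an \<open>R\<close>-dense orbit, so that \<open>N (inv x \<otimes> y)\<close> is the distance
  between the translates by \<open>x\<close> and \<open>y\<close>. Commutativity means that an element moves all points of
  the orbit by the same amount. This excludes bounded and parabolic behaviour, and what
  remains is a line.\<close>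

locale hyperbolic_abelian_norm = comm_group G for G (structure) +
  fixes N :: "'a \<Rightarrow> real" and C R :: real
  assumes N_nonneg: "x \<in> carrier G \<Longrightarrow> 0 \<le> N x"
    and N_one: "N \<one> = 0"
    and N_inv: "x \<in> carrier G \<Longrightarrow> N (inv x) = N x"
    and N_mult: "x \<in> carrier G \<Longrightarrow> y \<in> carrier G \<Longrightarrow> N (x \<otimes> y) \<le> N x + N y"
    and four_point: "\<lbrakk>x \<in> carrier G; y \<in> carrier G; z \<in> carrier G; w \<in> carrier G\<rbrakk> \<Longrightarrow>
        N (inv x \<otimes> z) + N (inv y \<otimes> w)
        \<le> max (N (inv x \<otimes> y) + N (inv z \<otimes> w)) (N (inv y \<otimes> z) + N (inv x \<otimes> w)) + C"
    and coarse_geodesic: "\<lbrakk>g \<in> carrier G; 0 \<le> t; t \<le> N g\<rbrakk> \<Longrightarrow>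
        \<exists>k\<in>carrier G. \<bar>N k - t\<bar> \<le> R \<and> \<bar>N (inv k \<otimes> g) - (N g - t)\<bar> \<le> R"
    and unbounded: "\<exists>g\<in>carrier G. N g > B"
begin

lemma R_nonneg: "0 \<le> R"
  using coarse_geodesic[of \<one> 0] N_one by force

lemma C_nonneg: "0 \<le> C"
  using four_point[of \<one> \<one> \<one> \<one>] N_one by simp

lemma cancel:
  assumes "x \<in> carrier G" "y \<in> carrier G"
  shows "x \<otimes> (inv x \<otimes> y) = y" "inv x \<otimes> (x \<otimes> y) = y" "inv (x \<otimes> y) \<otimes> y = inv x"
proof -
  show "x \<otimes> (inv x \<otimes> y) = y" "inv x \<otimes> (x \<otimes> y) = y"
    using assms m_assoc[of x "inv x" y] m_assoc[of "inv x" x y] by auto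
  have "inv (x \<otimes> y) \<otimes> y = inv x \<otimes> (inv y \<otimes> y)"
    unfolding inv_mult[OF assms] using assms by (intro m_assoc) auto
  then show "inv (x \<otimes> y) \<otimes> y = inv x" using assms by simp
qed

lemma N_diff_commute:
  assumes "x \<in> carrier G" "y \<in> carrier G"
  shows "N (inv x \<otimes> y) = N (inv y \<otimes> x)"
  using N_inv[of "inv x \<otimes> y"] assms by (simp add: inv_mult m_comm)

lemma N_triangle:
  assumes "x \<in> carrier G" "y \<in> carrier G" "z \<in> carrier G"
  shows "N (inv x \<otimes> z) \<le> N (inv x \<otimes> y) + N (inv y \<otimes> z)"
proof -
  have "(inv x \<otimes> y) \<otimes> (inv y \<otimes> z) = inv x \<otimes> z"
    using assms cancel(1)[of y z] by (simp add: m_assoc)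
  then show ?thesis using N_mult[of "inv x \<otimes> y" "inv y \<otimes> z"] assms by simp
qed

lemma N_triangle_mult:
  assumes "x \<in> carrier G" "y \<in> carrier G" "z \<in> carrier G"
  shows "N (x \<otimes> z) \<le> N (inv y \<otimes> x) + N (y \<otimes> z)"
  using N_triangle[of "inv x" "inv y" z] assms by (simp add: m_comm)

lemma N_diff_le:
  assumes "x \<in> carrier G" "y \<in> carrier G"
  shows "N (inv x \<otimes> y) \<le> N x + N y" "N x \<le> N (inv x \<otimes> y) + N y" "N y \<le> N (inv x \<otimes> y) + N x"
proof -
  show "N (inv x \<otimes> y) \<le> N x + N y" using N_mult[of "inv x" y] N_inv assms by simp
  show "N y \<le> N (inv x \<otimes> y) + N x" using N_mult[of x "inv x \<otimes> y"] cancel(1) assms by simp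
  show "N x \<le> N (inv x \<otimes> y) + N y"
    using N_mult[of y "inv y \<otimes> x"] cancel(1) N_diff_commute assms by simp
qed

lemma parallelogram:
  assumes h: "h \<in> carrier G" and k: "k \<in> carrier G"
  shows "N (h \<otimes> k) + N (inv h \<otimes> k) \<le> 2 * max (N h) (N k) + C"
  using four_point[of \<one> h "h \<otimes> k" k] cancel[OF h k] N_inv h k by simp

lemma square_four_point:
  assumes "a \<in> carrier G" "h \<in> carrier G"
  shows "N (a \<otimes> a) + N h \<le> N a + max (N (a \<otimes> h)) (N (inv a \<otimes> h)) + C"
  using four_point[of "inv a" \<one> a h] assms by simp

lemma square_triangle:
  assumes h: "h \<in> carrier G" and k: "k \<in> carrier G"
  shows "N (h \<otimes> h) \<le> N (k \<otimes> k) + 2 * N (inv k \<otimes> h)" "N (h \<otimes> h) \<le> N (k \<otimes> k) + 2 * N (k \<otimes> h)"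
    "N (h \<otimes> h) \<le> N (h \<otimes> k) + N (inv h \<otimes> k)"
proof -
  have hkk: "(inv k \<otimes> h) \<otimes> (inv k \<otimes> h) = inv k \<otimes> inv k \<otimes> (h \<otimes> h)" if "k \<in> carrier G" for k
    using h that by (simp add: m_ac)
  have 1: "N (h \<otimes> h) \<le> N (k \<otimes> k) + 2 * N (inv k \<otimes> h)" if k: "k \<in> carrier G" for k
    using N_diff_le(3)[of "k \<otimes> k" "h \<otimes> h"] N_mult[of "inv k \<otimes> h" "inv k \<otimes> h"] hkk[OF k] h k
    by (simp add: inv_mult)
  show "N (h \<otimes> h) \<le> N (k \<otimes> k) + 2 * N (inv k \<otimes> h)" by (rule 1[OF k])
  show "N (h \<otimes> h) \<le> N (k \<otimes> k) + 2 * N (k \<otimes> h)"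
    using 1[of "inv k"] N_inv[of "k \<otimes> k"] k by (simp add: inv_mult)
  show "N (h \<otimes> h) \<le> N (h \<otimes> k) + N (inv h \<otimes> k)"
    using N_triangle_mult[of h k h] N_diff_commute[OF h k] h k by (simp add: m_comm)
qed

text \<open>The midpoint \<open>h\<close> of a geodesic from \<open>\<one>\<close> to \<open>g\<close> and its mirror image \<open>inv h \<otimes> g\<close> span a
  thin parallelogram, so they are close and \<open>g\<close> is close to the square of \<open>h\<close>.\<close>

lemma large_element_with_long_square:
  obtains h where "h \<in> carrier G" "N h \<ge> B" "N (h \<otimes> h) \<ge> 2 * N h - (4 * R + C)"
proof -
  obtain g where g: "g \<in> carrier G" "N g > 2 * (B + R)" using unbounded by blast
  obtain h where h: "h \<in> carrier G" "\<bar>N h - N g / 2\<bar> \<le> R" "\<bar>N (inv h \<otimes> g) - (N g - N g / 2)\<bar> \<le> R"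
    using coarse_geodesic[of g "N g / 2"] N_nonneg[OF g(1)] g(1) by auto
  define k where "k = inv h \<otimes> g"
  have k: "k \<in> carrier G" "h \<otimes> k = g" "\<bar>N k - N g / 2\<bar> \<le> R"
    using h g cancel unfolding k_def by auto
  have "N (inv h \<otimes> k) \<le> 2 * R + C"
    using parallelogram[OF h(1) k(1)] k h(2) by (auto simp: max_def split: if_splits)
  moreover have "g = (h \<otimes> h) \<otimes> (inv h \<otimes> k)"
    using cancel(1)[OF h(1) k(1)] h(1) k by (simp add: m_assoc)
  then have "N g \<le> N (h \<otimes> h) + N (inv h \<otimes> k)"
    using N_mult[of "h \<otimes> h" "inv h \<otimes> k"] h(1) k(1) by simp
  ultimately have "N (h \<otimes> h) \<ge> 2 * N h - (4 * R + C)" using h(2) by linarith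
  moreover have "N h \<ge> B" using h(2) g(2) by (simp add: abs_le_iff field_simps)
  ultimately show ?thesis using that h(1) by blast
qed

text \<open>The four-point inequality for \<open>inv a\<close>, \<open>\<one>\<close>, \<open>a\<close>, \<open>h\<close> makes \<open>h\<close> far from \<open>a\<close> or from \<open>inv a\<close>, and
  then the parallelogram spanned by \<open>a\<close> and \<open>h\<close> makes it close to the other one.\<close>

lemma close_or_opposite:
  assumes a: "a \<in> carrier G" and h: "h \<in> carrier G"
    and sq: "N (a \<otimes> a) \<ge> 2 * N a - c" and "\<bar>N a - N h\<bar> \<le> R"
  shows "N (a \<otimes> h) \<le> c + 3 * R + 2 * C \<or> N (inv a \<otimes> h) \<le> c + 3 * R + 2 * C"
  using parallelogram[OF a h] square_four_point[OF a h] assms(4) sq by linarith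

text \<open>Elements on a geodesic to an element with long square again have long squares, and every
  element is close to one of these or to its inverse. So there are no parabolic directions.\<close>

lemma long_square:
  assumes h: "h \<in> carrier G"
  shows "N (h \<otimes> h) \<ge> 2 * N h - (28 * R + 7 * C)"
proof -
  obtain k where k: "k \<in> carrier G" "N k \<ge> N h" "N (k \<otimes> k) \<ge> 2 * N k - (4 * R + C)"
    using large_element_with_long_square by blast
  obtain a where a: "a \<in> carrier G" "\<bar>N a - N h\<bar> \<le> R" "\<bar>N (inv a \<otimes> k) - (N k - N h)\<bar> \<le> R"
    using coarse_geodesic[OF k(1) N_nonneg[OF h] k(2)] by blast
  have aa: "N (a \<otimes> a) \<ge> 2 * N h - (6 * R + C)"
    using square_triangle(1)[OF k(1) a(1)] a(3) k(3) by linarith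
  then have "N (a \<otimes> a) \<ge> 2 * N a - (8 * R + C)" using a(2) by linarith
  from close_or_opposite[OF a(1) h this a(2)]
  show ?thesis
    using square_triangle(1,2)[OF a(1) h] N_diff_commute[OF a(1) h] m_comm[OF a(1) h] aa
      R_nonneg C_nonneg by auto
qed

text \<open>The shorter element \<open>h\<close> is compared with the point at distance \<open>N h\<close> on a geodesic from \<open>\<one>\<close>
  to \<open>g\<close>.\<close>

lemma same_or_opposite_direction:
  assumes g: "g \<in> carrier G" and h: "h \<in> carrier G"
  shows "N (inv g \<otimes> h) \<le> \<bar>N g - N h\<bar> + (32 * R + 9 * C) \<and> N (g \<otimes> h) \<ge> N g + N h - (60 * R + 16 * C)
    \<or> N (g \<otimes> h) \<le> \<bar>N g - N h\<bar> + (32 * R + 9 * C) \<and> N (inv g \<otimes> h) \<ge> N g + N h - (60 * R + 16 * C)"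
proof -
  have *: "N (inv g \<otimes> h) \<le> N g - N h + (32 * R + 9 * C) \<and> N (g \<otimes> h) \<ge> N g + N h - (60 * R + 16 * C)
    \<or> N (g \<otimes> h) \<le> N g - N h + (32 * R + 9 * C) \<and> N (inv g \<otimes> h) \<ge> N g + N h - (60 * R + 16 * C)"
    if g: "g \<in> carrier G" and h: "h \<in> carrier G" and le: "N h \<le> N g" for g h
  proof -
    obtain a where a: "a \<in> carrier G" "\<bar>N a - N h\<bar> \<le> R" "\<bar>N (inv a \<otimes> g) - (N g - N h)\<bar> \<le> R"
      using coarse_geodesic[OF g N_nonneg[OF h] le] by blast
    from close_or_opposite[OF a(1) h long_square[OF a(1)] a(2)]
    have "N (inv g \<otimes> h) \<le> N g - N h + (32 * R + 9 * C) \<or> N (g \<otimes> h) \<le> N g - N h + (32 * R + 9 * C)"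
      using N_triangle[OF g a(1) h] N_triangle_mult[OF g a(1) h] N_diff_commute[OF g a(1)] a(3)
      by linarith
    then show ?thesis using square_triangle(3)[OF g h] long_square[OF g] by linarith
  qed
  show ?thesis
  proof (cases "N h \<le> N g")
    case True
    then show ?thesis using *[OF g h True] by (elim disjE conjE; linarith)
  next
    case False
    then have "N g \<le> N h" by simp
    from *[OF h g this] show ?thesis
      unfolding N_diff_commute[OF h g] m_comm[OF h g] by (elim disjE conjE; linarith)
  qed
qed

text \<open>The coordinate is the signed norm, the sign telling whether an element points in the direction
  of a fixed long element \<open>k\<close>. Two elements that do so are at distance at most their norms minus
  \<open>2 * N k\<close>, up to a constant, so for long \<open>k\<close> they cannot point in opposite
  directions.\<close>

theorem line_coordinate:
  obtains f :: "'a \<Rightarrow> real" and c where "c \<ge> 0"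
    "\<And>g h. g \<in> carrier G \<Longrightarrow> h \<in> carrier G \<Longrightarrow> \<bar>\<bar>f g - f h\<bar> - N (inv g \<otimes> h)\<bar> \<le> c"
    "\<And>s. \<exists>h\<in>carrier G. \<bar>s - f h\<bar> \<le> c"
proof -
  define c6 where "c6 = 32 * R + 9 * C"
  define c7 where "c7 = 60 * R + 16 * C"
  have c: "c6 \<ge> 0" "c7 \<ge> 0" "R \<le> c7" "28 * R + 7 * C \<le> c7"
    unfolding c6_def c7_def using R_nonneg C_nonneg by auto
  note dich = same_or_opposite_direction[folded c6_def c7_def]
  obtain k where k: "k \<in> carrier G" "N k > 2 * c6 + 2 * c7" using unbounded by blast
  define f where "f h = (if N (inv k \<otimes> h) \<le> N (k \<otimes> h) then N h else - N h)" for h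
  have pos: "N (inv k \<otimes> h) \<le> N h - N k + c6" if "h \<in> carrier G" "N h > N k" "f h = N h" for h
    using dich[OF k(1) that(1)] that k(2) c N_nonneg[OF that(1)] N_nonneg[OF k(1)]
    by (auto simp: f_def split: if_splits)
  have neg: "N (k \<otimes> h) \<le> N h - N k + c6" if "h \<in> carrier G" "N h > N k" "f h = - N h" for h
    using dich[OF k(1) that(1)] that k(2) c N_nonneg[OF that(1)] N_nonneg[OF k(1)]
    by (auto simp: f_def split: if_splits)
  have fcases: "f h = N h \<or> f h = - N h" for h by (auto simp: f_def)
  have inv_side: "N (inv k \<otimes> inv h) = N (k \<otimes> h)" if "h \<in> carrier G" for h
    using N_inv[of "k \<otimes> h"] that k(1) by (simp add: inv_mult)
  have same: "N (inv g \<otimes> h) \<le> \<bar>N g - N h\<bar> + c6"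
    if g: "g \<in> carrier G" "N g > N k" "N (inv k \<otimes> g) \<le> N g - N k + c6"
      and h: "h \<in> carrier G" "N h > N k" "N (inv k \<otimes> h) \<le> N h - N k + c6" for g h
  proof -
    have "N (inv g \<otimes> h) \<le> N g + N h - 2 * N k + 2 * c6"
      using N_triangle[OF g(1) k(1) h(1)] N_diff_commute[OF g(1) k(1)] g(3) h(3) by linarith
    then have "\<not> N (inv g \<otimes> h) \<ge> N g + N h - c7" using k(2) c(1,2) by (simp add: not_le)
    then show ?thesis using dich[OF g(1) h(1)] by blast
  qed
  define c8 where "c8 = 2 * N k + c6 + c7"
  have rough: "\<bar>\<bar>f g - f h\<bar> - N (inv g \<otimes> h)\<bar> \<le> c8" if g: "g \<in> carrier G" and h: "h \<in> carrier G" for g h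
  proof -
    have nn: "N k \<ge> 0" "N g \<ge> 0" "N h \<ge> 0" using N_nonneg g h k by auto
    note tri = N_diff_le[OF g h]
    show ?thesis
    proof (cases "N g \<le> N k \<or> N h \<le> N k")
      case True
      have "N g - N h \<le> \<bar>f g - f h\<bar>" "N h - N g \<le> \<bar>f g - f h\<bar>" "\<bar>f g - f h\<bar> \<le> N g + N h"
        using fcases[of g] fcases[of h] nn by auto
      then have "\<bar>\<bar>f g - f h\<bar> - N (inv g \<otimes> h)\<bar> \<le> 2 * N k" using True tri nn by auto
      then show ?thesis using c unfolding c8_def by linarith
    next
      case False
      then have big: "N g > N k" "N h > N k" by auto
      have opp: "N (inv x \<otimes> y) \<ge> N x + N y - c7"
        if x: "x \<in> carrier G" "N x > N k" "f x = N x" and y: "y \<in> carrier G" "N y > N k" "f y = - N y"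
        for x y
      proof -
        have "N (inv x \<otimes> inv y) \<le> \<bar>N x - N (inv y)\<bar> + c6"
          using same[OF x(1,2) pos[OF x], of "inv y"] neg[OF y] inv_side[OF y(1)] y N_inv[OF y(1)] by simp
        then have "N (x \<otimes> y) \<le> \<bar>N x - N y\<bar> + c6"
          using N_inv[of "x \<otimes> y"] x(1) y(1) N_inv by (simp add: inv_mult)
        then have "N (x \<otimes> y) < N x + N y - c7" using x(2) y(2) k(2) c(1,2) by linarith
        then show ?thesis using dich[OF x(1) y(1)] by linarith
      qed
      consider "f g = N g" "f h = N h" | "f g = N g" "f h = - N h" | "f g = - N g" "f h = N h"
        | "f g = - N g" "f h = - N h" using fcases[of g] fcases[of h] by blast
      then show ?thesis
      proof cases
        case 1
        then show ?thesis using same[OF g big(1) pos[OF g big(1)] h big(2) pos[OF h big(2)]] tri nn c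
          unfolding c8_def by linarith
      next
        case 2
        then show ?thesis using opp[OF g big(1) _ h big(2)] tri nn c unfolding c8_def by linarith
      next
        case 3
        then show ?thesis using opp[OF h big(2) _ g big(1)] N_diff_commute[OF g h] tri nn c
          unfolding c8_def by linarith
      next
        case 4
        have "N (inv (inv g) \<otimes> inv h) \<le> \<bar>N (inv g) - N (inv h)\<bar> + c6"
          using neg[OF g big(1) 4(1)] neg[OF h big(2) 4(2)] inv_side g h N_inv big by (intro same) auto
        moreover have "N (inv (inv g) \<otimes> inv h) = N (inv g \<otimes> h)"
          using N_diff_commute[of "inv g" "inv h"] g h by (simp add: m_comm)
        ultimately show ?thesis using 4 tri nn c N_inv[OF g] N_inv[OF h] unfolding c8_def by linarith
      qed
    qed
  qed
  show ?thesis
  proof (rule that[of "c8 + c7 + R" f])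
    show "0 \<le> c8 + c7 + R" unfolding c8_def using c R_nonneg N_nonneg[OF k(1)] by linarith
    fix g h assume "g \<in> carrier G" "h \<in> carrier G"
    then show "\<bar>\<bar>f g - f h\<bar> - N (inv g \<otimes> h)\<bar> \<le> c8 + c7 + R"
      using rough[of g h] c R_nonneg by linarith
  next
    fix s :: real
    obtain g where g: "g \<in> carrier G" "N g > \<bar>s\<bar>" using unbounded by blast
    obtain h where h: "h \<in> carrier G" "\<bar>N h - \<bar>s\<bar>\<bar> \<le> R"
      using coarse_geodesic[OF g(1), of "\<bar>s\<bar>"] g(2) by auto
    have hi: "inv h \<in> carrier G" "N (inv h) = N h" using h N_inv by auto
    have "\<bar>\<bar>f (inv h) - f h\<bar> - N (h \<otimes> h)\<bar> \<le> c8" using rough[OF hi(1) h(1)] h(1) by simp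
    then have sq: "2 * N h \<le> \<bar>f (inv h) - f h\<bar> + c8 + c7" using long_square[OF h(1)] c by linarith
    have c8: "0 \<le> c8" unfolding c8_def using c N_nonneg[OF k(1)] by linarith
    consider "f h = N h" "f (inv h) = - N h" | "f h = - N h" "f (inv h) = N h" | "f (inv h) = f h" "\<bar>f h\<bar> = N h"
      using fcases[of h] fcases[of "inv h"] hi(2) N_nonneg[OF h(1)] by fastforce
    then have "\<bar>s - f h\<bar> \<le> c8 + c7 + R \<or> \<bar>s - f (inv h)\<bar> \<le> c8 + c7 + R"
    proof cases
      case 3
      then have "\<bar>s\<bar> + \<bar>f h\<bar> \<le> c8 + c7 + R" using sq h(2) by linarith
      then show ?thesis by linarith
    qed (use h(2) c c8 in \<open>cases "0 \<le> s"; simp; linarith\<close>)+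
    then show "\<exists>h\<in>carrier G. \<bar>s - f h\<bar> \<le> c8 + c7 + R" using h(1) hi(1) by blast
  qed
qed

end

section \<open>Subgroups of finite index\<close>

definition finite_index :: "('g, 'b) monoid_scheme \<Rightarrow> 'g set \<Rightarrow> bool" where
  "finite_index G H \<longleftrightarrow> subgroup H G \<and> finite (rcosets\<^bsub>G\<^esub> H)"

context group
begin

lemma finite_indexI_cover:
  assumes H: "subgroup H G" and T: "finite T" "T \<subseteq> carrier G"
    and cover: "\<And>g. g \<in> carrier G \<Longrightarrow> \<exists>h\<in>H. \<exists>t\<in>T. g = h \<otimes> t"
  shows "finite_index G H"
proof -
  have "rcosets H \<subseteq> (\<lambda>t. H #> t) ` T"
  proof
    fix c assume "c \<in> rcosets H"
    then obtain g where g: "g \<in> carrier G" "c = H #> g" unfolding RCOSETS_def by blast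
    obtain h t where ht: "h \<in> H" "t \<in> T" "g = h \<otimes> t" using cover g by blast
    have HG: "H \<subseteq> carrier G" using subgroup.subset H by blast
    have "c = (H #> h) #> t" unfolding g(2) ht(3)
      using coset_mult_assoc[OF HG, of h t] HG ht T by auto
    also have "H #> h = H" using coset_join2[of h H] HG ht H by auto
    finally show "c \<in> (\<lambda>t. H #> t) ` T" using ht by blast
  qed
  then show ?thesis unfolding finite_index_def using H T finite_subset by blast
qed

lemma finite_index_cover:
  assumes "finite_index G H"
  obtains T where "finite T" "T \<subseteq> carrier G" "\<And>g. g \<in> carrier G \<Longrightarrow> \<exists>h\<in>H. \<exists>t\<in>T. g = h \<otimes> t"
proof -
  have H: "subgroup H G" and fin: "finite (rcosets H)" using assms unfolding finite_index_def by auto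
  define rep where "rep c = (SOME g. g \<in> carrier G \<and> H #> g = c)" for c
  have rep: "rep c \<in> carrier G \<and> H #> rep c = c" if "c \<in> rcosets H" for c
    unfolding rep_def by (rule someI_ex) (use that in \<open>auto simp: RCOSETS_def\<close>)
  show ?thesis
  proof (rule that[of "rep ` (rcosets H)"])
    show "finite (rep ` (rcosets H))" using fin by simp
    show "rep ` (rcosets H) \<subseteq> carrier G" using rep by blast
    fix g assume g: "g \<in> carrier G"
    have c: "H #> g \<in> rcosets H" using g unfolding RCOSETS_def by blast
    have "g \<in> H #> rep (H #> g)" using rep[OF c] rcos_self[OF g H] by simp
    then show "\<exists>h\<in>H. \<exists>t\<in>rep ` (rcosets H). g = h \<otimes> t"
      using c unfolding r_coset_def by blast
  qed
qed

text \<open>Every element is \<open>h \<otimes> t\<close> with \<open>h \<in> H\<close> and \<open>t\<close> from a finite set, and \<open>h\<close> lies in the coset of \<open>K\<close> of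
  a representative of its class under \<open>cls\<close>. For the stabiliser \<open>K\<close> of an
  object, \<open>cls h\<close> may be the image of this object under \<open>inv h\<close>.\<close>

lemma finite_indexI_classify:
  assumes K: "subgroup K G" and H: "finite_index G H" and fin: "finite (cls ` H)"
    and same: "\<And>g h. \<lbrakk>g \<in> H; h \<in> H; cls g = cls h\<rbrakk> \<Longrightarrow> g \<otimes> inv h \<in> K"
  shows "finite_index G K"
proof -
  obtain T where T: "finite T" "T \<subseteq> carrier G" "\<And>g. g \<in> carrier G \<Longrightarrow> \<exists>h\<in>H. \<exists>t\<in>T. g = h \<otimes> t"
    using finite_index_cover[OF H] by blast
  have HG: "H \<subseteq> carrier G" using H subgroup.subset unfolding finite_index_def by blast
  define rep where "rep c = (SOME h. h \<in> H \<and> cls h = c)" for c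
  have rep: "rep (cls h) \<in> H \<and> cls (rep (cls h)) = cls h" if "h \<in> H" for h
    unfolding rep_def by (rule someI_ex) (use that in auto)
  define T' where "T' = (\<lambda>(c, t). rep c \<otimes> t) ` (cls ` H \<times> T)"
  show ?thesis
  proof (rule finite_indexI_cover[OF K, of T'])
    show "finite T'" unfolding T'_def using fin T by simp
    show "T' \<subseteq> carrier G" unfolding T'_def using rep HG T(2) by auto
    fix g assume "g \<in> carrier G"
    then obtain h t where ht: "h \<in> H" "t \<in> T" "g = h \<otimes> t" using T by blast
    let ?r = "rep (cls h)"
    have r: "?r \<in> H" "cls ?r = cls h" using rep ht by auto
    have c: "?r \<in> carrier G" "t \<in> carrier G" "h \<in> carrier G" using r ht HG T(2) by auto
    then have "(h \<otimes> inv ?r) \<otimes> (?r \<otimes> t) = h \<otimes> (inv ?r \<otimes> (?r \<otimes> t))"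
      by (intro m_assoc) auto
    also have "inv ?r \<otimes> (?r \<otimes> t) = t"
      using c m_assoc[of "inv ?r" ?r t, symmetric] by simp
    finally have "g = (h \<otimes> inv ?r) \<otimes> (?r \<otimes> t)" using ht by simp
    moreover have "h \<otimes> inv ?r \<in> K" using same[OF ht(1) r(1)] r(2) by simp
    moreover have "?r \<otimes> t \<in> T'" unfolding T'_def using ht by force
    ultimately show "\<exists>h\<in>K. \<exists>t\<in>T'. g = h \<otimes> t" by blast
  qed
qed

lemma finite_index_carrier: "finite_index G (carrier G)"
  by (rule finite_indexI_cover[OF subgroup_self, of "{\<one>}"]) auto

lemma finite_index_Int:
  assumes H: "finite_index G H" and K: "finite_index G K"
  shows "finite_index G (H \<inter> K)"
proof (rule finite_indexI_classify[OF _ H, of _ "\<lambda>g. K #> g"])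
  have sub: "subgroup H G" "subgroup K G" and fin: "finite (rcosets K)"
    using H K unfolding finite_index_def by auto
  have HG: "H \<subseteq> carrier G" using subgroup.subset sub by blast
  show "subgroup (H \<inter> K) G" using subgroups_Inter_pair sub by blast
  show "finite ((\<lambda>g. K #> g) ` H)"
    by (rule finite_subset[OF _ fin]) (use HG in \<open>auto simp: RCOSETS_def\<close>)
  fix g h assume gh: "g \<in> H" "h \<in> H" "K #> g = K #> h"
  have "g \<in> K #> h" using rcos_self[of g K] gh HG sub by auto
  then have "g \<otimes> inv h \<in> K"
    using subgroup.rcos_module_imp[OF sub(2) is_group] gh HG by blast
  then show "g \<otimes> inv h \<in> H \<inter> K"
    using gh subgroup.m_closed[OF sub(1)] subgroup.m_inv_closed[OF sub(1)] by blast
qed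

lemma finite_index_INT:
  assumes "finite I" "\<And>i. i \<in> I \<Longrightarrow> finite_index G (H i)"
  shows "finite_index G (carrier G \<inter> (\<Inter>i\<in>I. H i))"
  using assms
proof (induction I)
  case empty
  then show ?case using finite_index_carrier by simp
next
  case (insert i I)
  have "carrier G \<inter> (\<Inter>i\<in>insert i I. H i) = H i \<inter> (carrier G \<inter> (\<Inter>i\<in>I. H i))" by auto
  then show ?case using finite_index_Int insert by simp
qed

text \<open>Schreier's argument: rewriting \<open>a \<otimes> t\<close>, for a generator \<open>a\<close> and a coset representative
  \<open>t\<close>, as \<open>t' \<otimes> s\<close> produces finitely many \<open>s\<close>, and moving a representative through a word letter
  by letter writes every element as a representative times a product of these.\<close>

lemma finite_index_finitely_generated:
  assumes A: "finite A" "A \<subseteq> carrier G" "generate G A = carrier G" and H: "finite_index G H"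
  obtains S where "finite S" "S \<subseteq> H" "finite_index G (generate G S)"
proof -
  have subH: "subgroup H G" using H unfolding finite_index_def by auto
  have HG: "H \<subseteq> carrier G" using subgroup.subset subH by blast
  obtain T0 where T0: "finite T0" "T0 \<subseteq> carrier G"
    "\<And>g. g \<in> carrier G \<Longrightarrow> \<exists>h\<in>H. \<exists>t\<in>T0. g = h \<otimes> t"
    using finite_index_cover[OF H] by blast
  define T where "T = insert \<one> (m_inv G ` T0)"
  have T: "finite T" "T \<subseteq> carrier G" "\<one> \<in> T" using T0 unfolding T_def by auto
  have cover: "\<exists>t\<in>T. \<exists>h\<in>H. g = t \<otimes> h" if g: "g \<in> carrier G" for g
  proof -
    obtain h t where ht: "h \<in> H" "t \<in> T0" "inv g = h \<otimes> t" using T0(3)[of "inv g"] g by auto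
    have "h \<in> carrier G" "t \<in> carrier G" using ht HG T0 by auto
    then have "g = inv t \<otimes> inv h" using inv_mult_group[of h t] ht(3) g by (metis inv_inv)
    then show ?thesis using ht subgroup.m_inv_closed[OF subH] unfolding T_def by blast
  qed
  define B where "B = A \<union> m_inv G ` A"
  have B: "finite B" "B \<subseteq> carrier G" using A unfolding B_def by auto
  have "\<forall>g. \<exists>t h. g \<in> carrier G \<longrightarrow> t \<in> T \<and> h \<in> H \<and> g = t \<otimes> h" using cover by blast
  then obtain \<tau> \<sigma> where ts: "\<And>g. g \<in> carrier G \<Longrightarrow> \<tau> g \<in> T \<and> \<sigma> g \<in> H \<and> g = \<tau> g \<otimes> \<sigma> g"
    by metis
  define S where "S = (\<lambda>(a, t). \<sigma> (a \<otimes> t)) ` (B \<times> T)"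
  have "\<sigma> (a \<otimes> t) \<in> H" if "a \<in> B" "t \<in> T" for a t
    using ts[of "a \<otimes> t"] that B T by blast
  then have S: "finite S" "S \<subseteq> H" unfolding S_def using B T by auto
  have SG: "S \<subseteq> carrier G" using S HG by blast
  have gen: "subgroup (generate G S) G" by (rule generate_is_subgroup[OF SG])
  have genG: "generate G S \<subseteq> carrier G" by (rule generate_incl[OF SG])
  have word: "\<exists>t\<in>T. \<exists>u\<in>generate G S. foldr (\<otimes>) w \<one> = t \<otimes> u" if "set w \<subseteq> B" for w
    using that
  proof (induction w)
    case Nil
    then show ?case using T generate.one by (intro bexI[of _ \<one>]) auto
  next
    case (Cons a w)
    then obtain t u where tu: "t \<in> T" "u \<in> generate G S" "foldr (\<otimes>) w \<one> = t \<otimes> u" by auto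
    have c: "a \<in> carrier G" "t \<in> carrier G" "u \<in> carrier G" using Cons B T tu genG by auto
    have s: "\<tau> (a \<otimes> t) \<in> T" "\<sigma> (a \<otimes> t) \<in> H" "a \<otimes> t = \<tau> (a \<otimes> t) \<otimes> \<sigma> (a \<otimes> t)"
      using ts[of "a \<otimes> t"] c by auto
    have "\<sigma> (a \<otimes> t) \<in> S" unfolding S_def using Cons.prems tu by force
    then have "\<sigma> (a \<otimes> t) \<otimes> u \<in> generate G S" using generate.eng generate.incl tu by metis
    moreover have "foldr (\<otimes>) (a # w) \<one> = (a \<otimes> t) \<otimes> u" using tu c by (simp add: m_assoc)
    then have "foldr (\<otimes>) (a # w) \<one> = \<tau> (a \<otimes> t) \<otimes> (\<sigma> (a \<otimes> t) \<otimes> u)"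
      using s c T HG m_assoc[of "\<tau> (a \<otimes> t)" "\<sigma> (a \<otimes> t)" u] by (metis subsetD)
    ultimately show ?case using s(1) by blast
  qed
  have "finite_index G (generate G S)"
  proof (rule finite_indexI_cover[OF gen, of "m_inv G ` T"])
    fix g assume g: "g \<in> carrier G"
    then obtain w where w: "set w \<subseteq> B" "foldr (\<otimes>) w \<one> = inv g"
      using word_exists[OF A(2), of "inv g"] A(3) unfolding B_def by auto
    obtain t u where tu: "t \<in> T" "u \<in> generate G S" "inv g = t \<otimes> u" using word[OF w(1)] w(2) by auto
    have "g = inv u \<otimes> inv t" using tu T genG g inv_mult_group[of t u] by (metis inv_inv subsetD)
    then show "\<exists>h\<in>generate G S. \<exists>t\<in>m_inv G ` T. g = h \<otimes> t"
      using tu subgroup.m_inv_closed[OF gen] by blast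
  qed (use T in auto)
  then show ?thesis using that S by blast
qed

lemma commute_inv:
  assumes "x \<in> carrier G" "s \<in> carrier G" "x \<otimes> s = s \<otimes> x"
  shows "inv x \<otimes> s = s \<otimes> inv x"
proof -
  have "inv x \<otimes> s = inv x \<otimes> ((s \<otimes> x) \<otimes> inv x)" using assms(1,2) by (simp add: m_assoc)
  also have "\<dots> = inv x \<otimes> (x \<otimes> (s \<otimes> inv x))" unfolding assms(3)[symmetric]
    using assms(1,2) by (simp add: m_assoc)
  also have "\<dots> = (inv x \<otimes> x) \<otimes> (s \<otimes> inv x)" using assms(1,2) by (intro m_assoc[symmetric]) auto
  finally show ?thesis using assms(1,2) by simp
qed

text \<open>In \<open>H\<close> every conjugacy class is finite, so the centraliser of any finite set has finite index.
  For a finite set that generates a subgroup of finite index, it meets this subgroup in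
  the centre.\<close>

lemma virtually_abelian_if_finitely_many_commutators:
  assumes A: "finite A" "A \<subseteq> carrier G" "generate G A = carrier G" and H: "finite_index G H"
    and comm: "finite {inv (h \<otimes> g) \<otimes> (g \<otimes> h) | g h. g \<in> H \<and> h \<in> H}"
  shows "virtually_abelian G"
proof -
  obtain S where S: "finite S" "S \<subseteq> H" "finite_index G (generate G S)"
    using finite_index_finitely_generated[OF A H] by blast
  have subH: "subgroup H G" using H unfolding finite_index_def by auto
  have HG: "H \<subseteq> carrier G" using subgroup.subset subH by blast
  have SG: "S \<subseteq> carrier G" using S HG by blast
  let ?L = "generate G S"
  have L: "subgroup ?L G" "?L \<subseteq> carrier G" "?L \<subseteq> H"
    using generate_is_subgroup[OF SG] generate_incl[OF SG] generate_subgroup_incl[OF S(2) subH] by auto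
  define Z where "Z = {x \<in> ?L. \<forall>s\<in>S. x \<otimes> s = s \<otimes> x}"
  have Z: "subgroup Z G"
  proof (rule subgroupI)
    show "Z \<subseteq> carrier G" unfolding Z_def using L by auto
    show "Z \<noteq> {}" unfolding Z_def using generate.one SG by force
    fix x assume x: "x \<in> Z"
    then have xc: "x \<in> carrier G" "x \<in> ?L" using L unfolding Z_def by auto
    have "inv x \<otimes> s = s \<otimes> inv x" if s: "s \<in> S" for s
    proof -
      have "x \<otimes> s = s \<otimes> x" "s \<in> carrier G" using x s SG unfolding Z_def by auto
      then show ?thesis using commute_inv[of x s] xc by auto
    qed
    then show "inv x \<in> Z" unfolding Z_def using subgroup.m_inv_closed[OF L(1) xc(2)] by auto
    fix y assume y: "y \<in> Z"
    have yc: "y \<in> carrier G" "y \<in> ?L" using y L unfolding Z_def by auto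
    have "(x \<otimes> y) \<otimes> s = s \<otimes> (x \<otimes> y)" if s: "s \<in> S" for s
    proof -
      have e: "x \<otimes> s = s \<otimes> x" "y \<otimes> s = s \<otimes> y" "s \<in> carrier G" using x y s SG unfolding Z_def by auto
      have "(x \<otimes> y) \<otimes> s = x \<otimes> (s \<otimes> y)" using xc yc e by (simp add: m_assoc)
      also have "\<dots> = (s \<otimes> x) \<otimes> y" using xc yc e by (simp add: m_assoc[symmetric])
      finally show ?thesis using xc yc e by (simp add: m_assoc)
    qed
    then show "x \<otimes> y \<in> Z" unfolding Z_def using subgroup.m_closed[OF L(1) xc(2) yc(2)] by auto
  qed
  have central: "x \<otimes> y = y \<otimes> x" if x: "x \<in> Z" and y: "y \<in> ?L" for x y
  proof -
    have xc: "x \<in> carrier G" using x L unfolding Z_def by auto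
    show ?thesis using y
    proof (induction rule: generate.induct)
      case one
      then show ?case using xc by simp
    next
      case (incl h)
      then show ?case using x unfolding Z_def by blast
    next
      case (inv h)
      then have "x \<otimes> h = h \<otimes> x" "h \<in> carrier G" using x SG unfolding Z_def by auto
      then show ?case using commute_inv[of h x] xc by simp
    next
      case (eng h1 h2)
      have c: "h1 \<in> carrier G" "h2 \<in> carrier G" using eng L by auto
      have "x \<otimes> (h1 \<otimes> h2) = (h1 \<otimes> x) \<otimes> h2" using eng.IH c xc by (simp add: m_assoc[symmetric])
      also have "\<dots> = h1 \<otimes> (h2 \<otimes> x)" using eng.IH c xc by (simp add: m_assoc)
      finally show ?case using c xc by (simp add: m_assoc)
    qed
  qed
  have ab: "comm_group (G\<lparr>carrier := Z\<rparr>)"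
  proof (rule group.group_comm_groupI[OF subgroup_imp_group[OF Z]])
    fix x y assume "x \<in> carrier (G\<lparr>carrier := Z\<rparr>)" "y \<in> carrier (G\<lparr>carrier := Z\<rparr>)"
    then show "x \<otimes>\<^bsub>G\<lparr>carrier := Z\<rparr>\<^esub> y = y \<otimes>\<^bsub>G\<lparr>carrier := Z\<rparr>\<^esub> x"
      using central[of x y] unfolding Z_def by simp
  qed
  define Q where "Q = {inv (h \<otimes> g) \<otimes> (g \<otimes> h) | g h. g \<in> H \<and> h \<in> H}"
  have "finite_index G Z"
  proof (rule finite_indexI_classify[OF Z S(3), of "\<lambda>h. \<lambda>s\<in>S. inv h \<otimes> (s \<otimes> h)"])
    have "(\<lambda>h. \<lambda>s\<in>S. inv h \<otimes> (s \<otimes> h)) ` ?L \<subseteq> PiE S (\<lambda>s. (\<lambda>c. s \<otimes> c) ` Q)"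
    proof (rule image_subsetI, rule restrict_PiE_iff[THEN iffD2], rule ballI)
      fix h s assume h: "h \<in> ?L" and s: "s \<in> S"
      have c: "h \<in> H" "s \<in> H" "h \<in> carrier G" "s \<in> carrier G" using h s L S SG by auto
      have "inv h \<otimes> (s \<otimes> h) = s \<otimes> (inv (h \<otimes> s) \<otimes> (s \<otimes> h))"
        using c by (simp add: inv_mult_group m_assoc[symmetric])
      then show "inv h \<otimes> (s \<otimes> h) \<in> (\<lambda>c. s \<otimes> c) ` Q" unfolding Q_def using c by blast
    qed
    moreover have "finite (PiE S (\<lambda>s. (\<lambda>c. s \<otimes> c) ` Q))"
      using S(1) comm unfolding Q_def by (intro finite_PiE) auto
    ultimately show "finite ((\<lambda>h. \<lambda>s\<in>S. inv h \<otimes> (s \<otimes> h)) ` ?L)" using finite_subset by blast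
    fix g h assume gh: "g \<in> ?L" "h \<in> ?L"
      and eq: "(\<lambda>s\<in>S. inv g \<otimes> (s \<otimes> g)) = (\<lambda>s\<in>S. inv h \<otimes> (s \<otimes> h))"
    have c: "g \<in> carrier G" "h \<in> carrier G" using gh L by auto
    have "(g \<otimes> inv h) \<otimes> s = s \<otimes> (g \<otimes> inv h)" if s: "s \<in> S" for s
    proof -
      have sc: "s \<in> carrier G" using s SG by auto
      have e: "inv g \<otimes> (s \<otimes> g) = inv h \<otimes> (s \<otimes> h)" using fun_cong[OF eq, of s] s by simp
      have "s \<otimes> g = g \<otimes> (inv g \<otimes> (s \<otimes> g))" using c sc by (simp add: m_assoc[symmetric])
      also have "\<dots> = (g \<otimes> inv h) \<otimes> s \<otimes> h" unfolding e using c sc by (simp add: m_assoc)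
      finally have "s \<otimes> g \<otimes> inv h = (g \<otimes> inv h) \<otimes> s \<otimes> h \<otimes> inv h" by simp
      also have "\<dots> = (g \<otimes> inv h) \<otimes> s" using c sc by (simp add: m_assoc)
      finally show ?thesis using c sc by (simp add: m_assoc)
    qed
    then show "g \<otimes> inv h \<in> Z" unfolding Z_def
      using gh subgroup.m_closed[OF L(1)] subgroup.m_inv_closed[OF L(1)] by auto
  qed
  then show ?thesis using Z ab
    unfolding virtually_abelian_def abelian_finite_index_def finite_index_def by blast
qed

end

section \<open>Hierarchically hyperbolic groups\<close>

context HHG
begin

abbreviation unb :: "'d \<Rightarrow> bool" where "unb U \<equiv> \<not> bounded_space (C U)"

abbreviation Eys :: "'d set" where "Eys \<equiv> eyries \<SS> C nest"

abbreviation wl :: "'g \<Rightarrow> nat" where "wl \<equiv> word_length G A"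

abbreviation stab :: "'d \<Rightarrow> 'g set" where "stab \<equiv> stabilizer G act"

text \<open>The distance that is usually written \<open>d\<^sub>U(x, y)\<close>.\<close>

definition dd :: "'d \<Rightarrow> 'g \<Rightarrow> 'g \<Rightarrow> real" where
  "dd U x y = mdist (C U) (\<pi> U x) (\<pi> U y)"

lemmas word_metric = word_metric_simps[OF gens_subset gens_generate]

lemma pi_in [simp]: "U \<in> \<SS> \<Longrightarrow> x \<in> carrier G \<Longrightarrow> \<pi> U x \<in> mspace (C U)"
  using proj[of U] word_metric(1) by auto

lemma dd_nonneg [simp]: "0 \<le> dd U x y"
  by (simp add: dd_def)

lemma dd_self [simp]: "U \<in> \<SS> \<Longrightarrow> x \<in> carrier G \<Longrightarrow> dd U x x = 0"
  by (simp add: dd_def)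

lemma dd_commute: "dd U x y = dd U y x"
  by (simp add: dd_def mdist_commute)

lemma dd_triangle:
  "\<lbrakk>U \<in> \<SS>; x \<in> carrier G; y \<in> carrier G; z \<in> carrier G\<rbrakk> \<Longrightarrow> dd U x z \<le> dd U x y + dd U y z"
  unfolding dd_def by (intro mdist_triangle) auto

lemma act_closed [simp]: "g \<in> carrier G \<Longrightarrow> U \<in> \<SS> \<Longrightarrow> act g U \<in> \<SS>"
  using element_image by blast

lemma act_mult: "\<lbrakk>g \<in> carrier G; h \<in> carrier G; U \<in> \<SS>\<rbrakk> \<Longrightarrow> act (g \<otimes> h) U = act g (act h U)"
  using composition_rule by blast

lemma act_one: "U \<in> \<SS> \<Longrightarrow> act \<one> U = U"
  using id_eq_one by (metis restrict_apply')

lemma act_inv [simp]: "g \<in> carrier G \<Longrightarrow> U \<in> \<SS> \<Longrightarrow> act (inv g) (act g U) = U"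
  using orbit_sym_aux by blast

lemma act_inv' [simp]: "g \<in> carrier G \<Longrightarrow> U \<in> \<SS> \<Longrightarrow> act g (act (inv g) U) = U"
  using act_inv[of "inv g" U] by simp

lemma dd_act:
  "\<lbrakk>U \<in> \<SS>; g \<in> carrier G; x \<in> carrier G; y \<in> carrier G\<rbrakk> \<Longrightarrow> dd (act g U) (g \<otimes> x) (g \<otimes> y) = dd U x y"
  unfolding dd_def using mv_isometry[of g U "\<pi> U x" "\<pi> U y"] mv_proj[of g x U] mv_proj[of g y U]
  by simp

lemma dd_shift:
  "\<lbrakk>U \<in> \<SS>; g \<in> carrier G; x \<in> carrier G; y \<in> carrier G\<rbrakk> \<Longrightarrow> dd U (g \<otimes> x) (g \<otimes> y) = dd (act (inv g) U) x y"
  using dd_act[of "act (inv g) U" g x y] by simp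

lemma stabD: "g \<in> stab U \<Longrightarrow> g \<in> carrier G \<and> act g U = U"
  by (simp add: stabilizer_def)

lemma stabI: "g \<in> carrier G \<Longrightarrow> act g U = U \<Longrightarrow> g \<in> stab U"
  by (simp add: stabilizer_def)

lemma dd_stab:
  "\<lbrakk>U \<in> \<SS>; g \<in> stab U; x \<in> carrier G; y \<in> carrier G\<rbrakk> \<Longrightarrow> dd U (g \<otimes> x) (g \<otimes> y) = dd U x y"
  using dd_act[of U g x y] stabD[of g U] by simp

lemma wl_mult: 
  assumes "g \<in> carrier G" "h \<in> carrier G"
  shows "wl (g \<otimes> h) \<le> wl g + wl h"
proof -
  obtain v where v: "length v = wl g" "set v \<subseteq> A \<union> m_inv G ` A" "foldr (\<otimes>) v \<one> = g"
    using word_length_attained[OF gens_subset gens_generate assms(1)] by blast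
  obtain w where w: "length w = wl h" "set w \<subseteq> A \<union> m_inv G ` A" "foldr (\<otimes>) w \<one> = h"
    using word_length_attained[OF gens_subset gens_generate assms(2)] by blast
  have AA: "A \<union> m_inv G ` A \<subseteq> carrier G" using gens_subset by auto
  have "foldr (\<otimes>) (v @ w) \<one> = g \<otimes> h" using foldr_mult_append[of v w] v w AA by auto
  then show ?thesis using word_length_le[of "v @ w" A "g \<otimes> h"] v w by simp
qed

lemma wl_one: "wl \<one> = 0"
  using word_length_le[of "[]" A \<one>] by simp

lemma wl_gen: "a \<in> A \<union> m_inv G ` A \<Longrightarrow> wl a \<le> 1"
  using word_length_le[of "[a]" A a] gens_subset by auto

lemma finite_ball: "finite {g \<in> carrier G. wl g \<le> n}"
proof (rule finite_subset)
  show "{g \<in> carrier G. wl g \<le> n}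
      \<subseteq> (\<lambda>w. foldr (\<otimes>) w \<one>) ` {w. set w \<subseteq> A \<union> m_inv G ` A \<and> length w \<le> n}"
  proof
    fix g assume g: "g \<in> {g \<in> carrier G. wl g \<le> n}"
    then have "g \<in> carrier G" by simp
    then obtain w where "length w = wl g" "set w \<subseteq> A \<union> m_inv G ` A" "foldr (\<otimes>) w \<one> = g"
      using word_length_attained[OF gens_subset gens_generate] by blast
    then show "g \<in> (\<lambda>w. foldr (\<otimes>) w \<one>) ` {w. set w \<subseteq> A \<union> m_inv G ` A \<and> length w \<le> n}"
      using g by (intro image_eqI[of _ _ w]) auto
  qed
  show "finite ((\<lambda>w. foldr (\<otimes>) w \<one>) ` {w. set w \<subseteq> A \<union> m_inv G ` A \<and> length w \<le> n})"
    using gens_finite by (intro finite_imageI finite_lists_length_le) auto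
qed

text \<open>By left invariance \<open>g\<close> and \<open>g \<otimes> x\<close> are as far apart in the word metric as \<open>\<one>\<close> and \<open>x\<close>.\<close>

lemma dd_right_mult:
  assumes "U \<in> \<SS>" "g \<in> carrier G" "x \<in> carrier G"
  shows "dd U g (g \<otimes> x) \<le> E * real (wl x) + E"
proof -
  have "inv g \<otimes> (g \<otimes> x) = x" using assms by (simp add: m_assoc[symmetric])
  then have "mdist (word_metric G A) g (g \<otimes> x) = real (wl x)"
    using assms unfolding word_metric(2) word_dist_def by simp
  then show ?thesis
    using proj_lipschitz[of U g "g \<otimes> x"] assms unfolding dd_def word_metric(1) by simp
qed

lemma finite_set_displacement:
  assumes "finite T" "T \<subseteq> carrier G"
  obtains D where "D \<ge> 0" "\<And>U g t. \<lbrakk>U \<in> \<SS>; g \<in> carrier G; t \<in> T\<rbrakk> \<Longrightarrow> dd U g (g \<otimes> t) \<le> D"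
proof (rule that[of "E * real (Max (insert 0 (wl ` T))) + E"])
  show "0 \<le> E * real (Max (insert 0 (wl ` T))) + E" using E_ge_1 by simp
  fix U g t assume *: "U \<in> \<SS>" "g \<in> carrier G" "t \<in> T"
  have "wl t \<le> Max (insert 0 (wl ` T))" using assms * by simp
  then have "E * real (wl t) \<le> E * real (Max (insert 0 (wl ` T)))"
    using E_ge_1 by (intro mult_left_mono) auto
  then show "dd U g (g \<otimes> t) \<le> E * real (Max (insert 0 (wl ` T))) + E"
    using dd_right_mult[OF *(1,2), of t] subsetD[OF assms(2) *(3)] by linarith
qed

lemma bounded_diam:
  assumes "U \<in> \<SS>" "bounded_space (C U)" "p \<in> mspace (C U)" "q \<in> mspace (C U)"
  shows "mdist (C U) p q \<le> E"
proof -
  interpret M: Metric_space "mspace (C U)" "mdist (C U)" by simp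
  obtain B where B: "\<forall>x\<in>mspace (C U). \<forall>y\<in>mspace (C U). mdist (C U) x y \<le> B"
    using assms(2) unfolding bounded_space_def M.mbounded_alt by auto
  have "mdiam (C U) (mspace (C U)) \<le> ennreal B" using B by (intro mdiam_le_dist) blast
  also have "ennreal B < \<infinity>" unfolding infinity_ennreal_def by (rule ennreal_less_top)
  finally have "mdiam (C U) (mspace (C U)) \<noteq> \<infinity>" by (rule less_imp_neq)
  then have "mdiam (C U) (mspace (C U)) \<le> ennreal E"
    using E_unbounded[OF assms(1)] by (meson not_le)
  then show ?thesis using mdist_le_mdiam[OF _ _ assms(3,4)] E_ge_1 by simp
qed

lemma dd_bounded:
  "\<lbrakk>U \<in> \<SS>; bounded_space (C U); x \<in> carrier G; y \<in> carrier G\<rbrakk> \<Longrightarrow> dd U x y \<le> E"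
  unfolding dd_def by (intro bounded_diam) auto

lemma proj_near:
  assumes "U \<in> \<SS>" "p \<in> mspace (C U)"
  obtains x where "x \<in> carrier G" "mdist (C U) p (\<pi> U x) < E + 1"
proof -
  have "mset_dist (C U) {p} (\<pi> U ` carrier G) < E + 1"
    using proj_onto[OF assms] unfolding word_metric(1) by linarith
  then obtain a b where "a \<in> {p}" "b \<in> \<pi> U ` carrier G" "mdist (C U) a b < E + 1"
    using mset_dist_witness[of "{p}" "\<pi> U ` carrier G" "C U" "E + 1"] one_closed by blast
  then show ?thesis using that by auto
qed

lemma unb_far:
  assumes "U \<in> \<SS>" "unb U" "x \<in> carrier G"
  obtains y where "y \<in> carrier G" "dd U x y > B"
proof -
  obtain q where q: "q \<in> mspace (C U)" "mdist (C U) (\<pi> U x) q > B + E + 1"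
    using unbounded_far[OF assms(2) pi_in[OF assms(1,3)]] by blast
  obtain y where y: "y \<in> carrier G" "mdist (C U) q (\<pi> U y) < E + 1" using proj_near[OF assms(1) q(1)] by blast
  have "mdist (C U) (\<pi> U x) q \<le> dd U x y + mdist (C U) q (\<pi> U y)"
    unfolding dd_def mdist_commute[of "C U" q] using assms y q by (intro mdist_triangle) auto
  then show ?thesis using that[OF y(1)] q y by linarith
qed

lemma boundedI_dd:
  assumes "U \<in> \<SS>" "\<And>x. x \<in> carrier G \<Longrightarrow> dd U \<one> x \<le> B"
  shows "bounded_space (C U)"
proof (rule ccontr)
  assume "unb U"
  then obtain y where "y \<in> carrier G" "dd U \<one> y > B" using unb_far[OF assms(1), of \<one>] by blast
  then show False using assms(2)[of y] by simp
qed

lemma bounded_act: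
  assumes "U \<in> \<SS>" "g \<in> carrier G"
  shows "bounded_space (C (act g U)) \<longleftrightarrow> bounded_space (C U)"
proof -
  have *: "bounded_space (C U)" if U: "U \<in> \<SS>" and g: "g \<in> carrier G" and b: "bounded_space (C (act g U))" for U g
  proof (rule bounded_spaceI)
    fix p q assume pq: "p \<in> mspace (C U)" "q \<in> mspace (C U)"
    have "mv g U p \<in> mspace (C (act g U))" "mv g U q \<in> mspace (C (act g U))"
      using mv_bij[OF g U] pq by (auto simp: bij_betw_def)
    from bounded_diam[OF act_closed[OF g U] b this] show "mdist (C U) p q \<le> E"
      using mv_isometry[OF g U pq] by simp
  qed
  show ?thesis using *[OF assms] *[of "act g U" "inv g"] assms by auto
qed

lemma nest_trans': "\<lbrakk>U \<in> \<SS>; V \<in> \<SS>; W \<in> \<SS>; nest U V; nest V W\<rbrakk> \<Longrightarrow> nest U W"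
  using nest_trans by (meson transp_onD)

lemma nest_antisym': "\<lbrakk>U \<in> \<SS>; V \<in> \<SS>; nest U V; nest V U\<rbrakk> \<Longrightarrow> U = V"
  using nest_antisym by (meson antisymp_onD)

lemma nest_refl': "U \<in> \<SS> \<Longrightarrow> nest U U"
  using nest_refl by (meson reflp_onD)

lemma EysD:
  assumes "U \<in> Eys"
  shows "U \<in> \<SS>" "unb U" "\<And>V. \<lbrakk>V \<in> \<SS>; unb V; nest U V\<rbrakk> \<Longrightarrow> V = U"
  using assms unfolding eyries_def by blast+

lemma act_Eys:
  assumes "U \<in> Eys" "g \<in> carrier G"
  shows "act g U \<in> Eys"
proof -
  note U = EysD[OF assms(1)]
  have "V = act g U" if V: "V \<in> \<SS>" "unb V" "nest (act g U) V" for V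
  proof -
    have "nest U (act (inv g) V)"
      using act_nest[of "inv g" "act g U" V] V U assms by simp
    then have "act (inv g) V = U"
      using U(3)[of "act (inv g) V"] bounded_act[of V "inv g"] V assms by simp
    then show ?thesis using V assms by auto
  qed
  then show ?thesis using U bounded_act[of U g] assms unfolding eyries_def by auto
qed

text \<open>By finite complexity an increasing sequence of domains stops.\<close>

lemma maximal_above:
  assumes V: "V \<in> \<SS>" "P V"
  shows "\<exists>U\<in>\<SS>. P U \<and> nest V U \<and> (\<forall>W\<in>\<SS>. P W \<and> nest U W \<longrightarrow> W = U)"
proof (rule ccontr)
  assume neg: "\<not> ?thesis"
  define S where "S = {U \<in> \<SS>. P U \<and> nest V U}"
  have step: "\<exists>W\<in>S. nest U W \<and> W \<noteq> U" if "U \<in> S" for U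
  proof -
    have U: "U \<in> \<SS>" "P U" "nest V U" using that S_def by auto
    then obtain W where W: "W \<in> \<SS>" "P W" "nest U W" "W \<noteq> U" using neg by blast
    then have "W \<in> S" using nest_trans'[of V U W] U V S_def by auto
    then show ?thesis using W by blast
  qed
  obtain n where n: "\<forall>Ch\<subseteq>\<SS>. (\<forall>V\<in>Ch. \<forall>W\<in>Ch. nest V W \<or> nest W V) \<longrightarrow> finite Ch \<and> card Ch \<le> n"
    using finite_complexity ..
  have long: "\<exists>Ch U. U \<in> Ch \<and> Ch \<subseteq> S \<and> finite Ch \<and> card Ch = Suc k \<and>
      (\<forall>V\<in>Ch. \<forall>W\<in>Ch. nest V W \<or> nest W V) \<and> (\<forall>W\<in>Ch. nest W U)" for k
  proof (induction k)
    case 0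
    have "V \<in> S" using V nest_refl' S_def by auto
    then show ?case using nest_refl'[OF V(1)] by (intro exI[of _ "{V}"] exI[of _ V]) auto
  next
    case (Suc k)
    then obtain Ch U where Ch: "U \<in> Ch" "Ch \<subseteq> S" "finite Ch" "card Ch = Suc k"
      "\<forall>V\<in>Ch. \<forall>W\<in>Ch. nest V W \<or> nest W V" "\<forall>W\<in>Ch. nest W U" by blast
    obtain W where W: "W \<in> S" "nest U W" "W \<noteq> U" using step Ch by blast
    have SS: "S \<subseteq> \<SS>" unfolding S_def by auto
    have "W \<notin> Ch" using nest_antisym'[of W U] Ch W SS by blast
    moreover have "nest T W" if "T \<in> Ch" for T using nest_trans'[of T U W] that Ch W SS by blast
    ultimately show ?case using Ch W nest_refl'[of W] SS
      by (intro exI[of _ "insert W Ch"] exI[of _ W]) auto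
  qed
  from long[of n] obtain Ch U where Ch: "U \<in> Ch \<and> Ch \<subseteq> S \<and> finite Ch \<and> card Ch = Suc n \<and>
      (\<forall>V\<in>Ch. \<forall>W\<in>Ch. nest V W \<or> nest W V) \<and> (\<forall>W\<in>Ch. nest W U)" by (elim exE)
  then have "Ch \<subseteq> \<SS>" unfolding S_def by auto
  then have "card Ch \<le> n" using n[rule_format, of Ch] Ch by blast
  then show False using Ch by simp
qed

lemma top_domain:
  assumes "\<SS> \<noteq> {}"
  shows "\<exists>M\<in>\<SS>. \<forall>V\<in>\<SS>. nest V M"
proof -
  obtain M where M: "M \<in> \<SS>"
    and uniq: "\<forall>M'. M' \<in> \<SS> \<and> (\<forall>V\<in>\<SS>. nest M' V \<longrightarrow> V = M') \<longrightarrow> M' = M"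
    using nest_maximal[OF assms] unfolding Ex1_def by blast
  have "nest V M" if V: "V \<in> \<SS>" for V
  proof -
    obtain U where "U \<in> \<SS>" "nest V U" "\<forall>W\<in>\<SS>. nest U W \<longrightarrow> W = U"
      using maximal_above[OF V, of "\<lambda>_. True"] by blast
    then show ?thesis using uniq by blast
  qed
  then show ?thesis using M by blast
qed

lemma nested_in_eyrie:
  assumes "U \<in> \<SS>" "unb U"
  obtains W where "W \<in> Eys" "nest U W"
proof -
  obtain W where "W \<in> \<SS>" "unb W" "nest U W" "\<forall>V\<in>\<SS>. unb V \<and> nest W V \<longrightarrow> V = W"
    using maximal_above[of U unb] assms by blast
  then show ?thesis using that unfolding eyries_def by blast
qed

definition covers :: "'d set \<Rightarrow> 'd \<Rightarrow> 'g \<Rightarrow> 'g \<Rightarrow> bool" where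
  "covers \<T> W x y \<longleftrightarrow> finite \<T> \<and> \<T> \<subseteq> {T\<in>\<SS>. nest T W \<and> unb T} \<and>
     (\<forall>T\<in>\<SS>. nest T W \<and> unb T \<and> dd T x y \<ge> E \<longrightarrow> (\<exists>T'\<in>\<T>. nest T T'))"

text \<open>Below a bounded domain the large links axiom yields a uniformly bounded number of domains.
  Iterating it down to unbounded domains, which happens after boundedly many steps by finite
  complexity, captures, up to nesting, all the unbounded domains in which two given points are far
  apart.\<close>

lemma unbounded_cover:
  "\<exists>K. \<forall>W\<in>\<SS>. \<forall>x\<in>carrier G. \<forall>y\<in>carrier G. \<exists>\<T>. card \<T> \<le> K \<and> covers \<T> W x y"
proof -
  define chain where "chain Ch \<longleftrightarrow> (\<forall>V\<in>Ch. \<forall>W\<in>Ch. nest V W \<or> nest W V)" for Ch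
  define below where "below W = {V \<in> \<SS>. nest V W}" for W
  have fin: "finite Ch" if "Ch \<subseteq> below W" "chain Ch" for Ch W
    using finite_complexity that unfolding chain_def below_def by blast
  have ind: "\<exists>K. \<forall>W\<in>\<SS>. (\<forall>Ch. Ch \<subseteq> below W \<and> chain Ch \<longrightarrow> card Ch \<le> j) \<longrightarrow>
    (\<forall>x\<in>carrier G. \<forall>y\<in>carrier G. \<exists>\<T>. card \<T> \<le> K \<and> covers \<T> W x y)" for j :: nat
  proof (induction j)
    case 0
    have "\<not> (\<forall>Ch. Ch \<subseteq> below W \<and> chain Ch \<longrightarrow> card Ch \<le> 0)" if "W \<in> \<SS>" for W
      using nest_refl'[OF that] that
      by (auto simp: below_def chain_def intro!: exI[of _ "{W}"])
    then show ?case by blast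
  next
    case (Suc j)
    then obtain K where K: "\<forall>W\<in>\<SS>. (\<forall>Ch. Ch \<subseteq> below W \<and> chain Ch \<longrightarrow> card Ch \<le> j) \<longrightarrow>
      (\<forall>x\<in>carrier G. \<forall>y\<in>carrier G. \<exists>\<T>. card \<T> \<le> K \<and> covers \<T> W x y)" ..
    define N where "N = nat \<lfloor>E * E + E\<rfloor>"
    show ?case
    proof (rule exI[of _ "max 1 (N * K)"], intro ballI impI)
      fix W x y assume W: "W \<in> \<SS>" and j: "\<forall>Ch. Ch \<subseteq> below W \<and> chain Ch \<longrightarrow> card Ch \<le> Suc j"
        and x: "x \<in> carrier G" and y: "y \<in> carrier G"
      show "\<exists>\<T>. card \<T> \<le> max 1 (N * K) \<and> covers \<T> W x y"
      proof (cases "unb W")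
        case True
        then show ?thesis using W nest_refl' unfolding covers_def by (intro exI[of _ "{W}"]) auto
      next
        case False
        define N' where "N' = E * mdist (C W) (\<pi> W x) (\<pi> W y) + E"
        have "E * dd W x y \<le> E * E" using dd_bounded[OF W _ x y] False E_ge_1 by (intro mult_left_mono) auto
        then have N': "nat \<lfloor>N'\<rfloor> \<le> N" unfolding N'_def N_def dd_def by (intro nat_mono floor_mono) simp
        obtain \<T>0 where T0: "\<T>0 \<subseteq> {T \<in> \<SS>. pnested nest T W}" "finite \<T>0" "int (card \<T>0) \<le> \<lfloor>N'\<rfloor>"
          "\<forall>T\<in>\<SS>. pnested nest T W \<longrightarrow> (\<exists>T'\<in>\<T>0. nest T T') \<or> mdist (C T) (\<pi> T x) (\<pi> T y) < E"
          using large_links[OF W _ _ N'_def] x y word_metric(1) by auto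
        have "\<exists>\<T>. card \<T> \<le> K \<and> covers \<T> T1 x y" if T1: "T1 \<in> \<T>0" for T1
        proof -
          have "card Ch \<le> j" if Ch: "Ch \<subseteq> below T1" "chain Ch" for Ch
          proof -
            have T1S: "T1 \<in> \<SS>" using T1 T0 by auto
            have T1W: "nest T1 W" "T1 \<noteq> W" using T1 T0 unfolding pnested_def by auto
            have W_notin: "W \<notin> Ch" using nest_antisym'[OF W T1S] T1W Ch unfolding below_def by auto
            have up: "nest T W \<and> T \<in> \<SS>" if "T \<in> Ch" for T
              using nest_trans'[of T T1 W] that Ch T1W T1S W unfolding below_def by auto
            have "insert W Ch \<subseteq> below W" "chain (insert W Ch)"
              using up W nest_refl' Ch(2) unfolding below_def chain_def by auto
            then have "card (insert W Ch) \<le> Suc j" using j by blast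
            then show "card Ch \<le> j" using W_notin fin[OF Ch] by simp
          qed
          then show ?thesis using K T1 T0(1) x y by blast
        qed
        then have "\<forall>T1\<in>\<T>0. \<exists>\<T>. card \<T> \<le> K \<and> covers \<T> T1 x y" ..
        from bchoice[OF this] obtain F where F0: "\<forall>T1\<in>\<T>0. card (F T1) \<le> K \<and> covers (F T1) T1 x y" ..
        have F: "finite (F T1) \<and> card (F T1) \<le> K \<and> F T1 \<subseteq> {T\<in>\<SS>. nest T T1 \<and> unb T} \<and>
          (\<forall>T\<in>\<SS>. nest T T1 \<and> unb T \<and> dd T x y \<ge> E \<longrightarrow> (\<exists>T'\<in>F T1. nest T T'))" if "T1 \<in> \<T>0" for T1
          using F0 that unfolding covers_def by blast
        have "card (\<Union>(F ` \<T>0)) \<le> (\<Sum>T\<in>\<T>0. card (F T))" using T0(2) by (rule card_UN_le)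
        also have "\<dots> \<le> of_nat (card \<T>0) * K" by (rule sum_bounded_above) (use F0 in blast)
        also have "card \<T>0 \<le> N" using T0(3) N' by linarith
        then have "of_nat (card \<T>0) * K \<le> N * K" by simp
        finally have "card (\<Union>(F ` \<T>0)) \<le> max 1 (N * K)" by simp
        moreover have "\<Union>(F ` \<T>0) \<subseteq> {T\<in>\<SS>. nest T W \<and> unb T}"
        proof
          fix T assume "T \<in> \<Union>(F ` \<T>0)"
          then obtain T1 where T1: "T1 \<in> \<T>0" "T \<in> F T1" by blast
          then have "T \<in> \<SS>" "nest T T1" "unb T" "T1 \<in> \<SS>" "nest T1 W"
            using F[OF T1(1)] T0(1) unfolding pnested_def by auto
          then show "T \<in> {T\<in>\<SS>. nest T W \<and> unb T}" using nest_trans' W by blast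
        qed
        moreover have "\<exists>T'\<in>\<Union>(F ` \<T>0). nest T T'"
          if T: "T \<in> \<SS>" "nest T W" "unb T" "dd T x y \<ge> E" for T
        proof -
          have "pnested nest T W" using T False unfolding pnested_def by auto
          then obtain T1 where "T1 \<in> \<T>0" "nest T T1" using T0(4) T unfolding dd_def by force
          then show ?thesis using F[of T1] T by blast
        qed
        moreover have "finite (\<Union>(F ` \<T>0))" using F T0(2) by blast
        ultimately have "covers (\<Union>(F ` \<T>0)) W x y" "card (\<Union>(F ` \<T>0)) \<le> max 1 (N * K)"
          unfolding covers_def by blast+
        then show ?thesis by blast
      qed
    qed
  qed
  obtain n where n: "\<forall>Ch\<subseteq>\<SS>. chain Ch \<longrightarrow> finite Ch \<and> card Ch \<le> n"
    using finite_complexity unfolding chain_def ..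
  have card: "\<forall>Ch. Ch \<subseteq> below W \<and> chain Ch \<longrightarrow> card Ch \<le> n" for W
    using n unfolding below_def by blast
  obtain K where K: "\<forall>W\<in>\<SS>. (\<forall>Ch. Ch \<subseteq> below W \<and> chain Ch \<longrightarrow> card Ch \<le> n) \<longrightarrow>
    (\<forall>x\<in>carrier G. \<forall>y\<in>carrier G. \<exists>\<T>. card \<T> \<le> K \<and> covers \<T> W x y)"
    using ind[of n] ..
  show ?thesis
  proof (intro exI[of _ K] ballI)
    fix W x y assume "W \<in> \<SS>" "x \<in> carrier G" "y \<in> carrier G"
    then show "\<exists>\<T>. card \<T> \<le> K \<and> covers \<T> W x y" using K card[of W] by blast
  qed
qed

text \<open>The cover is applied to the maximal domain. An eyrie nested in an unbounded domain is equal to it,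
  so the eyries in question belong to the covering set themselves.\<close>

lemma eyries_far_apart_bound:
  "\<exists>K. \<forall>x\<in>carrier G. \<forall>y\<in>carrier G.
    finite {U \<in> Eys. dd U x y > E} \<and> card {U \<in> Eys. dd U x y > E} \<le> K"
proof -
  obtain K where K: "\<forall>W\<in>\<SS>. \<forall>x\<in>carrier G. \<forall>y\<in>carrier G. \<exists>\<T>. card \<T> \<le> K \<and> covers \<T> W x y"
    using unbounded_cover ..
  have "finite {U \<in> Eys. dd U x y > E} \<and> card {U \<in> Eys. dd U x y > E} \<le> K"
    if xy: "x \<in> carrier G" "y \<in> carrier G" for x y
  proof (cases "\<SS> = {}")
    case True
    then show ?thesis by (simp add: eyries_def)
  next
    case False
    then obtain M where M: "M \<in> \<SS>" "\<forall>V\<in>\<SS>. nest V M" using top_domain by blast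
    obtain \<T> where T: "card \<T> \<le> K" and cov: "covers \<T> M x y" using K M(1) xy by blast
    have T': "finite \<T>" "\<T> \<subseteq> {T\<in>\<SS>. nest T M \<and> unb T}"
      "\<forall>T\<in>\<SS>. nest T M \<and> unb T \<and> dd T x y \<ge> E \<longrightarrow> (\<exists>T'\<in>\<T>. nest T T')"
      using cov unfolding covers_def by auto
    have "{U \<in> Eys. dd U x y > E} \<subseteq> \<T>"
    proof
      fix U assume U: "U \<in> {U \<in> Eys. dd U x y > E}"
      then have "U \<in> \<SS>" "unb U" "nest U M" "dd U x y \<ge> E" using EysD[of U] M(2) by auto
      then obtain T' where T'': "T' \<in> \<T>" "nest U T'" using T'(3) by blast
      then have "T' = U" using EysD(3)[of U T'] U T'(2) by auto
      then show "U \<in> \<T>" using T'' by simp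
    qed
    then show ?thesis using T T'(1) card_mono[of \<T>] finite_subset[of _ \<T>] by (meson le_trans)
  qed
  then show ?thesis by blast
qed

definition max_below :: "'d \<Rightarrow> 'd set" where
  "max_below W = {T \<in> \<SS>. pnested nest T W \<and> unb T \<and>
     (\<forall>V\<in>\<SS>. pnested nest V W \<and> unb V \<and> nest T V \<longrightarrow> V = T)}"

lemma max_belowD:
  assumes "T \<in> max_below W"
  shows "T \<in> \<SS>" "pnested nest T W" "unb T" "nest T W" "T \<noteq> W"
    "\<And>V. \<lbrakk>V \<in> \<SS>; pnested nest V W; unb V; nest T V\<rbrakk> \<Longrightarrow> V = T"
  using assms unfolding max_below_def pnested_def by blast+

text \<open>If \<open>W\<close> is unbounded, the number of domains in its large links depends on the two points. Below each
  of them the uniform cover applies.\<close>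

lemma finite_far_max_below:
  assumes W: "W \<in> \<SS>" and xy: "x \<in> carrier G" "y \<in> carrier G"
  shows "finite {T \<in> max_below W. dd T x y > E}" (is "finite ?F")
proof -
  obtain K where K: "\<forall>W\<in>\<SS>. \<forall>x\<in>carrier G. \<forall>y\<in>carrier G. \<exists>\<T>. card \<T> \<le> K \<and> covers \<T> W x y"
    using unbounded_cover ..
  obtain \<T>0 where T0: "\<T>0 \<subseteq> {T \<in> \<SS>. pnested nest T W}" "finite \<T>0"
    "\<forall>T\<in>\<SS>. pnested nest T W \<longrightarrow> (\<exists>T'\<in>\<T>0. nest T T') \<or> mdist (C T) (\<pi> T x) (\<pi> T y) < E"
  proof -
    define N where "N = E * mdist (C W) (\<pi> W x) (\<pi> W y) + E"
    have "x \<in> mspace (word_metric G A)" "y \<in> mspace (word_metric G A)" using xy word_metric(1) by auto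
    from large_links[OF W this N_def] show ?thesis by (elim exE conjE) (rule that)
  qed
  have "\<forall>T1\<in>\<T>0. \<exists>\<T>. covers \<T> T1 x y" using K xy T0(1) by blast
  from bchoice[OF this] obtain F where F0: "\<forall>T1\<in>\<T>0. covers (F T1) T1 x y" ..
  have F: "finite (F T1) \<and> F T1 \<subseteq> {T\<in>\<SS>. nest T T1 \<and> unb T} \<and>
       (\<forall>T\<in>\<SS>. nest T T1 \<and> unb T \<and> dd T x y \<ge> E \<longrightarrow> (\<exists>T'\<in>F T1. nest T T'))" if "T1 \<in> \<T>0" for T1
    using F0 that unfolding covers_def by blast
  have "?F \<subseteq> \<Union>(F ` \<T>0)"
  proof
    fix T assume "T \<in> ?F"
    then have T: "T \<in> max_below W" "dd T x y > E" by auto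
    note TS = max_belowD[OF T(1)]
    obtain T1 where T1: "T1 \<in> \<T>0" "nest T T1" using T0(3) TS(1,2) T(2) unfolding dd_def by force
    then obtain T' where T': "T' \<in> F T1" "nest T T'" using F[OF T1(1)] TS(1,3) T(2) by force
    have T1': "T1 \<in> \<SS>" "nest T1 W" "T1 \<noteq> W" using T1 T0(1) unfolding pnested_def by auto
    have T'': "T' \<in> \<SS>" "nest T' T1" "unb T'" using F[OF T1(1)] T' by auto
    have "nest T' W" using nest_trans'[OF T''(1) T1'(1) W] T1' T'' by blast
    moreover have "T' \<noteq> W" using nest_antisym'[OF T1'(1) W] T1' T'' by auto
    ultimately have "T' = T" using TS(6)[OF T''(1) _ T''(3) T'(2)] unfolding pnested_def by blast
    then show "T \<in> \<Union>(F ` \<T>0)" using T' T1 by blast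
  qed
  moreover have "finite (\<Union>(F ` \<T>0))" using F0 T0(2) unfolding covers_def by simp
  ultimately show ?thesis by (rule finite_subset)
qed

end

section \<open>Eyries\<close>

context HHG
begin

lemma infinite_orbit_act:
  assumes "q \<in> \<SS>" "h \<in> carrier G" "infinite (orbit G act q)"
  shows "infinite (orbit G act (act h q))"
proof -
  have "orbit G act q \<subseteq> orbit G act (act h q)"
  proof
    fix v assume "v \<in> orbit G act q"
    then obtain g where g: "g \<in> carrier G" "v = act g q" unfolding orbit_def by blast
    have "act (g \<otimes> inv h) (act h q) = act g q"
      using act_mult[of g "inv h" "act h q"] g assms by simp
    then have "v = act (g \<otimes> inv h) (act h q)" using g(2) by simp
    then show "v \<in> orbit G act (act h q)" unfolding orbit_def using g(1) assms(2) by blast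
  qed
  then show ?thesis using assms(3) finite_subset by blast
qed

text \<open>The elements of length at most \<open>n\<close> move \<open>p\<close> to at least \<open>n + 1\<close> points, since otherwise
  the orbit would stop growing.\<close>

lemma short_element_moving_off:
  assumes p: "p \<in> \<SS>" and inf: "infinite (orbit G act p)" and Q: "finite Q" "card Q \<le> M"
  shows "\<exists>g\<in>carrier G. wl g \<le> M \<and> act g p \<notin> Q"
proof -
  define Y where "Y n = (\<lambda>g. act g p) ` {g \<in> carrier G. wl g \<le> n}" for n
  have fin: "finite (Y n)" for n unfolding Y_def using finite_ball by simp
  have pY: "p \<in> Y n" for n
    unfolding Y_def by (rule image_eqI[of _ _ \<one>]) (simp_all add: act_one p wl_one)
  have stop: "\<not> Y (Suc j) \<subseteq> Y j" for j
  proof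
    assume sub: "Y (Suc j) \<subseteq> Y j"
    have AA: "A \<union> m_inv G ` A \<subseteq> carrier G" using gens_subset by auto
    have word: "act (foldr (\<otimes>) w \<one>) p \<in> Y j" if "set w \<subseteq> A \<union> m_inv G ` A" for w
      using that
    proof (induction w)
      case Nil
      then show ?case using pY act_one[OF p] by simp
    next
      case (Cons a w)
      define g where "g = foldr (\<otimes>) w \<one>"
      have a: "a \<in> carrier G" "wl a \<le> 1" using Cons.prems AA wl_gen[of a] by auto
      have g: "g \<in> carrier G" unfolding g_def using Cons.prems AA by (intro foldr_mult_closed) auto
      have "act g p \<in> Y j" unfolding g_def using Cons by simp
      then obtain g' where g': "g' \<in> carrier G" "wl g' \<le> j" "act g p = act g' p"
        unfolding Y_def by auto
      have "act (a \<otimes> g) p = act (a \<otimes> g') p" using act_mult[OF a(1) _ p] g g' by simp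
      moreover have "wl (a \<otimes> g') \<le> Suc j" using wl_mult[OF a(1) g'(1)] a(2) g'(2) by simp
      ultimately have "act (a \<otimes> g) p \<in> Y (Suc j)" unfolding Y_def using a(1) g'(1) by auto
      then show ?case using sub unfolding g_def by auto
    qed
    have "orbit G act p \<subseteq> Y j"
    proof
      fix v assume "v \<in> orbit G act p"
      then obtain g where g: "g \<in> carrier G" "v = act g p" unfolding orbit_def by blast
      obtain w where "set w \<subseteq> A \<union> m_inv G ` A" "foldr (\<otimes>) w \<one> = g"
        using word_length_attained[OF gens_subset gens_generate g(1)] by blast
      then show "v \<in> Y j" using word[of w] g(2) by simp
    qed
    then show False using inf fin finite_subset by blast
  qed
  have "card (Y n) \<ge> Suc n" for n
  proof (induction n)
    case 0
    have "Y 0 \<noteq> {}" using pY by blast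
    then show ?case using fin[of 0] by (simp add: Suc_le_eq card_gt_0_iff)
  next
    case (Suc n)
    have "Y n \<subseteq> Y (Suc n)" unfolding Y_def by auto
    then have "Y n \<subset> Y (Suc n)" using stop[of n] by blast
    then show ?case using psubset_card_mono[OF fin] Suc by (meson Suc_leI le_trans less_le_trans not_less_eq_eq)
  qed
  then have "\<not> Y M \<subseteq> Q" using card_mono[OF Q(1), of "Y M"] Q(2) by (metis Suc_n_not_le_n le_trans)
  then show ?thesis unfolding Y_def by blast
qed

text \<open>A uniform version of B. H. Neumann's lemma: an element that moves a finite set off another one can
  be chosen of length bounded in terms of the two cardinalities. To move one more point \<open>p\<close>,
  the other points are first moved off a larger set, so that it remains possible to
  correct the image of \<open>p\<close>.\<close>

lemma short_element_separating:
  fixes O' :: "'d set"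
  assumes inv: "\<And>g p. g \<in> carrier G \<Longrightarrow> p \<in> O' \<Longrightarrow> act g p \<in> O'" and sub: "O' \<subseteq> \<SS>"
    and inf: "\<And>p. p \<in> O' \<Longrightarrow> infinite (orbit G act p)"
  shows "\<exists>r. \<forall>P Q. finite P \<and> card P \<le> k \<and> P \<subseteq> O' \<and> finite Q \<and> card Q \<le> M
    \<longrightarrow> (\<exists>z\<in>carrier G. wl z \<le> r \<and> act z ` P \<inter> Q = {})"
proof (induction k arbitrary: M)
  case 0
  have "\<exists>z\<in>carrier G. wl z \<le> 0 \<and> act z ` P \<inter> Q = {}" if "finite P" "card P \<le> 0" for P Q
    using that wl_one by (intro bexI[of _ \<one>]) auto
  then show ?case by blast
next
  case (Suc k)
  obtain r where r: "\<forall>P Q. finite P \<and> card P \<le> k \<and> P \<subseteq> O' \<and> finite Q \<and> card Q \<le> M + M * M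
    \<longrightarrow> (\<exists>z\<in>carrier G. wl z \<le> r \<and> act z ` P \<inter> Q = {})"
    using Suc.IH[of "M + M * M"] ..
  show ?case
  proof (rule exI[of _ "M + r"], intro allI impI, elim conjE)
    fix P Q :: "'d set"
    assume P: "finite P" "card P \<le> Suc k" "P \<subseteq> O'" and Q: "finite Q" "card Q \<le> M"
    show "\<exists>z\<in>carrier G. wl z \<le> M + r \<and> act z ` P \<inter> Q = {}"
    proof (cases "P = {}")
      case True
      then show ?thesis using wl_one by (intro bexI[of _ \<one>]) auto
    next
      case False
      then obtain p where p: "p \<in> P" by blast
      define P' where "P' = P - {p}"
      have P': "finite P'" "card P' \<le> k" "P' \<subseteq> O'" "P = insert p P'"
        using P p unfolding P'_def by auto
      have "\<forall>q\<in>Q \<inter> O'. \<exists>u. u \<in> carrier G \<and> wl u \<le> M \<and> act u q \<notin> Q"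
        using short_element_moving_off[OF _ inf Q] sub by blast
      from bchoice[OF this] obtain u where
        u: "\<forall>q\<in>Q \<inter> O'. u q \<in> carrier G \<and> wl (u q) \<le> M \<and> act (u q) q \<notin> Q" ..
      \<comment> \<open>If \<open>w\<close> moves \<open>p\<close> into \<open>Q\<close>, at \<open>q\<close>, then following \<open>w\<close> by \<open>u q\<close> moves \<open>p\<close> out again. It does
        no harm to the other points if \<open>w\<close> has moved them off the preimage of \<open>Q\<close> under \<open>u q\<close>.\<close>
      define Q' where "Q' = Q \<union> (\<Union>q\<in>Q \<inter> O'. act (inv (u q)) ` Q)"
      have "card (\<Union>q\<in>Q \<inter> O'. act (inv (u q)) ` Q) \<le> (\<Sum>q\<in>Q \<inter> O'. card (act (inv (u q)) ` Q))"
        using Q(1) by (intro card_UN_le) simp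
      also have "\<dots> \<le> of_nat (card (Q \<inter> O')) * M"
        by (rule sum_bounded_above) (use card_image_le[OF Q(1)] Q(2) le_trans in blast)
      also have "\<dots> \<le> M * M" using card_mono[OF Q(1), of "Q \<inter> O'"] Q(2) by simp
      finally have "card Q' \<le> M + M * M"
        unfolding Q'_def using card_Un_le[of Q "\<Union>q\<in>Q \<inter> O'. act (inv (u q)) ` Q"] Q(2) by linarith
      moreover have "finite Q'" unfolding Q'_def using Q(1) by simp
      ultimately obtain w where w: "w \<in> carrier G" "wl w \<le> r" "act w ` P' \<inter> Q' = {}"
        using r[rule_format, of P' Q'] P'(1-3) by blast
      show ?thesis
      proof (cases "act w p \<in> Q")
        case False
        then have "act w ` P \<inter> Q = {}" using w(3) P'(4) unfolding Q'_def by auto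
        then show ?thesis using w by (intro bexI[of _ w]) auto
      next
        case True
        define q where "q = act w p"
        have q: "q \<in> Q \<inter> O'" using True inv[OF w(1)] p P(3) unfolding q_def by auto
        then have uq: "u q \<in> carrier G" "wl (u q) \<le> M" "act (u q) q \<notin> Q" using u by auto
        have "act (u q \<otimes> w) x \<notin> Q" if x: "x \<in> P" for x
        proof -
          have xO: "x \<in> \<SS>" using x P(3) sub by blast
          have e: "act (u q \<otimes> w) x = act (u q) (act w x)" using act_mult[OF uq(1) w(1) xO] .
          show ?thesis
          proof (cases "x = p")
            case True
            then show ?thesis using e uq(3) unfolding q_def by simp
          next
            case False
            then have "act w x \<notin> Q'" using w(3) x P'(4) by blast
            then have "act w x \<notin> act (inv (u q)) ` Q" using q unfolding Q'_def by blast
            moreover have "act w x = act (inv (u q)) (act (u q) (act w x))" using uq(1) w(1) xO by simp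
            ultimately show ?thesis using e by (metis imageI)
          qed
        qed
        then have "act (u q \<otimes> w) ` P \<inter> Q = {}" by blast
        moreover have "wl (u q \<otimes> w) \<le> M + r" using wl_mult[OF uq(1) w(1)] uq(2) w(2) by linarith
        ultimately show ?thesis using uq(1) w(1) by blast
      qed
    qed
  qed
qed

text \<open>If the orbit of an eyrie were infinite, elements that move the base point far in \<open>j\<close> eyries
  and in one eyrie could be combined to \<open>x \<otimes> w \<otimes> x'\<close>, which moves it far in \<open>j + 1\<close> eyries,
  where \<open>w\<close> is short and separates the two families. But the number of eyries in which
  two points are far apart is bounded.\<close>

lemma eyrie_orbit_finite:
  assumes "V0 \<in> Eys"
  shows "finite (orbit G act V0)"
proof (rule ccontr)
  assume inf: "infinite (orbit G act V0)"
  define O' where "O' = {V \<in> Eys. infinite (orbit G act V)}"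
  have OE: "O' \<subseteq> Eys" unfolding O'_def by auto
  have OS: "O' \<subseteq> \<SS>" using OE EysD(1) by blast
  have inv: "act g p \<in> O'" if "g \<in> carrier G" "p \<in> O'" for g p
    using that act_Eys[of p g] infinite_orbit_act[of p g] OS unfolding O'_def by blast
  have io: "infinite (orbit G act p)" if "p \<in> O'" for p using that unfolding O'_def by simp
  have V0: "V0 \<in> O'" using inf assms unfolding O'_def by blast
  obtain K where K: "\<forall>x\<in>carrier G. \<forall>y\<in>carrier G.
    finite {U \<in> Eys. dd U x y > E} \<and> card {U \<in> Eys. dd U x y > E} \<le> K"
    using eyries_far_apart_bound ..
  define F where "F x = {V \<in> O'. dd V \<one> x > E}" for x
  have F: "finite (F x)" "card (F x) \<le> K" if x: "x \<in> carrier G" for x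
  proof -
    have s: "F x \<subseteq> {U \<in> Eys. dd U \<one> x > E}" unfolding F_def using OE by blast
    have f: "finite {U \<in> Eys. dd U \<one> x > E}" "card {U \<in> Eys. dd U \<one> x > E} \<le> K"
      using K x by auto
    show "finite (F x)" using s f(1) by (rule finite_subset)
    show "card (F x) \<le> K" using card_mono[OF f(1) s] f(2) by linarith
  qed
  obtain r where r: "\<forall>P Q. finite P \<and> card P \<le> K \<and> P \<subseteq> O' \<and> finite Q \<and> card Q \<le> K
    \<longrightarrow> (\<exists>z\<in>carrier G. wl z \<le> r \<and> act z ` P \<inter> Q = {})"
    using short_element_separating[OF inv OS io, of K K] ..
  define D where "D = E * real r + E"
  have D: "0 \<le> D" unfolding D_def using E_ge_1 by simp
  have many: "\<exists>x\<in>carrier G. \<exists>T. finite T \<and> card T = j \<and> T \<subseteq> O' \<and> (\<forall>V\<in>T. dd V \<one> x > L)"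
    if "L \<ge> E" for j L using that
  proof (induction j arbitrary: L)
    case 0
    then show ?case by (intro bexI[of _ \<one>] exI[of _ "{}"]) auto
  next
    case (Suc j)
    have L': "L + D + E \<ge> E" "L + D + E \<ge> L" using Suc.prems D E_ge_1 by auto
    obtain x T where x: "x \<in> carrier G" and T: "finite T" "card T = j" "T \<subseteq> O'"
      "\<forall>V\<in>T. dd V \<one> x > L + D + E" using Suc.IH[OF L'(1)] by blast
    obtain x' where x': "x' \<in> carrier G" "dd V0 \<one> x' > L + D + E"
      using unb_far[OF EysD(1,2)[OF assms] one_closed] by blast
    \<comment> \<open>Acting by \<open>inv (x \<otimes> w)\<close> turns the part of the path \<open>\<one>\<close>, \<open>x\<close>, \<open>x \<otimes> w\<close>, \<open>x \<otimes> w \<otimes> x'\<close> after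
      \<open>x \<otimes> w\<close> into one from \<open>\<one>\<close> to \<open>x'\<close>. So \<open>z = inv w\<close> has to move the domains
      \<open>act (inv x) V\<close> with \<open>V \<in> F x\<close> off \<open>F x'\<close>.\<close>
    define P where "P = act (inv x) ` F x"
    have P: "finite P" "card P \<le> K" "P \<subseteq> O'"
    proof -
      show "finite P" unfolding P_def using F(1)[OF x] by simp
      show "card P \<le> K" unfolding P_def using card_image_le[OF F(1)[OF x], of "act (inv x)"] F(2)[OF x] by linarith
      show "P \<subseteq> O'" unfolding P_def F_def using inv[of "inv x"] x by auto
    qed
    obtain z where z: "z \<in> carrier G" "wl z \<le> r" "act z ` P \<inter> F x' = {}"
      using r[rule_format, of P "F x'"] P F[OF x'(1)] by blast
    define w where "w = inv z"
    define v where "v = x \<otimes> w"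
    define y where "y = v \<otimes> x'"
    have c: "w \<in> carrier G" "v \<in> carrier G" "y \<in> carrier G"
      unfolding y_def v_def w_def using x z x' by auto
    have vz: "v \<otimes> z = x" unfolding v_def w_def using x z by (simp add: m_assoc)
    have iv: "inv v = z \<otimes> inv x" unfolding v_def w_def using x z by (simp add: inv_mult_group)
    have avoid: "act (inv v) V \<notin> F x'" if "V \<in> F x" for V
    proof -
      have "V \<in> \<SS>" using that OS unfolding F_def by blast
      then have "act (inv v) V = act z (act (inv x) V)" unfolding iv using x z by (simp add: act_mult)
      then show ?thesis using z(3) that unfolding P_def by blast
    qed
    have xv: "dd V x v \<le> D" if "V \<in> \<SS>" for V
    proof -
      have "dd V v (v \<otimes> z) \<le> E * real (wl z) + E" using dd_right_mult[OF that c(2) z(1)] .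
      moreover have "E * real (wl z) \<le> E * real r" using z(2) E_ge_1 by (intro mult_left_mono) auto
      ultimately show ?thesis unfolding vz D_def using dd_commute[of V v x] by simp
    qed
    define V'' where "V'' = act v V0"
    have V0S: "V0 \<in> \<SS>" using V0 OS by blast
    have V'': "V'' \<in> O'" "V'' \<in> \<SS>" "act (inv v) V'' = V0"
      unfolding V''_def using inv[OF c(2) V0] OS V0S c(2) by auto
    have "V0 \<in> F x'" unfolding F_def using V0 x'(2) L'(2) Suc.prems by simp
    then have V''F: "V'' \<notin> F x" using avoid[of V''] V''(3) by metis
    have TF: "T \<subseteq> F x" unfolding F_def using T(3,4) L'(1) by fastforce
    have old: "dd V \<one> y > L" if V: "V \<in> T" for V
    proof -
      have VS: "V \<in> \<SS>" "V \<in> O'" using V T(3) OS by auto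
      have "act (inv v) V \<notin> F x'" using avoid V TF by blast
      moreover have "act (inv v) V \<in> O'" using inv[of "inv v" V] c(2) VS by simp
      ultimately have "dd (act (inv v) V) \<one> x' \<le> E" unfolding F_def by auto
      then have "dd V v y \<le> E" unfolding y_def using dd_shift[OF VS(1) c(2) one_closed x'(1)] c(2) by simp
      moreover have "dd V \<one> x \<le> dd V \<one> y + dd V y v + dd V v x"
        using dd_triangle[OF VS(1) one_closed c(3) x] dd_triangle[OF VS(1) c(3,2) x] by linarith
      ultimately show ?thesis using xv[OF VS(1)] T(4) V dd_commute[of V y v] dd_commute[of V v x] by fastforce
    qed
    have new: "dd V'' \<one> y > L"
    proof -
      have "dd V'' v y = dd V0 \<one> x'" unfolding V''_def y_def using dd_act[OF V0S c(2) one_closed x'(1)] c(2) by simp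
      moreover have "dd V'' \<one> x \<le> E" using V''F V''(1) unfolding F_def by auto
      moreover have "dd V'' v y \<le> dd V'' v x + dd V'' x \<one> + dd V'' \<one> y"
        using dd_triangle[OF V''(2) c(2) x c(3)] dd_triangle[OF V''(2) x one_closed c(3)] by linarith
      ultimately show ?thesis
        using xv[OF V''(2)] x'(2) dd_commute[of V'' v x] dd_commute[of V'' x \<one>] by linarith
    qed
    have "V'' \<notin> T" using V''F TF by blast
    then show ?case using T(1-3) old new V''(1) c(3)
      by (intro bexI[of _ y] exI[of _ "insert V'' T"]) auto
  qed
  obtain x T where x: "x \<in> carrier G" and T: "finite T" "card T = Suc K" "T \<subseteq> O'" "\<forall>V\<in>T. dd V \<one> x > E"
    using many[OF order_refl, of "Suc K"] by blast
  have "T \<subseteq> F x" unfolding F_def using T by auto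
  from card_mono[OF F(1)[OF x] this] show False using F(2)[OF x] T(2) by linarith
qed

lemma finite_Eys: "finite Eys"
proof -
  have "Eys \<subseteq> \<Union>{Ob \<in> orbits G \<SS> act. finite Ob}"
  proof
    fix U assume U: "U \<in> Eys"
    then have "U \<in> \<SS>" "finite (orbit G act U)" using EysD(1) eyrie_orbit_finite by auto
    then show "U \<in> \<Union>{Ob \<in> orbits G \<SS> act. finite Ob}"
      using orbit_refl[of U] unfolding orbits_def by blast
  qed
  moreover have "finite (\<Union>{Ob \<in> orbits G \<SS> act. finite Ob})"
    by (rule finite_Union) (use finite_orbits in auto)
  ultimately show ?thesis by (rule finite_subset)
qed

lemma stab_finite_index:
  assumes "U \<in> Eys"
  shows "finite_index G (stab U)"
proof (rule finite_indexI_classify[OF stabilizer_subgroup finite_index_carrier, of U "\<lambda>g. act (inv g) U"])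
  show US: "U \<in> \<SS>" using EysD assms by blast
  show "finite ((\<lambda>g. act (inv g) U) ` carrier G)"
    by (rule finite_subset[OF _ eyrie_orbit_finite[OF assms]]) (auto simp: orbit_def)
  fix g h assume gh: "g \<in> carrier G" "h \<in> carrier G" "act (inv g) U = act (inv h) U"
  have "act (g \<otimes> inv h) U = act g (act (inv g) U)" using gh US by (simp add: act_mult)
  also have "\<dots> = U" using gh(1) US by simp
  finally show "g \<otimes> inv h \<in> stab U" using gh(1,2) by (intro stabI) auto
qed

lemma finite_index_cobounded:
  assumes "finite_index G H"
  shows "\<exists>R\<ge>0. \<forall>g\<in>carrier G. \<exists>h\<in>H. \<forall>W\<in>\<SS>. dd W h g \<le> R"
proof -
  obtain T where T: "finite T" "T \<subseteq> carrier G" "\<And>g. g \<in> carrier G \<Longrightarrow> \<exists>h\<in>H. \<exists>t\<in>T. g = h \<otimes> t"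
    by (rule finite_index_cover[OF assms]) (rule that)
  obtain D where D: "D \<ge> 0" "\<And>U g t. \<lbrakk>U \<in> \<SS>; g \<in> carrier G; t \<in> T\<rbrakk> \<Longrightarrow> dd U g (g \<otimes> t) \<le> D"
    by (rule finite_set_displacement[OF T(1,2)]) (rule that)
  have HG: "H \<subseteq> carrier G" using assms subgroup.subset unfolding finite_index_def by blast
  show ?thesis
  proof (intro exI[of _ D] conjI ballI D(1))
    fix g assume g: "g \<in> carrier G"
    obtain h t where ht: "h \<in> H" "t \<in> T" "g = h \<otimes> t" using T(3)[OF g] by blast
    have "dd W h g \<le> D" if W: "W \<in> \<SS>" for W
      unfolding ht(3) using D(2)[OF W _ ht(2)] HG ht(1) by blast
    then show "\<exists>h\<in>H. \<forall>W\<in>\<SS>. dd W h g \<le> D" using ht(1) by blast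
  qed
qed

lemma pi_stab: "\<lbrakk>U \<in> \<SS>; g \<in> stab U; x \<in> carrier G\<rbrakk> \<Longrightarrow> mv g U (\<pi> U x) = \<pi> U (g \<otimes> x)"
  using mv_proj[of g x U] stabD[of g U] by simp

lemma mv_stab_isometry:
  "\<lbrakk>U \<in> \<SS>; g \<in> stab U; p \<in> mspace (C U); q \<in> mspace (C U)\<rbrakk> \<Longrightarrow>
    mv g U p \<in> mspace (C U) \<and> mdist (C U) (mv g U p) (mv g U q) = mdist (C U) p q"
  using mv_isometry[of g U p q] mv_bij[of g U] stabD[of g U] by (auto simp: bij_betw_def)

text \<open>A group that fixes two transverse domains preserves the bounded set that one of them
  determines in the other.\<close>

lemma transverse_stabilizers_bounded:
  assumes U: "U \<in> \<SS>" and V: "V \<in> \<SS>" and tr: "transverse nest orth U V"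
  shows "\<exists>B. \<forall>g\<in>stab U \<inter> stab V. dd U \<one> g \<le> B"
proof -
  have tr': "transverse nest orth V U"
    using tr orth_sym U V unfolding transverse_def by (meson symp_onD)
  have rho: "rho V U \<noteq> {}" "rho V U \<subseteq> mspace (C U)" "mdiam (C U) (rho V U) \<le> ennreal E"
    using rho_transverse[OF V U tr'] by auto
  then obtain r where r: "r \<in> rho V U" "r \<in> mspace (C U)" by blast
  have "dd U \<one> g \<le> 2 * mdist (C U) (\<pi> U \<one>) r + E" if g: "g \<in> stab U" "g \<in> stab V" for g
  proof -
    have gc: "g \<in> carrier G" "act g U = U" "act g V = V" using g stabD by auto
    have "mv g U ` rho V U = rho V U" using mv_rho[OF gc(1) U V] tr gc(2,3) by simp
    then have mr: "mv g U r \<in> rho V U" using r by blast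
    have 1: "mdist (C U) (mv g U r) r \<le> E" using mdist_le_mdiam[OF rho(3) _ mr r(1)] E_ge_1 by simp
    have 2: "mdist (C U) (\<pi> U g) (mv g U r) = mdist (C U) (\<pi> U \<one>) r"
      using mv_stab_isometry[OF U g(1) pi_in[OF U one_closed] r(2)] pi_stab[OF U g(1) one_closed] gc(1) by simp
    have m: "\<pi> U g \<in> mspace (C U)" "\<pi> U \<one> \<in> mspace (C U)" "mv g U r \<in> mspace (C U)"
      using U gc(1) mr rho(2) by auto
    show ?thesis using mdist_triangle[OF m(2) r(2) m(1)] mdist_triangle[OF r(2) m(3) m(1)] 1 2 mdist_commute[of "C U" r "mv g U r"] mdist_commute[of "C U" "mv g U r" "\<pi> U g"]
      unfolding dd_def by linarith
  qed
  then show ?thesis by blast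
qed

text \<open>The stabilisers of two transverse eyries meet in a subgroup of finite index, whose orbits in
  either eyrie would be both coarsely dense and bounded.\<close>

lemma Eys_orthogonal:
  assumes U: "U \<in> Eys" and V: "V \<in> Eys" and ne: "U \<noteq> V"
  shows "orth U V"
proof (rule ccontr)
  assume no: "\<not> orth U V"
  note US = EysD[OF U] and VS = EysD[OF V]
  have "transverse nest orth U V"
    using no ne US(3)[OF VS(1,2)] VS(3)[OF US(1,2)] unfolding transverse_def by blast
  from transverse_stabilizers_bounded[OF US(1) VS(1) this]
  obtain B where B: "\<forall>g\<in>stab U \<inter> stab V. dd U \<one> g \<le> B" ..
  have "finite_index G (stab U \<inter> stab V)"
    by (intro finite_index_Int stab_finite_index U V)
  from finite_index_cobounded[OF this] obtain R where
    R: "\<forall>g\<in>carrier G. \<exists>h\<in>stab U \<inter> stab V. \<forall>W\<in>\<SS>. dd W h g \<le> R" by blast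
  have "bounded_space (C U)"
  proof (rule boundedI_dd[OF US(1)])
    fix g assume g: "g \<in> carrier G"
    obtain h where h: "h \<in> stab U \<inter> stab V" "dd U h g \<le> R" using R US(1) g by blast
    have "h \<in> carrier G" using h stabD by blast
    then have "dd U \<one> g \<le> dd U \<one> h + dd U h g" using dd_triangle[OF US(1) one_closed _ g] by blast
    then show "dd U \<one> g \<le> B + R" using bspec[OF B h(1)] h(2) by linarith
  qed
  then show False using US(2) by blast
qed

end

section \<open>Domains below a quasiline\<close>

context HHG
begin

lemma pnested_act:
  assumes "g \<in> stab W" "V \<in> \<SS>" "W \<in> \<SS>"
  shows "pnested nest (act g V) W \<longleftrightarrow> pnested nest V W"
proof -
  have g: "g \<in> carrier G" "act g W = W" using stabD[OF assms(1)] by auto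
  have "nest (act g V) W \<longleftrightarrow> nest V W" using act_nest[OF g(1) assms(2,3)] g(2) by simp
  moreover have "act g V = W \<longleftrightarrow> V = W" using g act_inv[OF g(1) assms(2)] act_inv[OF g(1) assms(3)] by metis
  ultimately show ?thesis unfolding pnested_def by blast
qed

lemma stab_inv: "U \<in> \<SS> \<Longrightarrow> g \<in> stab U \<Longrightarrow> inv g \<in> stab U"
  using stabilizer_m_inv_closed by blast

lemma stab_mult: "U \<in> \<SS> \<Longrightarrow> g \<in> stab U \<Longrightarrow> h \<in> stab U \<Longrightarrow> g \<otimes> h \<in> stab U"
  using stabilizer_m_closed by blast

lemma act_max_below:
  assumes T: "T \<in> max_below W" and W: "W \<in> \<SS>" and g: "g \<in> stab W"
  shows "act g T \<in> max_below W"
proof -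
  note T' = max_belowD[OF T]
  have gc: "g \<in> carrier G" using g stabD by blast
  have "V = act g T" if V: "V \<in> \<SS>" "pnested nest V W" "unb V" "nest (act g T) V" for V
  proof -
    have "nest (act (inv g) (act g T)) (act (inv g) V)" using act_nest[of "inv g" "act g T" V] gc T'(1) V by simp
    then have "nest T (act (inv g) V)" using gc T'(1) by simp
    moreover have "pnested nest (act (inv g) V) W" using pnested_act[OF stab_inv[OF W g] V(1) W] V(2) by blast
    moreover have "unb (act (inv g) V)" using bounded_act[of V "inv g"] V gc by simp
    ultimately have "act (inv g) V = T" using T'(6)[of "act (inv g) V"] V(1) gc by simp
    then show ?thesis using V(1) gc by auto
  qed
  moreover have "act g T \<in> \<SS>" "pnested nest (act g T) W" "unb (act g T)"
    using T' gc pnested_act[OF g T'(1) W] bounded_act[OF T'(1) gc] by auto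
  ultimately show ?thesis unfolding max_below_def by blast
qed

lemma rho_bounded:
  assumes "V \<in> \<SS>" "W \<in> \<SS>" "pnested nest V W" "a \<in> rho V W" "b \<in> rho V W"
  shows "a \<in> mspace (C W)" "mdist (C W) a b \<le> E"
proof -
  have r: "rho V W \<subseteq> mspace (C W)" "mdiam (C W) (rho V W) \<le> ennreal E" using rho_nested[OF assms(1-3)] by auto
  show "a \<in> mspace (C W)" using r assms by blast
  show "mdist (C W) a b \<le> E" using mdist_le_mdiam[OF r(2) _ assms(4,5)] E_ge_1 by simp
qed

lemma realise_in_nested:
  assumes "V \<in> \<SS>" "W \<in> \<SS>" "pnested nest V W" "q \<in> mspace (C V)" "a \<in> rho V W"
  shows "\<exists>x\<in>carrier G. mdist (C V) (\<pi> V x) q \<le> E \<and> mdist (C W) (\<pi> W x) a \<le> 2 * E + 1"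
proof -
  have "\<exists>x\<in>carrier G. mdist (C V) (\<pi> V x) q \<le> E \<and> mset_dist (C W) {\<pi> W x} (rho V W) \<le> E"
    using partial_realisation[of "{V}" "\<lambda>_. q"] assms word_metric(1) by (auto simp: pairwise_def)
  then obtain x where x: "x \<in> carrier G" "mdist (C V) (\<pi> V x) q \<le> E"
    "mset_dist (C W) {\<pi> W x} (rho V W) < E + 1" by force
  obtain b where b: "b \<in> rho V W" "mdist (C W) (\<pi> W x) b < E + 1"
    using mset_dist_witness[OF _ _ x(3)] assms(5) by blast
  have m: "\<pi> W x \<in> mspace (C W)" "b \<in> mspace (C W)" "a \<in> mspace (C W)" "mdist (C W) b a \<le> E"
    using x(1) assms rho_bounded[OF assms(1-3) b(1) assms(5)] rho_bounded[OF assms(1-3) assms(5) b(1)] by auto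
  have "mdist (C W) (\<pi> W x) a \<le> 2 * E + 1" using mdist_triangle[OF m(1-3)] b(2) m(4) by linarith
  then show ?thesis using x by blast
qed

text \<open>An isometry that moves a point \<open>z\<close> of \<open>C W\<close> only a little moves it almost nothing in domains whose
  \<open>\<rho>\<close>-set is far from \<open>z\<close>, by the bounded geodesic image axiom.\<close>

lemma still_in_far_domain:
  assumes T: "T \<in> \<SS>" and W: "W \<in> \<SS>" and TW: "pnested nest T W" and g: "g \<in> stab W" and z: "z \<in> carrier G"
    and small: "dd W z (g \<otimes> z) \<le> c" and far: "\<forall>b\<in>rho T W. mdist (C W) (\<pi> W z) b > c + E + 1"
  shows "dd (act g T) z (g \<otimes> z) \<le> E"
proof (rule ccontr)
  assume "\<not> dd (act g T) z (g \<otimes> z) \<le> E"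
  then have big: "mdist (C (act g T)) (\<pi> (act g T) z) (\<pi> (act g T) (g \<otimes> z)) > E" unfolding dd_def by simp
  have gc: "g \<in> carrier G" "act g W = W" using stabD[OF g] by auto
  have gz: "g \<otimes> z \<in> carrier G" using gc z by simp
  have gT: "act g T \<in> \<SS>" "pnested nest (act g T) W" using gc T pnested_act[OF g T W] TW by auto
  obtain S where S: "geodesic_segment (C W) (\<pi> W z) (\<pi> W (g \<otimes> z)) S"
    using geodesic[OF W] pi_in[OF W z] pi_in[OF W gz] unfolding geodesic_space_def by blast
  have "mset_dist (C W) (rho (act g T) W) S \<le> E"
    using bounded_geodesic_image'[OF gT(1) W gT(2) _ _ big S] z gz word_metric(1) by simp
  then have lt: "mset_dist (C W) (rho (act g T) W) S < E + 1" by simp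
  have ne: "rho (act g T) W \<noteq> {}" using rho_nested[OF gT(1) W gT(2)] by blast
  have "S \<noteq> {}" using geodesic_segment_ends[OF S] by blast
  then obtain b s where bs: "b \<in> rho (act g T) W" "s \<in> S" "mdist (C W) b s < E + 1"
    using mset_dist_witness[OF ne _ lt] by blast
  have "mv g W ` rho T W = rho (act g T) W" using mv_rho[OF gc(1) W T] TW gc(2) by simp
  then obtain b0 where b0: "b0 \<in> rho T W" "b = mv g W b0" using bs(1) by blast
  have b0m: "b0 \<in> mspace (C W)" using rho_bounded(1)[OF T W TW b0(1) b0(1)] .
  have bm: "b \<in> mspace (C W)" using mv_stab_isometry[OF W g b0m b0m] b0(2) by simp
  have e: "mdist (C W) (\<pi> W (g \<otimes> z)) b = mdist (C W) (\<pi> W z) b0"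
    using mv_stab_isometry[OF W g pi_in[OF W z] b0m] pi_stab[OF W g z] b0(2) by simp
  note sp = geodesic_segment_point[OF S bs(2)]
  have "mdist (C W) (\<pi> W (g \<otimes> z)) s \<le> c"
    using sp(2) small mdist_nonneg[of "C W" "\<pi> W z" s] mdist_commute[of "C W" s "\<pi> W (g \<otimes> z)"]
    unfolding dd_def by linarith
  then have "mdist (C W) (\<pi> W (g \<otimes> z)) b < c + E + 1"
    using mdist_triangle[OF pi_in[OF W gz] sp(1) bm] bs(3) mdist_commute[of "C W" s b] by linarith
  then show False using far b0(1) e by force
qed

text \<open>A form of acylindricity. The points \<open>y\<close> and \<open>y'\<close> are far from \<open>\<rho>\<^sup>T\<^sub>W\<close> in \<open>C W\<close> and far from each other
  in \<open>C T\<close>. If \<open>g\<close> moves both a little in \<open>C W\<close>, then it moves both almost nothing in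
  \<open>C (act g T)\<close>, so they are far apart there as well, and there are finitely many
  such domains.\<close>

lemma finitely_many_translates:
  assumes W: "W \<in> Eys" and T: "T \<in> max_below W"
  shows "\<exists>y\<in>carrier G. \<exists>y'\<in>carrier G. \<exists>F. finite F \<and>
    (\<forall>g\<in>stab W. dd W y (g \<otimes> y) \<le> c \<and> dd W y' (g \<otimes> y') \<le> c \<longrightarrow> act g T \<in> F)"
proof -
  note WS = EysD[OF W] and TS = max_belowD[OF T]
  obtain R where R: "R \<ge> 0" "\<forall>g\<in>carrier G. \<exists>h\<in>stab W. \<forall>V\<in>\<SS>. dd V h g \<le> R"
    using finite_index_cobounded[OF stab_finite_index[OF W]] by blast
  obtain a where a: "a \<in> rho T W" using rho_nested[OF TS(1) WS(1) TS(2)] by blast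
  have am: "a \<in> mspace (C W)" using rho_bounded(1)[OF TS(1) WS(1) TS(2) a a] .
  define D where "D = c + 2 * E + 1"
  have far: "\<forall>b\<in>rho T W. mdist (C W) (\<pi> W z) b > c + E + 1"
    if z: "z \<in> carrier G" and za: "mdist (C W) (\<pi> W z) a > D" for z
  proof
    fix b assume b: "b \<in> rho T W"
    have bm: "b \<in> mspace (C W)" "mdist (C W) b a \<le> E" using rho_bounded[OF TS(1) WS(1) TS(2) b a] .
    show "mdist (C W) (\<pi> W z) b > c + E + 1"
      using mdist_triangle[OF pi_in[OF WS(1) z] bm(1) am] bm(2) za unfolding D_def by linarith
  qed
  define a0 where "a0 = mdist (C W) (\<pi> W \<one>) a"
  obtain y where y: "y \<in> carrier G" "dd W \<one> y > D + a0"
    using unb_far[OF WS(1,2) one_closed] by blast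
  have p1: "\<pi> W \<one> \<in> mspace (C W)" using WS(1) by simp
  have ya: "mdist (C W) (\<pi> W y) a > D"
    using mdist_triangle[OF p1 am pi_in[OF WS(1) y(1)]] y(2) mdist_commute[of "C W" a "\<pi> W y"]
    unfolding dd_def a0_def by linarith
  obtain t where t: "t \<in> carrier G" "dd W \<one> t > D + R + 2 * E + 1"
    using unb_far[OF WS(1,2) one_closed] by blast
  obtain q where q: "q \<in> mspace (C T)" "mdist (C T) (\<pi> T y) q > 5 * E + R + E * real (wl t)"
    using unbounded_far[OF TS(3) pi_in[OF TS(1) y(1)]] by blast
  obtain p where p: "p \<in> carrier G" "mdist (C T) (\<pi> T p) q \<le> E" "mdist (C W) (\<pi> W p) a \<le> 2 * E + 1"
    using realise_in_nested[OF TS(1) WS(1) TS(2) q(1) a] by blast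
  obtain h where h: "h \<in> stab W" "\<forall>V\<in>\<SS>. dd V h p \<le> R" using R p(1) by blast
  have hc: "h \<in> carrier G" using h(1) stabD by blast
  \<comment> \<open>The point \<open>p\<close> is far from \<open>y\<close> in \<open>C T\<close> but over \<open>\<rho>\<^sup>T\<^sub>W\<close>. The step \<open>t\<close>, chosen before \<open>p\<close>, leads away
    from \<open>\<rho>\<^sup>T\<^sub>W\<close> at bounded cost in \<open>C T\<close>.\<close>
  define y' where "y' = h \<otimes> t"
  have y': "y' \<in> carrier G" unfolding y'_def using hc t by simp
  have "dd W h y' = dd W \<one> t" unfolding y'_def using dd_stab[OF WS(1) h(1) one_closed t(1)] hc by simp
  then have "dd W p y' > D + 2 * E + 1"
    using t(2) dd_triangle[OF WS(1) hc p(1) y'] h(2) WS(1) by fastforce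
  then have y'a: "mdist (C W) (\<pi> W y') a > D"
    using mdist_triangle[OF pi_in[OF WS(1) p(1)] am pi_in[OF WS(1) y']] p(3)
      mdist_commute[of "C W" a "\<pi> W y'"] unfolding dd_def by linarith
  have "dd T y p > 4 * E + R + E * real (wl t)"
    using mdist_triangle[OF pi_in[OF TS(1) y(1)] pi_in[OF TS(1) p(1)] q(1)] q(2) p(2) unfolding dd_def by linarith
  moreover have "dd T h y' \<le> E * real (wl t) + E" unfolding y'_def using dd_right_mult[OF TS(1) hc t(1)] .
  moreover have "dd T h p \<le> R" using h(2) TS(1) by blast
  moreover have "dd T y p \<le> dd T y y' + dd T y' h + dd T h p"
    using dd_triangle[OF TS(1) y(1) y' p(1)] dd_triangle[OF TS(1) y' hc p(1)] by linarith
  ultimately have yy': "dd T y y' > 3 * E" using dd_commute[of T y' h] by linarith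
  define F where "F = {V \<in> max_below W. dd V y y' > E}"
  have "finite F" unfolding F_def by (rule finite_far_max_below[OF WS(1) y(1) y'])
  moreover have "act g T \<in> F"
    if g: "g \<in> stab W" "dd W y (g \<otimes> y) \<le> c" "dd W y' (g \<otimes> y') \<le> c" for g
  proof -
    have gc: "g \<in> carrier G" using g(1) stabD by blast
    let ?V = "act g T"
    have VS: "?V \<in> \<SS>" using gc TS(1) by simp
    have c1: "g \<otimes> y \<in> carrier G" "g \<otimes> y' \<in> carrier G" using gc y y' by auto
    have "dd ?V y (g \<otimes> y) \<le> E" "dd ?V y' (g \<otimes> y') \<le> E"
      using still_in_far_domain[OF TS(1) WS(1) TS(2) g(1) y(1) g(2) far[OF y(1) ya]]
        still_in_far_domain[OF TS(1) WS(1) TS(2) g(1) y' g(3) far[OF y' y'a]] by auto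
    moreover have "dd ?V (g \<otimes> y) (g \<otimes> y') = dd T y y'" using dd_act[OF TS(1) gc y(1) y'] .
    moreover have "dd ?V (g \<otimes> y) (g \<otimes> y') \<le> dd ?V (g \<otimes> y) y + dd ?V y y' + dd ?V y' (g \<otimes> y')"
      using dd_triangle[OF VS c1(1) y(1) c1(2)] dd_triangle[OF VS y(1) y' c1(2)] by linarith
    ultimately have "dd ?V y y' > E" using yy' dd_commute[of ?V "g \<otimes> y" y] by linarith
    then show ?thesis unfolding F_def using act_max_below[OF T WS(1) g(1)] by blast
  qed
  ultimately show ?thesis using y(1) y' by blast
qed

text \<open>Orthogonal domains below \<open>W\<close> are realised by a common point, so their \<open>\<rho>\<close>-sets in \<open>C W\<close> are
  close to each other.\<close>

lemma far_translate_transverse: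
  assumes W: "W \<in> \<SS>" and U: "U \<in> max_below W" and U': "U' \<in> max_below W"
    and far: "\<And>a b. \<lbrakk>a \<in> rho U W; b \<in> rho U' W\<rbrakk> \<Longrightarrow> mdist (C W) a b > 2 * E + 2"
  shows "transverse nest orth U U'"
proof -
  note US = max_belowD[OF U] and US' = max_belowD[OF U']
  have ne: "rho U W \<noteq> {}" "rho U' W \<noteq> {}" using rho_nested US(1,2) US'(1,2) W by blast+
  then obtain a0 b0 where ab: "a0 \<in> rho U W" "b0 \<in> rho U' W" by blast
  have "U \<noteq> U'"
  proof
    assume "U = U'"
    then have "mdist (C W) a0 a0 > 2 * E + 2" using far ab by blast
    then show False using rho_bounded(2)[OF US(1) W US(2) ab(1) ab(1)] E_ge_1 by linarith
  qed
  moreover from this have "\<not> nest U U'" "\<not> nest U' U"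
    using US(6)[OF US'(1-3)] US'(6)[OF US(1-3)] by auto
  moreover have "\<not> orth U U'"
  proof
    assume o: "orth U U'"
    then have "orth U' U" using orth_sym US(1) US'(1) by (meson symp_onD)
    then have pw: "pairwise orth {U, U'}" using o by (auto simp: pairwise_def)
    have pts: "\<pi> V \<one> \<in> mspace (C V)" if "V \<in> {U, U'}" for V using that US(1) US'(1) by auto
    have sub: "{U, U'} \<subseteq> \<SS>" using US(1) US'(1) by auto
    from partial_realisation[OF sub pw pts] obtain x where x: "x \<in> mspace (word_metric G A)"
      "\<forall>V\<in>{U, U'}. \<forall>T\<in>\<SS>. pnested nest V T \<or> transverse nest orth V T \<longrightarrow> mset_dist (C T) {\<pi> T x} (rho V T) \<le> E"
      by blast
    have xc: "x \<in> carrier G" using x(1) word_metric(1) by simp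
    have "mset_dist (C W) {\<pi> W x} (rho U W) < E + 1" "mset_dist (C W) {\<pi> W x} (rho U' W) < E + 1"
      using x(2) US(2) US'(2) W by force+
    then obtain a b where "a \<in> rho U W" "mdist (C W) (\<pi> W x) a < E + 1"
      "b \<in> rho U' W" "mdist (C W) (\<pi> W x) b < E + 1"
      using mset_dist_witness[of "{\<pi> W x}" "rho U W" "C W" "E + 1"]
        mset_dist_witness[of "{\<pi> W x}" "rho U' W" "C W" "E + 1"] ne by (metis insert_not_empty singletonD)
    moreover from this have "a \<in> mspace (C W)" "b \<in> mspace (C W)"
      using rho_bounded(1)[OF US(1) W US(2)] rho_bounded(1)[OF US'(1) W US'(2)] by blast+
    ultimately show False
      using far[of a b] mdist_triangle[of a "C W" "\<pi> W x" b] pi_in[OF W xc] mdist_commute[of "C W" a "\<pi> W x"]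
      by fastforce
  qed
  ultimately show ?thesis unfolding transverse_def by blast
qed

text \<open>Elements \<open>g k\<close> that move the base point little in \<open>W\<close> but arbitrarily far in a domain \<open>U\<close> below
  \<open>W\<close>. Balls of a quasiline are coarsely finite, so after passing to an infinite set of indices the
  \<open>g k\<close> differ by elements that fix \<open>U\<close> and a transverse translate of \<open>U\<close>. Those
  have bounded orbits in \<open>C U\<close>.\<close>

lemma no_unbounded_below_quasiline:
  assumes W: "W \<in> Eys" and ql: "quasiline (C W)" and U0: "U0 \<in> \<SS>" "unb U0" "nest U0 W"
  shows "U0 = W"
proof (rule ccontr)
  assume "U0 \<noteq> W"
  note WS = EysD[OF W]
  obtain U where "U \<in> \<SS>" "pnested nest U W \<and> unb U"
    "\<forall>V\<in>\<SS>. (pnested nest V W \<and> unb V) \<and> nest U V \<longrightarrow> V = U"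
    using maximal_above[OF U0(1), of "\<lambda>T. pnested nest T W \<and> unb T"] U0 \<open>U0 \<noteq> W\<close>
    unfolding pnested_def by blast
  then have U: "U \<in> max_below W" unfolding max_below_def by blast
  note US = max_belowD[OF U]
  have p1: "\<pi> W \<one> \<in> mspace (C W)" using WS(1) by simp
  obtain f C0 where C0: "C0 \<ge> 0"
    "\<And>p q. p \<in> mspace (C W) \<Longrightarrow> q \<in> mspace (C W) \<Longrightarrow> \<bar>\<bar>f p - f q\<bar> - mdist (C W) p q\<bar> \<le> C0"
    by (rule quasiline_rough_isometry[OF geodesic[OF WS(1)] ql p1]) (rule that)
  define \<phi> where "\<phi> x = f (\<pi> W x)" for x
  have \<phi>: "\<bar>\<bar>\<phi> x - \<phi> y\<bar> - dd W x y\<bar> \<le> C0" if "x \<in> carrier G" "y \<in> carrier G" for x y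
    unfolding \<phi>_def dd_def using C0(2) WS(1) that by simp
  obtain R where R: "R \<ge> 0" "\<forall>g\<in>carrier G. \<exists>h\<in>stab W. \<forall>V\<in>\<SS>. dd V h g \<le> R"
    using finite_index_cobounded[OF stab_finite_index[OF W]] by blast
  obtain a where a: "a \<in> rho U W" using rho_nested[OF US(1) WS(1) US(2)] by blast
  have am: "a \<in> mspace (C W)" using rho_bounded(1)[OF US(1) WS(1) US(2) a a] .
  define a0 where "a0 = mdist (C W) (\<pi> W \<one>) a"
  have "\<exists>\<tau>\<in>stab W. dd W \<one> \<tau> > 2 * a0 + 4 * E + 2"
  proof -
    obtain y where y: "y \<in> carrier G" "dd W \<one> y > 2 * a0 + 4 * E + 2 + R"
      using unb_far[OF WS(1,2) one_closed] by blast
    obtain h where h: "h \<in> stab W" "dd W h y \<le> R" using R(2) y(1) WS(1) by blast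
    have "dd W \<one> h > 2 * a0 + 4 * E + 2"
      using dd_triangle[OF WS(1) one_closed _ y(1), of h] h y(2) stabD[OF h(1)] by linarith
    then show ?thesis using h(1) by blast
  qed
  then obtain \<tau> where \<tau>: "\<tau> \<in> stab W" "dd W \<one> \<tau> > 2 * a0 + 4 * E + 2" by blast
  have \<tau>c: "\<tau> \<in> carrier G" "act \<tau> W = W" using stabD[OF \<tau>(1)] by auto
  define U' where "U' = act \<tau> U"
  have U': "U' \<in> max_below W" unfolding U'_def by (rule act_max_below[OF U WS(1) \<tau>(1)])
  note US' = max_belowD[OF U']
  have tr: "transverse nest orth U U'"
  proof (rule far_translate_transverse[OF WS(1) U U'])
    fix x b assume x: "x \<in> rho U W" and b: "b \<in> rho U' W"
    have "mv \<tau> W ` rho U W = rho U' W" unfolding U'_def using mv_rho[OF \<tau>c(1) WS(1) US(1)] US(2) \<tau>c(2) by simp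
    then obtain b0 where b0: "b0 \<in> rho U W" "b = mv \<tau> W b0" using b by blast
    have xm: "x \<in> mspace (C W)" "mdist (C W) a x \<le> E" "b0 \<in> mspace (C W)" "mdist (C W) a b0 \<le> E"
      using rho_bounded[OF US(1) WS(1) US(2) x a] rho_bounded[OF US(1) WS(1) US(2) a x]
        rho_bounded[OF US(1) WS(1) US(2) a b0(1)] rho_bounded[OF US(1) WS(1) US(2) b0(1) a] by auto
    have bm: "b \<in> mspace (C W)" and e: "mdist (C W) (\<pi> W \<tau>) b = mdist (C W) (\<pi> W \<one>) b0"
      using mv_stab_isometry[OF WS(1) \<tau>(1) p1 xm(3)] mv_stab_isometry[OF WS(1) \<tau>(1) xm(3) xm(3)]
        pi_stab[OF WS(1) \<tau>(1) one_closed] \<tau>c b0(2) by auto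
    have t1: "mdist (C W) (\<pi> W \<one>) b0 \<le> a0 + E" "mdist (C W) (\<pi> W \<one>) x \<le> a0 + E"
      using mdist_triangle[OF p1 am xm(3)] mdist_triangle[OF p1 am xm(1)] xm(2,4) unfolding a0_def by linarith+
    have \<tau>m: "\<pi> W \<tau> \<in> mspace (C W)" using WS(1) \<tau>c(1) by simp
    have "dd W \<one> \<tau> \<le> mdist (C W) (\<pi> W \<one>) x + mdist (C W) x b + mdist (C W) b (\<pi> W \<tau>)"
      using mdist_triangle[OF p1 xm(1) \<tau>m] mdist_triangle[OF xm(1) bm \<tau>m] unfolding dd_def by linarith
    then show "mdist (C W) x b > 2 * E + 2"
      using t1 \<tau>(2) e mdist_commute[of "C W" b "\<pi> W \<tau>"] by linarith
  qed
  from transverse_stabilizers_bounded[OF US(1) US'(1) tr]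
  obtain B where B: "\<forall>g\<in>stab U \<inter> stab U'. dd U \<one> g \<le> B" ..
  have "\<forall>k::nat. \<exists>g. g \<in> stab W \<and> dd W \<one> g \<le> a0 + 2 * E + 1 + R \<and> dd U \<one> g > real k"
  proof
    fix k :: nat
    obtain q where q: "q \<in> mspace (C U)" "mdist (C U) (\<pi> U \<one>) q > real k + E + R"
      using unbounded_far[OF US(3) pi_in[OF US(1) one_closed]] by blast
    obtain x where x: "x \<in> carrier G" "mdist (C U) (\<pi> U x) q \<le> E" "mdist (C W) (\<pi> W x) a \<le> 2 * E + 1"
      using realise_in_nested[OF US(1) WS(1) US(2) q(1) a] by blast
    obtain h where h: "h \<in> stab W" "\<forall>V\<in>\<SS>. dd V h x \<le> R" using R(2) x(1) by blast
    have hc: "h \<in> carrier G" using stabD h(1) by blast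
    have h': "dd W x h \<le> R" "dd U h x \<le> R" using h(2) WS(1) US(1) dd_commute[of W x h] by auto
    have "dd W \<one> x \<le> a0 + 2 * E + 1"
      using mdist_triangle[OF p1 am pi_in[OF WS(1) x(1)]] x(3) mdist_commute[of "C W" a "\<pi> W x"]
      unfolding dd_def a0_def by linarith
    then have "dd W \<one> h \<le> a0 + 2 * E + 1 + R" using dd_triangle[OF WS(1) one_closed x(1) hc] h'(1) by linarith
    moreover have "dd U \<one> x > real k + R"
      using mdist_triangle[OF pi_in[OF US(1) one_closed] pi_in[OF US(1) x(1)] q(1)] x(2) q(2)
      unfolding dd_def by linarith
    then have "dd U \<one> h > real k" using dd_triangle[OF US(1) one_closed hc x(1)] h'(2) by linarith
    ultimately show "\<exists>g. g \<in> stab W \<and> dd W \<one> g \<le> a0 + 2 * E + 1 + R \<and> dd U \<one> g > real k"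
      using h(1) by blast
  qed
  from choice[OF this] obtain g where
    g: "\<forall>k::nat. g k \<in> stab W \<and> dd W \<one> (g k) \<le> a0 + 2 * E + 1 + R \<and> dd U \<one> (g k) > real k" ..
  have gc: "g k \<in> carrier G" for k using g stabD by blast
  define c where "c = 1 + C0"
  obtain y1 y2 F where F: "y1 \<in> carrier G" "y2 \<in> carrier G" "finite F"
    "\<forall>g\<in>stab W. dd W y1 (g \<otimes> y1) \<le> c \<and> dd W y2 (g \<otimes> y2) \<le> c \<longrightarrow> act g U \<in> F"
    using finitely_many_translates[OF W U, of c] by blast
  obtain y3 y4 F' where F': "y3 \<in> carrier G" "y4 \<in> carrier G" "finite F'"
    "\<forall>g\<in>stab W. dd W y3 (g \<otimes> y3) \<le> c \<and> dd W y4 (g \<otimes> y4) \<le> c \<longrightarrow> act g U' \<in> F'"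
    using finitely_many_translates[OF W U', of c] by blast
  define Z where "Z = {y1, y2, y3, y4}"
  have Z: "finite Z" "Z \<subseteq> carrier G" unfolding Z_def using F F' by auto
  define L where "L = Max ((\<lambda>z. dd W \<one> z) ` Z)"
  have L: "dd W \<one> z \<le> L" if "z \<in> Z" for z unfolding L_def using Z(1) that by simp
  \<comment> \<open>Two indices in the same cell give a product \<open>g k0 \<otimes> inv (g k)\<close> that moves all points of \<open>Z\<close> by at
    most \<open>c\<close>.\<close>
  define cell where "cell k = (\<lambda>z\<in>Z. \<lfloor>\<phi> (inv (g k) \<otimes> z)\<rfloor>)" for k :: nat
  define b where "b = a0 + 2 * E + 1 + R + L + C0"
  have near: "\<bar>\<phi> (inv (g k) \<otimes> z) - \<phi> \<one>\<bar> \<le> b" if z: "z \<in> Z" for k z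
  proof -
    have zc: "z \<in> carrier G" "inv (g k) \<otimes> z \<in> carrier G" "inv (g k) \<in> carrier G" using z Z(2) gc by auto
    have gi: "inv (g k) \<in> stab W" using stab_inv[OF WS(1)] g by blast
    have "dd W \<one> (inv (g k)) = dd W (g k) \<one>"
      using dd_stab[OF WS(1) gi gc one_closed, of k] gc zc(3) by simp
    moreover have "dd W (inv (g k)) (inv (g k) \<otimes> z) = dd W \<one> z"
      using dd_stab[OF WS(1) gi one_closed zc(1)] zc(3) by simp
    moreover have "dd W \<one> (inv (g k) \<otimes> z) \<le> dd W \<one> (inv (g k)) + dd W (inv (g k)) (inv (g k) \<otimes> z)"
      by (rule dd_triangle[OF WS(1) one_closed zc(3,2)])
    moreover have "dd W (g k) \<one> \<le> a0 + 2 * E + 1 + R" using g dd_commute[of W "g k" \<one>] by simp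
    ultimately have "dd W \<one> (inv (g k) \<otimes> z) \<le> a0 + 2 * E + 1 + R + L" using L[OF z] by linarith
    then show ?thesis using \<phi>[OF zc(2) one_closed] dd_commute[of W \<one> "inv (g k) \<otimes> z"] unfolding b_def by linarith
  qed
  have "range cell \<subseteq> PiE Z (\<lambda>_. {\<lfloor>\<phi> \<one> - b\<rfloor>..\<lfloor>\<phi> \<one> + b\<rfloor>})"
  proof (rule image_subsetI)
    fix k
    have "\<lfloor>\<phi> (inv (g k) \<otimes> z)\<rfloor> \<in> {\<lfloor>\<phi> \<one> - b\<rfloor>..\<lfloor>\<phi> \<one> + b\<rfloor>}" if "z \<in> Z" for z
    proof -
      have "\<phi> \<one> - b \<le> \<phi> (inv (g k) \<otimes> z)" "\<phi> (inv (g k) \<otimes> z) \<le> \<phi> \<one> + b" using near[OF that, of k] by linarith+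
      then show ?thesis by (simp add: floor_mono)
    qed
    then show "cell k \<in> PiE Z (\<lambda>_. {\<lfloor>\<phi> \<one> - b\<rfloor>..\<lfloor>\<phi> \<one> + b\<rfloor>})" unfolding cell_def by simp
  qed
  then have "finite (range cell)" using Z(1) finite_PiE finite_subset by (metis (no_types, lifting) finite_atLeastAtMost_int)
  then obtain k0 where k0: "infinite {k. cell k = cell k0}"
    using pigeonhole_infinite[of "UNIV :: nat set" cell] by auto
  define I where "I = {k. cell k = cell k0}"
  define u where "u k = g k0 \<otimes> inv (g k)" for k
  have uW: "u k \<in> stab W" for k unfolding u_def using stab_mult[OF WS(1)] stab_inv[OF WS(1)] g by blast
  have uc: "u k \<in> carrier G" for k using uW stabD by blast
  have small: "dd W z (u k \<otimes> z) \<le> c" if k: "k \<in> I" and z: "z \<in> Z" for k z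
  proof -
    have zc: "z \<in> carrier G" "inv (g k) \<otimes> z \<in> carrier G" "inv (g k0) \<otimes> z \<in> carrier G" using z Z(2) gc by auto
    have "cell k z = cell k0 z" using k unfolding I_def by simp
    then have "\<lfloor>\<phi> (inv (g k) \<otimes> z)\<rfloor> = \<lfloor>\<phi> (inv (g k0) \<otimes> z)\<rfloor>" unfolding cell_def using z by simp
    then have "\<bar>\<phi> (inv (g k0) \<otimes> z) - \<phi> (inv (g k) \<otimes> z)\<bar> \<le> 1" by linarith
    then have "dd W (inv (g k0) \<otimes> z) (inv (g k) \<otimes> z) \<le> c" using \<phi>[OF zc(3,2)] unfolding c_def by linarith
    moreover have "g k0 \<otimes> (inv (g k0) \<otimes> z) = z" "g k0 \<otimes> (inv (g k) \<otimes> z) = u k \<otimes> z"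
      unfolding u_def using zc gc by (simp_all add: m_assoc[symmetric])
    then have "dd W z (u k \<otimes> z) = dd W (inv (g k0) \<otimes> z) (inv (g k) \<otimes> z)"
      using dd_stab[OF WS(1) _ zc(3,2), of "g k0"] g by simp
    ultimately show ?thesis by simp
  qed
  \<comment> \<open>For indices with equal \<open>h\<close> the quotient \<open>g k \<otimes> inv (g k1)\<close> fixes both \<open>U\<close> and \<open>U'\<close>.\<close>
  define h where "h k = (act (inv (g k)) U, act (inv (g k)) U')" for k
  have "h ` I \<subseteq> (act (inv (g k0)) ` F) \<times> (act (inv (g k0)) ` F')"
  proof (rule image_subsetI)
    fix k assume k: "k \<in> I"
    have "act (u k) U \<in> F" "act (u k) U' \<in> F'"
      using F(4) F'(4) uW[of k] small[OF k] unfolding Z_def by blast+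
    moreover have "act (inv (g k0)) (act (u k) V) = act (inv (g k)) V" if "V \<in> \<SS>" for V
      unfolding u_def using act_mult[OF gc _ that, of "inv (g k)" k0] gc that by simp
    ultimately show "h k \<in> (act (inv (g k0)) ` F) \<times> (act (inv (g k0)) ` F')"
      unfolding h_def using US(1) US'(1) by (metis imageI mem_Sigma_iff)
  qed
  then have "finite (h ` I)" using F(3) F'(3) finite_subset by (metis finite_SigmaI finite_imageI)
  moreover have "infinite I" using k0 unfolding I_def .
  ultimately obtain k1 where k1: "k1 \<in> I" "infinite {k \<in> I. h k = h k1}"
    using pigeonhole_infinite[of I h] by auto
  have bound: "real k \<le> B + dd U \<one> (g k1)" if k: "h k = h k1" for k
  proof -
    define e where "e = g k \<otimes> inv (g k1)"
    have ec: "e \<in> carrier G" unfolding e_def using gc by simp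
    have "act e V = V" if "V \<in> \<SS>" "act (inv (g k)) V = act (inv (g k1)) V" for V
      unfolding e_def using act_mult[OF gc _ that(1), of "inv (g k1)" k] gc that by (metis act_inv' inv_closed)
    then have eU: "e \<in> stab U" "e \<in> stab U'" using k US(1) US'(1) ec unfolding h_def by (auto intro: stabI)
    have "e \<otimes> g k1 = g k" unfolding e_def using gc by (simp add: m_assoc)
    then have "dd U e (g k) = dd U \<one> (g k1)" using dd_stab[OF US(1) eU(1) one_closed gc, of k1] ec by simp
    moreover have "dd U \<one> (g k) \<le> dd U \<one> e + dd U e (g k)" using dd_triangle[OF US(1) one_closed ec gc] .
    moreover have "dd U \<one> e \<le> B" using B eU by blast
    moreover have "real k < dd U \<one> (g k)" using g by blast
    ultimately show ?thesis by linarith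
  qed
  have "{k \<in> I. h k = h k1} \<subseteq> {..nat \<lfloor>B + dd U \<one> (g k1)\<rfloor>}"
  proof
    fix k assume "k \<in> {k \<in> I. h k = h k1}"
    then have "real k \<le> B + dd U \<one> (g k1)" using bound by blast
    then show "k \<in> {..nat \<lfloor>B + dd U \<one> (g k1)\<rfloor>}" by (simp add: le_nat_floor)
  qed
  then show False using k1(2) finite_subset by blast
qed

end

section \<open>Virtually abelian groups act on eyries as on quasilines\<close>

context HHG
begin

text \<open>The part of \<open>H\<close> that fixes \<open>W\<close> has finite index, so its orbit in \<open>C W\<close> is coarsely dense and the
  displacement of the base point is a hyperbolic norm on it.\<close>

lemma virtually_abelian_imp_quasiline:
  assumes H: "abelian_finite_index G H" and W: "W \<in> Eys"
  shows "quasiline (C W)"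
proof -
  note WS = EysD[OF W]
  define H0 where "H0 = H \<inter> stab W"
  have subH: "subgroup H G" and abH: "comm_group (G\<lparr>carrier := H\<rparr>)" and fiH: "finite_index G H"
    using H unfolding abelian_finite_index_def finite_index_def by auto
  have fi: "finite_index G H0" unfolding H0_def by (intro finite_index_Int fiH stab_finite_index W)
  have sub: "subgroup H0 G" using fi unfolding finite_index_def by blast
  have H0: "x \<in> carrier G" "x \<in> stab W" "x \<in> H" if "x \<in> H0" for x
    using that stabD unfolding H0_def by auto
  have inv0: "inv x \<in> H0" if "x \<in> H0" for x using subgroup.m_inv_closed[OF sub that] .
  let ?K = "G\<lparr>carrier := H0\<rparr>"
  have invK: "inv\<^bsub>?K\<^esub> x = inv x" if "x \<in> H0" for x using m_inv_consistent[OF sub that] by simp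
  have comm: "comm_group ?K"
  proof (rule group.group_comm_groupI[OF subgroup_imp_group[OF sub]])
    fix x y assume "x \<in> carrier ?K" "y \<in> carrier ?K"
    then have "x \<in> carrier (G\<lparr>carrier := H\<rparr>)" "y \<in> carrier (G\<lparr>carrier := H\<rparr>)" using H0(3) by auto
    from comm_monoid.m_comm[OF comm_group.axioms(1)[OF abH] this]
    show "x \<otimes>\<^bsub>?K\<^esub> y = y \<otimes>\<^bsub>?K\<^esub> x" by simp
  qed
  obtain R where R: "R \<ge> 0" "\<forall>g\<in>carrier G. \<exists>h\<in>H0. \<forall>V\<in>\<SS>. dd V h g \<le> R"
    using finite_index_cobounded[OF fi] by blast
  define R' where "R' = R + E + 1"
  have R': "R' \<ge> 0" unfolding R'_def using R(1) E_ge_1 by simp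
  have near: "\<exists>h\<in>H0. mdist (C W) p (\<pi> W h) \<le> R'" if p: "p \<in> mspace (C W)" for p
  proof -
    obtain x where x: "x \<in> carrier G" "mdist (C W) p (\<pi> W x) < E + 1" using proj_near[OF WS(1) p] by blast
    obtain h where h: "h \<in> H0" "dd W h x \<le> R" using R(2) x(1) WS(1) by blast
    have "mdist (C W) p (\<pi> W h) \<le> R'"
      using mdist_triangle[OF p pi_in[OF WS(1) x(1)] pi_in[OF WS(1) H0(1)[OF h(1)]]] x(2) h(2) dd_commute[of W h x]
      unfolding dd_def R'_def by linarith
    then show ?thesis using h(1) by blast
  qed
  have p1: "\<pi> W \<one> \<in> mspace (C W)" using WS(1) by simp
  define N where "N x = dd W \<one> x" for x
  have NN: "N (inv x \<otimes> z) = dd W x z" if "x \<in> H0" "z \<in> H0" for x z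
  proof -
    have "x \<otimes> (inv x \<otimes> z) = z" using H0(1) that by (simp add: m_assoc[symmetric])
    then show ?thesis using dd_stab[OF WS(1) H0(2)[OF that(1)] one_closed, of "inv x \<otimes> z"] H0(1) that
      unfolding N_def by simp
  qed
  have "hyperbolic_abelian_norm ?K N (6 * E + 8) R'"
  proof (intro hyperbolic_abelian_norm.intro comm hyperbolic_abelian_norm_axioms.intro)
    fix x y z w
    assume "x \<in> carrier ?K"
    then have x: "x \<in> H0" by simp
    show "0 \<le> N x" unfolding N_def by simp
    have "N (inv x) = dd W x \<one>" using NN[OF x subgroup.one_closed[OF sub]] H0(1)[OF x] by simp
    then show "N (inv\<^bsub>?K\<^esub> x) = N x" using invK[OF x] dd_commute[of W x \<one>] unfolding N_def by simp
    assume "y \<in> carrier ?K"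
    then have y: "y \<in> H0" by simp
    have "dd W x (x \<otimes> y) = N y" unfolding N_def using dd_stab[OF WS(1) H0(2)[OF x] one_closed H0(1)[OF y]] H0(1)[OF x] by simp
    then show "N (x \<otimes>\<^bsub>?K\<^esub> y) \<le> N x + N y"
      using dd_triangle[OF WS(1) one_closed H0(1)[OF x], of "x \<otimes> y"] H0(1)[OF x] H0(1)[OF y] unfolding N_def by simp
    assume "z \<in> carrier ?K" "w \<in> carrier ?K"
    then have z: "z \<in> H0" and w: "w \<in> H0" by auto
    have "dd W x z + dd W y w \<le> max (dd W x y + dd W z w) (dd W y z + dd W x w) + (6 * E + 8)"
      unfolding dd_def by (intro hyperbolic_four_point geodesic hyperbolic pi_in WS(1) H0(1) x y z w)
    then show "N (inv\<^bsub>?K\<^esub> x \<otimes>\<^bsub>?K\<^esub> z) + N (inv\<^bsub>?K\<^esub> y \<otimes>\<^bsub>?K\<^esub> w)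
      \<le> max (N (inv\<^bsub>?K\<^esub> x \<otimes>\<^bsub>?K\<^esub> y) + N (inv\<^bsub>?K\<^esub> z \<otimes>\<^bsub>?K\<^esub> w))
          (N (inv\<^bsub>?K\<^esub> y \<otimes>\<^bsub>?K\<^esub> z) + N (inv\<^bsub>?K\<^esub> x \<otimes>\<^bsub>?K\<^esub> w)) + (6 * E + 8)"
      using invK x y z w NN by simp
  next
    show "N \<one>\<^bsub>?K\<^esub> = 0" unfolding N_def using WS(1) by simp
  next
    fix g t assume "g \<in> carrier ?K" and t: "0 \<le> t" "t \<le> N g"
    then have g: "g \<in> H0" by simp
    have pg: "\<pi> W g \<in> mspace (C W)" using WS(1) H0(1)[OF g] by simp
    define L where "L = mdist (C W) (\<pi> W \<one>) (\<pi> W g)"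
    have NL: "N g = L" unfolding N_def dd_def L_def ..
    obtain \<gamma> :: "real \<Rightarrow> 'p" where \<gamma>: "\<And>s. 0 \<le> s \<Longrightarrow> s \<le> L \<Longrightarrow> \<gamma> s \<in> mspace (C W)"
      "\<And>s t. 0 \<le> s \<Longrightarrow> s \<le> L \<Longrightarrow> 0 \<le> t \<Longrightarrow> t \<le> L \<Longrightarrow> mdist (C W) (\<gamma> s) (\<gamma> t) = \<bar>s - t\<bar>"
      "\<gamma> 0 = \<pi> W \<one>" "\<gamma> L = \<pi> W g"
      by (rule geodesic_pathE[OF geodesic[OF WS(1)] p1 pg, folded L_def]) (rule that)
    have tm: "\<gamma> t \<in> mspace (C W)" using \<gamma>(1) t NL by simp
    have d: "mdist (C W) (\<pi> W \<one>) (\<gamma> t) = t" "mdist (C W) (\<gamma> t) (\<pi> W g) = N g - t"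
      using \<gamma>(2)[of 0 t] \<gamma>(2)[of t L] \<gamma>(3,4) t NL by auto
    obtain k where k: "k \<in> H0" "mdist (C W) (\<gamma> t) (\<pi> W k) \<le> R'" using near[OF tm] by blast
    have km: "\<pi> W k \<in> mspace (C W)" using WS(1) H0(1)[OF k(1)] by simp
    have "\<bar>N k - t\<bar> \<le> R'"
      using mdist_triangle[OF p1 tm km] mdist_triangle[OF p1 km tm] d k(2) mdist_commute[of "C W" "\<pi> W k" "\<gamma> t"]
      unfolding N_def dd_def by linarith
    moreover have "\<bar>dd W k g - (N g - t)\<bar> \<le> R'"
      using mdist_triangle[OF km tm pg] mdist_triangle[OF tm km pg] d k(2) mdist_commute[of "C W" "\<pi> W k" "\<gamma> t"]
      unfolding dd_def by linarith
    ultimately show "\<exists>k\<in>carrier ?K. \<bar>N k - t\<bar> \<le> R' \<and> \<bar>N (inv\<^bsub>?K\<^esub> k \<otimes>\<^bsub>?K\<^esub> g) - (N g - t)\<bar> \<le> R'"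
      using k(1) invK NN g by auto
  next
    fix B
    obtain y where y: "y \<in> carrier G" "dd W \<one> y > B + R" using unb_far[OF WS(1,2) one_closed] by blast
    obtain h where h: "h \<in> H0" "dd W h y \<le> R" using R(2) y(1) WS(1) by blast
    have "dd W \<one> h > B" using dd_triangle[OF WS(1) one_closed H0(1)[OF h(1)] y(1)] h(2) y(2) by linarith
    then show "\<exists>g\<in>carrier ?K. N g > B" using h(1) unfolding N_def by auto
  qed
  then obtain f c where f: "c \<ge> 0"
    "\<And>g h. g \<in> carrier ?K \<Longrightarrow> h \<in> carrier ?K \<Longrightarrow> \<bar>\<bar>f g - f h\<bar> - N (inv\<^bsub>?K\<^esub> g \<otimes>\<^bsub>?K\<^esub> h)\<bar> \<le> c"
    "\<And>s. \<exists>h\<in>carrier ?K. \<bar>s - f h\<bar> \<le> c"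
    by (rule hyperbolic_abelian_norm.line_coordinate) (rule that)
  have f': "\<bar>\<bar>f g - f h\<bar> - dd W g h\<bar> \<le> c" if "g \<in> H0" "h \<in> H0" for g h
    using f(2)[of g h] that invK NN by simp
  have "\<forall>p\<in>mspace (C W). \<exists>h. h \<in> H0 \<and> mdist (C W) p (\<pi> W h) \<le> R'" using near by blast
  from bchoice[OF this] obtain q where q: "\<forall>p\<in>mspace (C W). q p \<in> H0 \<and> mdist (C W) p (\<pi> W (q p)) \<le> R'" ..
  have qm: "\<pi> W (q p) \<in> mspace (C W)" if "p \<in> mspace (C W)" for p using q that WS(1) H0(1) by simp
  show ?thesis
  proof (rule quasilineI[of "2 * c + 2 * R'" "C W" "\<lambda>p. f (q p)"])
    show "0 \<le> 2 * c + 2 * R'" using f(1) R' by simp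
    fix p r assume p: "p \<in> mspace (C W)" and r: "r \<in> mspace (C W)"
    have qp: "q p \<in> H0" "mdist (C W) p (\<pi> W (q p)) \<le> R'" and qr: "q r \<in> H0" "mdist (C W) r (\<pi> W (q r)) \<le> R'"
      using q p r by auto
    have "\<bar>mdist (C W) (\<pi> W (q p)) (\<pi> W (q r)) - mdist (C W) p r\<bar> \<le> 2 * R'"
      using mdist_triangle[OF p qm[OF p] r] mdist_triangle[OF qm[OF p] qm[OF r] r] qp(2) qr(2)
        mdist_triangle[OF qm[OF p] p qm[OF r]] mdist_triangle[OF p r qm[OF r]]
        mdist_commute[of "C W" r "\<pi> W (q r)"] mdist_commute[of "C W" p "\<pi> W (q p)"] by linarith
    then show "\<bar>\<bar>f (q p) - f (q r)\<bar> - mdist (C W) p r\<bar> \<le> 2 * c + 2 * R'"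
      using f'[OF qp(1) qr(1)] f(1) unfolding dd_def by linarith
  next
    fix s
    obtain h where h: "h \<in> H0" "\<bar>s - f h\<bar> \<le> c" using f(3)[of s] by auto
    have hm: "\<pi> W h \<in> mspace (C W)" using WS(1) H0(1)[OF h(1)] by simp
    have qh: "q (\<pi> W h) \<in> H0" "dd W h (q (\<pi> W h)) \<le> R'" using q hm unfolding dd_def by auto
    have "\<bar>s - f (q (\<pi> W h))\<bar> \<le> 2 * c + 2 * R'" using f'[OF h(1) qh(1)] qh(2) h(2) R' by linarith
    then show "\<exists>p\<in>mspace (C W). \<bar>s - f (q p)\<bar> \<le> 2 * c + 2 * R'" using hm by blast
  qed
qed

end

section \<open>Translations of quasilines\<close>

text \<open>The sign is determined by any point far from the origin: if \<open>\<psi>\<close> and \<open>\<xi>\<close> agreed at \<open>x\<close> and were opposite at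
  \<open>y\<close>, their distances between \<open>x\<close> and \<open>y\<close> would differ by about twice the smaller of
  \<open>\<bar>\<xi> x\<bar>\<close> and \<open>\<bar>\<xi> y\<bar>\<close>.\<close>

lemma equal_or_opposite:
  fixes \<psi> \<xi> :: "'a \<Rightarrow> real"
  assumes e: "e \<in> X" "\<psi> e = 0" "\<xi> e = 0"
    and dist: "\<And>x y. x \<in> X \<Longrightarrow> y \<in> X \<Longrightarrow> \<bar>\<bar>\<psi> x - \<psi> y\<bar> - \<bar>\<xi> x - \<xi> y\<bar>\<bar> \<le> c"
  shows "(\<forall>x\<in>X. \<bar>\<psi> x - \<xi> x\<bar> \<le> 5 * c) \<or> (\<forall>x\<in>X. \<bar>\<psi> x + \<xi> x\<bar> \<le> 5 * c)"
proof -
  have size: "\<bar>\<bar>\<psi> x\<bar> - \<bar>\<xi> x\<bar>\<bar> \<le> c" if "x \<in> X" for x using dist[OF that e(1)] e by simp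
  then have c: "0 \<le> c" using e(1) by fastforce
  have sign: "\<bar>\<psi> x - \<xi> x\<bar> \<le> c \<or> \<bar>\<psi> x + \<xi> x\<bar> \<le> c" if "x \<in> X" for x using size[OF that] by linarith
  show ?thesis
  proof (cases "\<exists>x\<in>X. \<bar>\<psi> x - \<xi> x\<bar> \<le> c \<and> \<bar>\<xi> x\<bar> > 2 * c")
    case True
    then obtain x where x: "x \<in> X" "\<bar>\<psi> x - \<xi> x\<bar> \<le> c" "\<bar>\<xi> x\<bar> > 2 * c" by blast
    have "\<bar>\<psi> y - \<xi> y\<bar> \<le> 5 * c" if y: "y \<in> X" for y
    proof (rule ccontr)
      assume no: "\<not> \<bar>\<psi> y - \<xi> y\<bar> \<le> 5 * c"
      then have opp: "\<bar>\<psi> y + \<xi> y\<bar> \<le> c" using sign[OF y] c by linarith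
      have "\<bar>\<psi> y - \<xi> y\<bar> \<le> \<bar>\<psi> y + \<xi> y\<bar> + 2 * \<bar>\<xi> y\<bar>" by linarith
      then have big: "\<bar>\<xi> y\<bar> > 2 * c" using no opp by linarith
      have "\<bar>\<xi> x + \<xi> y\<bar> \<le> \<bar>\<psi> x - \<psi> y\<bar> + 2 * c" "\<bar>\<psi> x - \<psi> y\<bar> \<le> \<bar>\<xi> x + \<xi> y\<bar> + 2 * c"
        using x(2) opp by linarith+
      then have "\<bar>\<bar>\<xi> x + \<xi> y\<bar> - \<bar>\<xi> x - \<xi> y\<bar>\<bar> \<le> 3 * c" using dist[OF x(1) y] by linarith
      moreover have "\<bar>\<bar>\<xi> x + \<xi> y\<bar> - \<bar>\<xi> x - \<xi> y\<bar>\<bar> = 2 * min \<bar>\<xi> x\<bar> \<bar>\<xi> y\<bar>" by linarith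
      ultimately show False using x(3) big c by linarith
    qed
    then show ?thesis by blast
  next
    case False
    have "\<bar>\<psi> x + \<xi> x\<bar> \<le> 5 * c" if x: "x \<in> X" for x
    proof (cases "\<bar>\<psi> x + \<xi> x\<bar> \<le> c")
      case True
      then show ?thesis using c by linarith
    next
      case no: False
      then have "\<bar>\<psi> x - \<xi> x\<bar> \<le> c" using sign[OF x] by blast
      moreover from this have "\<bar>\<xi> x\<bar> \<le> 2 * c" using False x by force
      ultimately show ?thesis by linarith
    qed
    then show ?thesis by blast
  qed
qed

context HHG
begin

definition coarse_translations :: "'d \<Rightarrow> 'g set \<Rightarrow> ('g \<Rightarrow> real) \<Rightarrow> real \<Rightarrow> bool" where
  "coarse_translations W P \<phi> c \<longleftrightarrow> \<phi> \<one> = 0 \<and> 0 \<le> c \<and>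
    (\<forall>x\<in>carrier G. \<forall>y\<in>carrier G. \<bar>\<bar>\<phi> x - \<phi> y\<bar> - dd W x y\<bar> \<le> c) \<and>
    (\<forall>h\<in>P. \<forall>x\<in>carrier G. \<bar>\<phi> (h \<otimes> x) - \<phi> x - \<phi> h\<bar> \<le> c)"

lemma coarse_translationsD:
  assumes "coarse_translations W P \<phi> c"
  shows "\<phi> \<one> = 0" "0 \<le> c"
    "\<And>x y. \<lbrakk>x \<in> carrier G; y \<in> carrier G\<rbrakk> \<Longrightarrow> \<bar>\<bar>\<phi> x - \<phi> y\<bar> - dd W x y\<bar> \<le> c"
    "\<And>h x. \<lbrakk>h \<in> P; x \<in> carrier G\<rbrakk> \<Longrightarrow> \<bar>\<phi> (h \<otimes> x) - \<phi> x - \<phi> h\<bar> \<le> c"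
  using assms unfolding coarse_translations_def by auto

lemma coarse_translations_mono:
  assumes "coarse_translations W P \<phi> c" "Q \<subseteq> P" "c \<le> c'"
  shows "coarse_translations W Q \<phi> c'"
proof -
  note P = coarse_translationsD[OF assms(1)]
  have "\<bar>\<bar>\<phi> x - \<phi> y\<bar> - dd W x y\<bar> \<le> c'" if "x \<in> carrier G" "y \<in> carrier G" for x y
    using P(3)[OF that] assms(3) by linarith
  moreover have "\<bar>\<phi> (h \<otimes> x) - \<phi> x - \<phi> h\<bar> \<le> c'" if "h \<in> Q" "x \<in> carrier G" for h x
    using P(4)[OF subsetD[OF assms(2) that(1)] that(2)] assms(3) by linarith
  ultimately show ?thesis using P(1,2) assms(3) unfolding coarse_translations_def by simp
qed

text \<open>The elements that act on a quasiline by coarse translations form a subgroup. Elements of the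
  stabiliser that are not of this kind act as reflections, so the product of any two of them is a coarse translation.\<close>

lemma translation_subgroup:
  assumes W: "W \<in> Eys" and ql: "quasiline (C W)"
  shows "\<exists>P \<phi> c. finite_index G P \<and> coarse_translations W P \<phi> c"
proof -
  note WS = EysD[OF W]
  have p1: "\<pi> W \<one> \<in> mspace (C W)" using WS(1) by simp
  obtain f C0 where C0: "C0 \<ge> 0"
    "\<And>p q. p \<in> mspace (C W) \<Longrightarrow> q \<in> mspace (C W) \<Longrightarrow> \<bar>\<bar>f p - f q\<bar> - mdist (C W) p q\<bar> \<le> C0"
    by (rule quasiline_rough_isometry[OF geodesic[OF WS(1)] ql p1]) (rule that)
  define \<phi> where "\<phi> x = f (\<pi> W x) - f (\<pi> W \<one>)" for x
  have \<phi>: "\<bar>\<bar>\<phi> x - \<phi> y\<bar> - dd W x y\<bar> \<le> C0" if "x \<in> carrier G" "y \<in> carrier G" for x y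
    using C0(2)[of "\<pi> W x" "\<pi> W y"] WS(1) that unfolding \<phi>_def dd_def by simp
  have \<phi>1: "\<phi> \<one> = 0" unfolding \<phi>_def by simp
  have unbdd: "\<exists>x\<in>carrier G. \<bar>\<phi> x\<bar> > B" for B
  proof -
    obtain x where x: "x \<in> carrier G" "dd W \<one> x > B + C0" using unb_far[OF WS(1,2) one_closed] by blast
    then show ?thesis using \<phi>[OF one_closed x(1)] \<phi>1 by (intro bexI[of _ x]) auto
  qed
  define c where "c = 10 * C0"
  have kinds: "(\<forall>x\<in>carrier G. \<bar>\<phi> (h \<otimes> x) - \<phi> h - \<phi> x\<bar> \<le> c) \<or> (\<forall>x\<in>carrier G. \<bar>\<phi> (h \<otimes> x) - \<phi> h + \<phi> x\<bar> \<le> c)"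
    if h: "h \<in> stab W" for h
  proof -
    have hc: "h \<in> carrier G" using h stabD by blast
    have iso: "\<bar>\<bar>(\<phi> (h \<otimes> x) - \<phi> h) - (\<phi> (h \<otimes> y) - \<phi> h)\<bar> - \<bar>\<phi> x - \<phi> y\<bar>\<bar> \<le> 2 * C0"
      if "x \<in> carrier G" "y \<in> carrier G" for x y
      using \<phi>[OF that] \<phi>[of "h \<otimes> x" "h \<otimes> y"] dd_stab[OF WS(1) h that] hc that by simp
    have "\<phi> (h \<otimes> \<one>) - \<phi> h = 0" using hc by simp
    from equal_or_opposite[of \<one> "carrier G" "\<lambda>x. \<phi> (h \<otimes> x) - \<phi> h" \<phi> "2 * C0", OF one_closed this \<phi>1 iso]
    show ?thesis unfolding c_def by simp
  qed
  define P where "P = {h \<in> stab W. \<exists>B. \<forall>x\<in>carrier G. \<bar>\<phi> (h \<otimes> x) - \<phi> x\<bar> \<le> B}"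
  have Pc: "h \<in> carrier G" "h \<in> stab W" if "h \<in> P" for h using that stabD unfolding P_def by auto
  have P: "subgroup P G"
  proof (rule subgroupI)
    show "P \<subseteq> carrier G" using Pc by blast
    have "\<one> \<in> P" unfolding P_def using act_one[OF WS(1)] by (auto intro!: stabI exI[of _ 0])
    then show "P \<noteq> {}" by blast
    fix g assume g: "g \<in> P"
    then obtain B where B: "\<forall>x\<in>carrier G. \<bar>\<phi> (g \<otimes> x) - \<phi> x\<bar> \<le> B" unfolding P_def by blast
    have "\<bar>\<phi> (inv g \<otimes> x) - \<phi> x\<bar> \<le> B" if x: "x \<in> carrier G" for x
    proof -
      have "g \<otimes> (inv g \<otimes> x) = x" using Pc(1)[OF g] x by (simp add: m_assoc[symmetric])
      then show ?thesis using bspec[OF B, of "inv g \<otimes> x"] Pc(1)[OF g] x by (simp add: abs_minus_commute)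
    qed
    then show "inv g \<in> P" unfolding P_def using stab_inv[OF WS(1) Pc(2)[OF g]] by blast
    fix h assume h: "h \<in> P"
    then obtain B' where B': "\<forall>x\<in>carrier G. \<bar>\<phi> (h \<otimes> x) - \<phi> x\<bar> \<le> B'" unfolding P_def by blast
    have "\<bar>\<phi> (g \<otimes> h \<otimes> x) - \<phi> x\<bar> \<le> B + B'" if x: "x \<in> carrier G" for x
    proof -
      have hx: "g \<otimes> h \<otimes> x = g \<otimes> (h \<otimes> x)" "h \<otimes> x \<in> carrier G"
        using Pc(1)[OF g] Pc(1)[OF h] x by (auto simp: m_assoc)
      show ?thesis using bspec[OF B hx(2)] bspec[OF B' x] unfolding hx(1) by linarith
    qed
    then show "g \<otimes> h \<in> P" unfolding P_def using stab_mult[OF WS(1) Pc(2)[OF g] Pc(2)[OF h]] by blast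
  qed
  have trans: "\<bar>\<phi> (h \<otimes> x) - \<phi> x - \<phi> h\<bar> \<le> c" if h: "h \<in> P" and x: "x \<in> carrier G" for h x
  proof -
    obtain B where B: "\<forall>x\<in>carrier G. \<bar>\<phi> (h \<otimes> x) - \<phi> x\<bar> \<le> B" using h unfolding P_def by blast
    have "\<not> (\<forall>x\<in>carrier G. \<bar>\<phi> (h \<otimes> x) - \<phi> h + \<phi> x\<bar> \<le> c)"
    proof
      assume refl: "\<forall>x\<in>carrier G. \<bar>\<phi> (h \<otimes> x) - \<phi> h + \<phi> x\<bar> \<le> c"
      obtain y where y: "y \<in> carrier G" "\<bar>\<phi> y\<bar> > B + c + \<bar>\<phi> h\<bar>" using unbdd by blast
      show False using bspec[OF B y(1)] bspec[OF refl y(1)] y(2) by linarith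
    qed
    then have "\<bar>\<phi> (h \<otimes> x) - \<phi> h - \<phi> x\<bar> \<le> c" using kinds[OF Pc(2)[OF h]] x by blast
    then show ?thesis by linarith
  qed
  have "finite_index G P"
  proof (rule finite_indexI_classify[OF P stab_finite_index[OF W], of "\<lambda>g. g \<in> P"])
    show "finite ((\<lambda>g. g \<in> P) ` stab W)" by (rule finite_subset[OF subset_UNIV]) simp
    fix g h assume g: "g \<in> stab W" and h: "h \<in> stab W" and eq: "(g \<in> P) = (h \<in> P)"
    show "g \<otimes> inv h \<in> P"
    proof (cases "g \<in> P")
      case True
      then show ?thesis using eq subgroup.m_closed[OF P] subgroup.m_inv_closed[OF P] by blast
    next
      case False
      define k where "k = inv h"
      have kW: "k \<in> stab W" unfolding k_def using stab_inv[OF WS(1) h] .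
      have gc: "g \<in> carrier G" and kc: "k \<in> carrier G" using g kW stabD by auto
      have "inv k = h" unfolding k_def using h stabD by simp
      then have "k \<notin> P" using False eq subgroup.m_inv_closed[OF P, of k] by metis
      have refl: "\<forall>x\<in>carrier G. \<bar>\<phi> (u \<otimes> x) - \<phi> u + \<phi> x\<bar> \<le> c" if u: "u \<in> stab W" "u \<notin> P" for u
      proof -
        have "\<not> (\<forall>x\<in>carrier G. \<bar>\<phi> (u \<otimes> x) - \<phi> u - \<phi> x\<bar> \<le> c)"
        proof
          assume *: "\<forall>x\<in>carrier G. \<bar>\<phi> (u \<otimes> x) - \<phi> u - \<phi> x\<bar> \<le> c"
          have "\<bar>\<phi> (u \<otimes> x) - \<phi> x\<bar> \<le> c + \<bar>\<phi> u\<bar>" if "x \<in> carrier G" for x using bspec[OF * that] by linarith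
          then show False using u unfolding P_def by blast
        qed
        then show ?thesis using kinds[OF u(1)] by blast
      qed
      have "\<bar>\<phi> (g \<otimes> k \<otimes> x) - \<phi> x\<bar> \<le> 2 * c + \<bar>\<phi> g\<bar> + \<bar>\<phi> k\<bar>" if x: "x \<in> carrier G" for x
      proof -
        have kx: "k \<otimes> x \<in> carrier G" "g \<otimes> k \<otimes> x = g \<otimes> (k \<otimes> x)" using gc kc x by (auto simp: m_assoc)
        show ?thesis
          using bspec[OF refl[OF g False] kx(1)] bspec[OF refl[OF kW \<open>k \<notin> P\<close>] x] kx(2) by simp
      qed
      then show ?thesis unfolding P_def k_def[symmetric] using stab_mult[OF WS(1) g kW] by blast
    qed
  qed
  moreover have "\<bar>\<bar>\<phi> x - \<phi> y\<bar> - dd W x y\<bar> \<le> c" if "x \<in> carrier G" "y \<in> carrier G" for x y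
    using \<phi>[OF that] C0(1) unfolding c_def by linarith
  moreover have "0 \<le> c" unfolding c_def using C0(1) by simp
  ultimately show ?thesis using \<phi>1 trans unfolding coarse_translations_def by blast
qed

lemma common_translation_subgroup:
  assumes ql: "\<forall>W\<in>Eys. quasiline (C W)"
  shows "\<exists>P \<phi> c. finite_index G P \<and> (\<forall>W\<in>Eys. coarse_translations W P (\<phi> W) c)"
proof -
  have "\<forall>W\<in>Eys. \<exists>t. finite_index G (fst t) \<and> coarse_translations W (fst t) (fst (snd t)) (snd (snd t))"
    using translation_subgroup ql by fastforce
  from bchoice[OF this] obtain t where
    t: "\<forall>W\<in>Eys. finite_index G (fst (t W)) \<and>
      coarse_translations W (fst (t W)) (fst (snd (t W))) (snd (snd (t W)))" ..
  define P where "P W = fst (t W)" for W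
  define \<phi> where "\<phi> W = fst (snd (t W))" for W
  define c where "c W = snd (snd (t W))" for W
  have tW: "finite_index G (P W)" "coarse_translations W (P W) (\<phi> W) (c W)" if "W \<in> Eys" for W
    using t that unfolding P_def \<phi>_def c_def by auto
  define c' where "c' = (\<Sum>W\<in>Eys. c W)"
  have le: "c W \<le> c'" if "W \<in> Eys" for W
    unfolding c'_def using member_le_sum[OF that, of c] coarse_translationsD(2)[OF tW(2)] finite_Eys by auto
  define Q where "Q = carrier G \<inter> (\<Inter>W\<in>Eys. P W)"
  have "finite_index G Q" unfolding Q_def using finite_index_INT[OF finite_Eys, of P] tW(1) by blast
  moreover have "coarse_translations W Q (\<phi> W) c'" if W: "W \<in> Eys" for W
    by (rule coarse_translations_mono[OF tW(2)[OF W] _ le[OF W]]) (use W in \<open>auto simp: Q_def\<close>)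
  ultimately show ?thesis by blast
qed

text \<open>If all eyries are quasilines then they are the only unbounded domains, so by the uniqueness axiom the
  group is determined by its action on the eyries up to finite ambiguity.\<close>

lemma eyries_determine_distance:
  assumes ql: "\<forall>W\<in>Eys. quasiline (C W)"
  shows "\<exists>n. \<forall>x\<in>carrier G. \<forall>y\<in>carrier G. (\<forall>W\<in>Eys. dd W x y \<le> \<kappa>) \<longrightarrow> wl (inv x \<otimes> y) \<le> n"
proof -
  obtain \<theta> :: real where \<theta>: "\<forall>x\<in>mspace (word_metric G A). \<forall>y\<in>mspace (word_metric G A).
    mdist (word_metric G A) x y > \<theta> \<longrightarrow> (\<exists>U\<in>\<SS>. mdist (C U) (\<pi> U x) (\<pi> U y) > max \<kappa> E)"
    using uniqueness[of "max \<kappa> E"] ..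
  have "wl (inv x \<otimes> y) \<le> nat \<lfloor>\<theta>\<rfloor>" if xy: "x \<in> carrier G" "y \<in> carrier G" and small: "\<forall>W\<in>Eys. dd W x y \<le> \<kappa>" for x y
  proof -
    have "mdist (word_metric G A) x y = real (wl (inv x \<otimes> y))"
      unfolding word_metric(2) word_dist_def using xy by simp
    moreover have "\<not> mdist (word_metric G A) x y > \<theta>"
    proof
      assume "mdist (word_metric G A) x y > \<theta>"
      then obtain U where U: "U \<in> \<SS>" "dd U x y > max \<kappa> E"
        using \<theta> xy unfolding word_metric(1) dd_def by blast
      have "unb U" using dd_bounded[OF U(1) _ xy] U(2) by force
      then obtain W where W: "W \<in> Eys" "nest U W" using nested_in_eyrie[OF U(1)] by blast
      then have "U = W" using no_unbounded_below_quasiline[OF W(1) _ U(1) \<open>unb U\<close> W(2)] ql by blast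
      then show False using small W U(2) by force
    qed
    ultimately have "real (wl (inv x \<otimes> y)) \<le> \<theta>" by simp
    then show ?thesis by (simp add: le_nat_floor)
  qed
  then show ?thesis by blast
qed

text \<open>Translations of a line commute, so commutators of coarse translations move the base point boundedly in
  every eyrie. There are finitely many such elements.\<close>

lemma quasilines_imp_virtually_abelian:
  assumes ql: "\<forall>W\<in>Eys. quasiline (C W)"
  shows "virtually_abelian G"
proof -
  obtain P \<phi> c where P: "finite_index G P" and \<phi>: "\<forall>W\<in>Eys. coarse_translations W P (\<phi> W) c"
    using common_translation_subgroup[OF ql] by blast
  have PG: "P \<subseteq> carrier G" using P subgroup.subset unfolding finite_index_def by blast
  obtain n where n: "\<forall>x\<in>carrier G. \<forall>y\<in>carrier G. (\<forall>W\<in>Eys. dd W x y \<le> 3 * c) \<longrightarrow> wl (inv x \<otimes> y) \<le> n"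
    using eyries_determine_distance[OF ql] ..
  have "inv (h \<otimes> g) \<otimes> (g \<otimes> h) \<in> {g \<in> carrier G. wl g \<le> n}" if gh: "g \<in> P" "h \<in> P" for g h
  proof -
    have c: "g \<in> carrier G" "h \<in> carrier G" "h \<otimes> g \<in> carrier G" "g \<otimes> h \<in> carrier G" using gh PG by auto
    have "dd W (h \<otimes> g) (g \<otimes> h) \<le> 3 * c" if W: "W \<in> Eys" for W
    proof -
      note t = coarse_translationsD[OF bspec[OF \<phi> W]]
      show ?thesis using t(4)[OF gh(1) c(2)] t(4)[OF gh(2) c(1)] t(3)[OF c(3,4)] by linarith
    qed
    then show ?thesis using n c by simp
  qed
  then have "{inv (h \<otimes> g) \<otimes> (g \<otimes> h) | g h. g \<in> P \<and> h \<in> P} \<subseteq> {g \<in> carrier G. wl g \<le> n}" by blast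
  then have "finite {inv (h \<otimes> g) \<otimes> (g \<otimes> h) | g h. g \<in> P \<and> h \<in> P}" using finite_ball finite_subset by blast
  from virtually_abelian_if_finitely_many_commutators[OF gens_finite gens_subset gens_generate P this]
  show ?thesis .
qed

end

section \<open>Rank\<close>

context HHG
begin

text \<open>The integer parts of the coordinates divide the group into cells with boundedly many elements. A
  coordinate takes a range of integer parts proportional to the radius on a ball.\<close>

lemma polynomial_growth:
  assumes ql: "\<forall>W\<in>Eys. quasiline (C W)"
  shows "\<exists>F q. \<forall>r. card {g \<in> carrier G. wl g \<le> r * l} \<le> F * (q * (r + 1)) ^ card Eys"
proof -
  obtain P \<phi> c0 where P: "finite_index G P" and \<phi>0: "\<forall>W\<in>Eys. coarse_translations W P (\<phi> W) c0"
    using common_translation_subgroup[OF ql] by blast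
  \<comment> \<open>If there are no eyries, \<open>c0\<close> may be negative.\<close>
  define c where "c = max 0 c0"
  have c: "0 \<le> c" unfolding c_def by simp
  have \<phi>: "coarse_translations W P (\<phi> W) c" if "W \<in> Eys" for W
    by (rule coarse_translations_mono[OF bspec[OF \<phi>0 that]]) (auto simp: c_def)
  note \<phi>1 = coarse_translationsD(1)[OF \<phi>] and rough = coarse_translationsD(3)[OF \<phi>]
  obtain n where n: "\<forall>x\<in>carrier G. \<forall>y\<in>carrier G. (\<forall>W\<in>Eys. dd W x y \<le> 1 + c) \<longrightarrow> wl (inv x \<otimes> y) \<le> n"
    using eyries_determine_distance[OF ql] ..
  define F where "F = card {g \<in> carrier G. wl g \<le> n}"
  define q0 where "q0 = nat \<lceil>E * real l + E + c\<rceil>"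
  have q0: "E * real l + E + c \<le> real q0" unfolding q0_def by linarith
  have "card {g \<in> carrier G. wl g \<le> r * l} \<le> F * ((2 * q0 + 1) * (r + 1)) ^ card Eys" for r
  proof -
    define S where "S = {g \<in> carrier G. wl g \<le> r * l}"
    have S: "finite S" unfolding S_def by (rule finite_ball)
    define b where "b = q0 * (r + 1)"
    define cell where "cell x = (\<lambda>W\<in>Eys. \<lfloor>\<phi> W x\<rfloor>)" for x
    have size: "\<lfloor>\<phi> W x\<rfloor> \<in> {- int b..int b}" if W: "W \<in> Eys" and x: "x \<in> S" for W x
    proof -
      have xc: "x \<in> carrier G" "wl x \<le> r * l" using x unfolding S_def by auto
      have "dd W \<one> x \<le> E * real (wl x) + E" using dd_right_mult[OF EysD(1)[OF W] one_closed xc(1)] xc(1) by simp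
      also have "real (wl x) \<le> real (r * l)" using xc(2) by (simp only: of_nat_le_iff)
      then have "E * real (wl x) \<le> E * real (r * l)" by (rule mult_left_mono) (use E_ge_1 in simp)
      finally have "dd W \<one> x \<le> E * real (r * l) + E" by simp
      moreover have "\<bar>\<phi> W x\<bar> \<le> dd W \<one> x + c" using rough[OF W one_closed xc(1)] \<phi>1[OF W] by linarith
      ultimately have "\<bar>\<phi> W x\<bar> \<le> E * real (r * l) + E + c" by linarith
      also have "\<dots> \<le> (E * real l + E + c) * real (r + 1)"
      proof -
        have "0 \<le> E * real l + E * real r + c * real r" using E_ge_1 c by simp
        then show ?thesis by (simp add: algebra_simps)
      qed
      also have "\<dots> \<le> real q0 * real (r + 1)" using q0 by (intro mult_right_mono) auto
      also have "\<dots> = real b" unfolding b_def by (simp only: of_nat_mult)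
      finally have "- real b \<le> \<phi> W x" "\<phi> W x \<le> real b" by linarith+
      then have "- int b \<le> \<lfloor>\<phi> W x\<rfloor>" "\<lfloor>\<phi> W x\<rfloor> \<le> int b" by linarith+
      then show ?thesis by simp
    qed
    define Box where "Box = PiE Eys (\<lambda>_. {- int b..int b})"
    have box: "cell ` S \<subseteq> Box" unfolding Box_def cell_def using size by auto
    have finBox: "finite Box" unfolding Box_def using finite_Eys by (intro finite_PiE) auto
    have cardBox: "card Box = (2 * b + 1) ^ card Eys"
    proof -
      have "card {- int b..int b} = 2 * b + 1" by simp
      then show ?thesis unfolding Box_def using finite_Eys by (simp add: card_PiE)
    qed
    have fiber: "card {x \<in> S. cell x = v} \<le> F" for v
    proof (cases "{x \<in> S. cell x = v} = {}")
      case False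
      then obtain x0 where x0: "x0 \<in> S" "cell x0 = v" by blast
      have x0c: "x0 \<in> carrier G" using x0 unfolding S_def by simp
      have "{x \<in> S. cell x = v} \<subseteq> (\<lambda>u. x0 \<otimes> u) ` {g \<in> carrier G. wl g \<le> n}"
      proof
        fix x assume "x \<in> {x \<in> S. cell x = v}"
        then have x: "x \<in> carrier G" "cell x = cell x0" using x0 unfolding S_def by auto
        have "dd W x0 x \<le> 1 + c" if W: "W \<in> Eys" for W
        proof -
          have "cell x W = cell x0 W" using x(2) by simp
          then have "\<lfloor>\<phi> W x\<rfloor> = \<lfloor>\<phi> W x0\<rfloor>" unfolding cell_def using W by simp
          then have "\<bar>\<phi> W x0 - \<phi> W x\<bar> \<le> 1" by linarith
          then show ?thesis using rough[OF W x0c x(1)] by linarith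
        qed
        then have "wl (inv x0 \<otimes> x) \<le> n" using n x0c x(1) by blast
        moreover have "x = x0 \<otimes> (inv x0 \<otimes> x)" using x0c x(1) by (simp add: m_assoc[symmetric])
        ultimately show "x \<in> (\<lambda>u. x0 \<otimes> u) ` {g \<in> carrier G. wl g \<le> n}" using x0c x(1) by blast
      qed
      then have "card {x \<in> S. cell x = v} \<le> card ((\<lambda>u. x0 \<otimes> u) ` {g \<in> carrier G. wl g \<le> n})"
        by (rule card_mono[OF finite_imageI[OF finite_ball]])
      also have "\<dots> \<le> F" unfolding F_def by (rule card_image_le[OF finite_ball])
      finally show ?thesis .
    next
      case True
      then have "card {x \<in> S. cell x = v} = card ({} :: 'g set)" by (rule arg_cong)
      then show ?thesis by simp
    qed
    have "S = (\<Union>v\<in>cell ` S. {x \<in> S. cell x = v})" by blast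
    then have "card S \<le> (\<Sum>v\<in>cell ` S. card {x \<in> S. cell x = v})"
      using card_UN_le[of "cell ` S" "\<lambda>v. {x \<in> S. cell x = v}"] S by simp
    also have "\<dots> \<le> of_nat (card (cell ` S)) * F" by (rule sum_bounded_above) (rule fiber)
    also have "\<dots> \<le> (2 * b + 1) ^ card Eys * F" using card_mono[OF finBox box] cardBox by simp
    also have "(2 * b + 1) ^ card Eys \<le> ((2 * q0 + 1) * (r + 1)) ^ card Eys"
      unfolding b_def by (intro power_mono) (auto simp: algebra_simps)
    finally show ?thesis unfolding S_def by (simp add: mult.commute)
  qed
  then show ?thesis by blast
qed

text \<open>Independent elements generate a free abelian group, which grows polynomially of degree equal to
  its rank.\<close>

lemma independent_card_le:
  assumes ql: "\<forall>W\<in>Eys. quasiline (C W)" and H: "abelian_finite_index G H"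
    and B: "int_independent (G\<lparr>carrier := H\<rparr>) B"
  shows "card B \<le> card Eys"
proof -
  have subH: "subgroup H G" and abH: "comm_group (G\<lparr>carrier := H\<rparr>)"
    using H unfolding abelian_finite_index_def by auto
  have HG: "H \<subseteq> carrier G" using subgroup.subset subH by blast
  let ?K = "G\<lparr>carrier := H\<rparr>"
  interpret K: comm_group ?K by (rule abH)
  have BH: "B \<subseteq> H" and finB: "finite B" and ind: "\<And>n :: 'g \<Rightarrow> int. finprod ?K (\<lambda>b. b [^]\<^bsub>?K\<^esub> n b) B = \<one>\<^bsub>?K\<^esub> \<Longrightarrow> (\<forall>b\<in>B. n b = 0)"
    using B unfolding int_independent_def by auto
  define v where "v e = finprod ?K (\<lambda>b. b [^]\<^bsub>?K\<^esub> int (e b)) B" for e :: "'g \<Rightarrow> nat"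
  define l where "l = (\<Sum>b\<in>B. wl b)"
  have powH: "b [^]\<^bsub>?K\<^esub> (k :: int) \<in> H" if "b \<in> H" for b k using K.int_pow_closed[of b k] that by simp
  have pow: "wl (b [^]\<^bsub>?K\<^esub> k) \<le> k * wl b" if b: "b \<in> H" for b and k :: nat
  proof (induction k)
    case 0
    then show ?case using wl_one by simp
  next
    case (Suc k)
    have "b [^]\<^bsub>?K\<^esub> k \<in> H" using K.nat_pow_closed[of b k] b by simp
    then have "wl (b [^]\<^bsub>?K\<^esub> k \<otimes> b) \<le> wl (b [^]\<^bsub>?K\<^esub> k) + wl b" using wl_mult b HG by blast
    then show ?case using Suc K.nat_pow_Suc[of b k] by simp
  qed
  have prod: "wl (finprod ?K (\<lambda>b. b [^]\<^bsub>?K\<^esub> int (e b)) S) \<le> (\<Sum>b\<in>S. e b * wl b)"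
    if "finite S" "S \<subseteq> H" for S and e :: "'g \<Rightarrow> nat"
    using that
  proof (induction S)
    case empty
    then show ?case using wl_one by simp
  next
    case (insert a S)
    have a: "a \<in> H" "S \<subseteq> H" using insert.prems by auto
    have f: "(\<lambda>b. b [^]\<^bsub>?K\<^esub> int (e b)) \<in> S \<rightarrow> carrier ?K" using a(2) powH by auto
    have fa: "a [^]\<^bsub>?K\<^esub> int (e a) \<in> carrier ?K" using powH[OF a(1)] by simp
    have m: "finprod ?K (\<lambda>b. b [^]\<^bsub>?K\<^esub> int (e b)) S \<in> carrier ?K" using K.finprod_closed[OF f] .
    have "finprod ?K (\<lambda>b. b [^]\<^bsub>?K\<^esub> int (e b)) (insert a S)
      = a [^]\<^bsub>?K\<^esub> int (e a) \<otimes> finprod ?K (\<lambda>b. b [^]\<^bsub>?K\<^esub> int (e b)) S"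
      using K.finprod_insert[OF insert.hyps f fa] by simp
    moreover have "wl (a [^]\<^bsub>?K\<^esub> int (e a) \<otimes> finprod ?K (\<lambda>b. b [^]\<^bsub>?K\<^esub> int (e b)) S)
      \<le> wl (a [^]\<^bsub>?K\<^esub> int (e a)) + wl (finprod ?K (\<lambda>b. b [^]\<^bsub>?K\<^esub> int (e b)) S)"
      using wl_mult fa m HG by simp blast
    moreover have "wl (a [^]\<^bsub>?K\<^esub> int (e a)) \<le> e a * wl a" using pow[OF a(1), of "e a"] by (simp add: int_pow_int)
    ultimately show ?case using insert by simp
  qed
  have inj: "inj_on v (PiE B (\<lambda>_. {0..r}))" for r
  proof (rule inj_onI)
    fix e e' assume e: "e \<in> PiE B (\<lambda>_. {0..r})" and e': "e' \<in> PiE B (\<lambda>_. {0..r})" and eq: "v e = v e'"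
    define w where "w = finprod ?K (\<lambda>b. b [^]\<^bsub>?K\<^esub> (int (e b) - int (e' b))) B"
    have fs: "(\<lambda>b. b [^]\<^bsub>?K\<^esub> (m b :: int)) \<in> B \<rightarrow> carrier ?K" for m using BH powH by auto
    have "v e = finprod ?K (\<lambda>b. b [^]\<^bsub>?K\<^esub> (int (e b) - int (e' b)) \<otimes>\<^bsub>?K\<^esub> b [^]\<^bsub>?K\<^esub> int (e' b)) B"
      unfolding v_def
    proof (rule K.finprod_cong')
      show "(\<lambda>b. b [^]\<^bsub>?K\<^esub> (int (e b) - int (e' b)) \<otimes>\<^bsub>?K\<^esub> b [^]\<^bsub>?K\<^esub> int (e' b)) \<in> B \<rightarrow> carrier ?K"
        using BH powH subgroup.m_closed[OF subH] by auto
      fix b assume "b \<in> B"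
      then have "b \<in> carrier ?K" using BH by auto
      from K.int_pow_mult[OF this, of "int (e b) - int (e' b)" "int (e' b)"]
      show "b [^]\<^bsub>?K\<^esub> int (e b) = b [^]\<^bsub>?K\<^esub> (int (e b) - int (e' b)) \<otimes>\<^bsub>?K\<^esub> b [^]\<^bsub>?K\<^esub> int (e' b)" by simp
    qed simp
    also have "\<dots> = w \<otimes>\<^bsub>?K\<^esub> v e'" unfolding w_def v_def by (rule K.finprod_multf[OF fs fs])
    finally have "v e' = w \<otimes>\<^bsub>?K\<^esub> v e'" using eq by simp
    moreover have "w \<in> carrier ?K" "v e' \<in> carrier ?K" unfolding w_def v_def by (intro K.finprod_closed fs)+
    ultimately have "w = \<one>\<^bsub>?K\<^esub>" using K.r_cancel_one'[of "v e'" w] by simp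
    then have z: "\<forall>b\<in>B. int (e b) - int (e' b) = 0" using ind[of "\<lambda>b. int (e b) - int (e' b)"] unfolding w_def by simp
    show "e = e'" by (rule PiE_ext[OF e e']) (use z in auto)
  qed
  obtain F q where Fq: "\<forall>r. card {g \<in> carrier G. wl g \<le> r * l} \<le> F * (q * (r + 1)) ^ card Eys"
    using polynomial_growth[OF ql, of l] by blast
  have growth: "(r + 1) ^ card B \<le> F * (q * (r + 1)) ^ card Eys" for r
  proof -
    have "v ` PiE B (\<lambda>_. {0..r}) \<subseteq> {g \<in> carrier G. wl g \<le> r * l}"
    proof (rule image_subsetI)
      fix e assume e: "e \<in> PiE B (\<lambda>_. {0..r})"
      have "wl (v e) \<le> (\<Sum>b\<in>B. e b * wl b)" unfolding v_def by (rule prod[OF finB BH])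
      also have "\<dots> \<le> (\<Sum>b\<in>B. r * wl b)" using e by (intro sum_mono mult_right_mono) (auto simp: PiE_iff)
      also have "\<dots> = r * l" unfolding l_def by (simp add: sum_distrib_left)
      finally have "wl (v e) \<le> r * l" .
      moreover have "v e \<in> carrier ?K" unfolding v_def using BH powH by (intro K.finprod_closed) auto
      ultimately show "v e \<in> {g \<in> carrier G. wl g \<le> r * l}" using HG by auto
    qed
    then have "card (v ` PiE B (\<lambda>_. {0..r})) \<le> card {g \<in> carrier G. wl g \<le> r * l}"
      by (rule card_mono[OF finite_ball])
    moreover have "card (v ` PiE B (\<lambda>_. {0..r})) = (r + 1) ^ card B"
      using card_image[OF inj] finB by (simp add: card_PiE)
    ultimately show ?thesis using Fq[rule_format, of r] by linarith
  qed
  show ?thesis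
  proof (rule ccontr)
    assume "\<not> card B \<le> card Eys"
    then have le: "Suc (card Eys) \<le> card B" by simp
    define r where "r = F * q ^ card Eys"
    have "(r + 1) * (r + 1) ^ card Eys = (r + 1) ^ Suc (card Eys)" by simp
    also have "\<dots> \<le> (r + 1) ^ card B" using le by (intro power_increasing) auto
    also have "\<dots> \<le> F * (q * (r + 1)) ^ card Eys" by (rule growth)
    also have "\<dots> = r * (r + 1) ^ card Eys" unfolding power_mult_distrib by (simp add: r_def)
    finally show False by simp
  qed
qed

text \<open>Elements that translate far along one eyrie and little along the others, which exist since eyries are
  orthogonal. Up to bounded errors, their coordinate matrix is diagonally dominant, which makes
  them independent.\<close>

lemma independent_exists:
  assumes ql: "\<forall>W\<in>Eys. quasiline (C W)" and H: "abelian_finite_index G H"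
  shows "\<exists>B. int_independent (G\<lparr>carrier := H\<rparr>) B \<and> card B = card Eys"
proof -
  have subH: "subgroup H G" and abH: "comm_group (G\<lparr>carrier := H\<rparr>)" and fiH: "finite_index G H"
    using H unfolding abelian_finite_index_def finite_index_def by auto
  let ?K = "G\<lparr>carrier := H\<rparr>"
  interpret K: comm_group ?K by (rule abH)
  obtain P \<phi> c0 where P: "finite_index G P" and \<phi>0: "\<forall>W\<in>Eys. coarse_translations W P (\<phi> W) c0"
    using common_translation_subgroup[OF ql] by blast
  \<comment> \<open>If there are no eyries, \<open>c0\<close> may be negative.\<close>
  define c where "c = max 0 c0"
  have c: "0 \<le> c" unfolding c_def by simp
  have \<phi>: "coarse_translations W P (\<phi> W) c" if "W \<in> Eys" for W
    by (rule coarse_translations_mono[OF bspec[OF \<phi>0 that]]) (auto simp: c_def)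
  note \<phi>1 = coarse_translationsD(1)[OF \<phi>] and rough = coarse_translationsD(3)[OF \<phi>]
  define H1 where "H1 = H \<inter> P"
  have fi1: "finite_index G H1" unfolding H1_def by (rule finite_index_Int[OF fiH P])
  then have sub1: "subgroup H1 G" unfolding finite_index_def by blast
  have H1: "H1 \<subseteq> carrier G" "H1 \<subseteq> H" "H1 \<subseteq> P" using subgroup.subset[OF sub1] unfolding H1_def by auto
  have add: "\<bar>\<phi> W (h \<otimes> x) - \<phi> W x - \<phi> W h\<bar> \<le> c" if "W \<in> Eys" "h \<in> H1" "x \<in> H1" for W h x
    using coarse_translationsD(4)[OF \<phi>] that H1 by blast
  have natpow: "b [^] k \<in> H1 \<and> \<bar>\<phi> W (b [^] k) - real k * \<phi> W b\<bar> \<le> real k * c"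
    if W: "W \<in> Eys" and b: "b \<in> H1" for W b and k :: nat
  proof (induction k)
    case 0
    then show ?case using \<phi>1[OF W] subgroup.one_closed[OF sub1] by simp
  next
    case (Suc k)
    have "b [^] Suc k = b [^] k \<otimes> b" by simp
    moreover have "b [^] k \<otimes> b \<in> H1" using subgroup.m_closed[OF sub1] Suc b by blast
    moreover have "\<bar>\<phi> W (b [^] k \<otimes> b) - \<phi> W b - \<phi> W (b [^] k)\<bar> \<le> c" using add[OF W _ b] Suc by blast
    moreover have "real (Suc k) * \<phi> W b = real k * \<phi> W b + \<phi> W b" "real (Suc k) * c = real k * c + c"
      by (simp_all add: algebra_simps)
    ultimately show ?case using Suc by auto
  qed
  have intpow: "b [^] k \<in> H1 \<and> \<bar>\<phi> W (b [^] k) - of_int k * \<phi> W b\<bar> \<le> (\<bar>of_int k\<bar> + 1) * c"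
    if W: "W \<in> Eys" and b: "b \<in> H1" for W b and k :: int
  proof (cases "0 \<le> k")
    case True
    define j where "j = nat k"
    have k: "k = int j" unfolding j_def using True by simp
    have "real j * c \<le> (real j + 1) * c" using c by (simp add: algebra_simps)
    then show ?thesis using natpow[OF W b, of j] unfolding k int_pow_int by simp
  next
    case False
    define j where "j = nat (- k)"
    have k: "k = - int j" unfolding j_def using False by simp
    have bc: "b \<in> carrier G" using b H1 by blast
    define y where "y = b [^] j"
    have y: "y \<in> H1" "\<bar>\<phi> W y - real j * \<phi> W b\<bar> \<le> real j * c" unfolding y_def using natpow[OF W b, of j] by auto
    have iy: "inv y \<in> H1" "b [^] k = inv y" "y \<in> carrier G"
      unfolding k y_def using subgroup.m_inv_closed[OF sub1 y(1)] y int_pow_neg_int[OF bc, of j] H1 unfolding y_def by auto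
    have "\<bar>\<phi> W (y \<otimes> inv y) - \<phi> W (inv y) - \<phi> W y\<bar> \<le> c" using add[OF W y(1) iy(1)] .
    then have "\<bar>\<phi> W (inv y) + \<phi> W y\<bar> \<le> c" using \<phi>1[OF W] iy(3) by simp
    then have "\<bar>\<phi> W (inv y) + real j * \<phi> W b\<bar> \<le> real j * c + c" using y(2) by linarith
    then show ?thesis unfolding iy(2) using iy(1) unfolding k by (simp add: algebra_simps)
  qed
  have finprod: "finprod ?K (\<lambda>b. b [^]\<^bsub>?K\<^esub> n b) S \<in> H1 \<and>
    \<bar>\<phi> W (finprod ?K (\<lambda>b. b [^]\<^bsub>?K\<^esub> n b) S) - (\<Sum>b\<in>S. of_int (n b) * \<phi> W b)\<bar> \<le> (\<Sum>b\<in>S. (\<bar>of_int (n b)\<bar> + 2) * c)"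
    if W: "W \<in> Eys" and "finite S" "S \<subseteq> H1" for W S and n :: "'g \<Rightarrow> int"
    using that(2,3)
  proof (induction S)
    case empty
    then show ?case using \<phi>1[OF W] subgroup.one_closed[OF sub1] by simp
  next
    case (insert a S)
    have a: "a \<in> H1" "S \<subseteq> H1" using insert.prems by auto
    have cons: "b [^]\<^bsub>?K\<^esub> n b = b [^] n b" if "b \<in> H1" for b
      using int_pow_consistent[OF subH, of b "n b"] that H1(2) by auto
    have f: "(\<lambda>b. b [^]\<^bsub>?K\<^esub> n b) \<in> S \<rightarrow> carrier ?K" using a(2) H1(2) K.int_pow_closed by auto
    have fa: "a [^]\<^bsub>?K\<^esub> n a \<in> carrier ?K" using a(1) H1(2) K.int_pow_closed by auto
    define y where "y = finprod ?K (\<lambda>b. b [^]\<^bsub>?K\<^esub> n b) S"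
    have y: "y \<in> H1" "\<bar>\<phi> W y - (\<Sum>b\<in>S. of_int (n b) * \<phi> W b)\<bar> \<le> (\<Sum>b\<in>S. (\<bar>of_int (n b)\<bar> + 2) * c)"
      using insert.IH[OF a(2)] unfolding y_def by auto
    have e: "finprod ?K (\<lambda>b. b [^]\<^bsub>?K\<^esub> n b) (insert a S) = a [^] n a \<otimes> y"
      using K.finprod_insert[OF insert.hyps f fa] cons[OF a(1)] unfolding y_def by simp
    note p = intpow[OF W a(1), of "n a"]
    have m: "a [^] n a \<otimes> y \<in> H1" using subgroup.m_closed[OF sub1] p y(1) by blast
    have ad: "\<bar>\<phi> W (a [^] n a \<otimes> y) - \<phi> W y - \<phi> W (a [^] n a)\<bar> \<le> c" using add[OF W _ y(1)] p by blast
    have s: "(\<Sum>b\<in>insert a S. of_int (n b) * \<phi> W b) = of_int (n a) * \<phi> W a + (\<Sum>b\<in>S. of_int (n b) * \<phi> W b)"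
      "(\<Sum>b\<in>insert a S. (\<bar>of_int (n b)\<bar> + 2) * c) = (\<bar>of_int (n a)\<bar> + 1) * c + c + (\<Sum>b\<in>S. (\<bar>of_int (n b)\<bar> + 2) * c)"
      using insert.hyps by (simp_all add: algebra_simps)
    have "\<bar>\<phi> W (a [^] n a \<otimes> y) - (of_int (n a) * \<phi> W a + (\<Sum>b\<in>S. of_int (n b) * \<phi> W b))\<bar>
      \<le> (\<bar>of_int (n a)\<bar> + 1) * c + c + (\<Sum>b\<in>S. (\<bar>of_int (n b)\<bar> + 2) * c)"
      using conjunct2[OF p] ad y(2) by linarith
    then show ?case unfolding e s using m by blast
  qed
  obtain R where R: "R \<ge> 0" "\<forall>g\<in>carrier G. \<exists>h\<in>H1. \<forall>V\<in>\<SS>. dd V h g \<le> R"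
    using finite_index_cobounded[OF fi1] by blast
  define c' where "c' = E + R + c"
  have c': "0 \<le> c'" unfolding c'_def using R(1) c E_ge_1 by simp
  define N where "N = real (card Eys)"
  \<comment> \<open>Diagonal entries larger than \<open>M\<close> outweigh the \<open>N\<close> off-diagonal ones, each at most \<open>c'\<close>, and the errors, at
    most \<open>3 * c\<close> for each element per unit of the largest exponent.\<close>
  define M where "M = N * (3 * c + c') + c'"
  have M: "c' \<le> M" "N * (3 * c + c') \<le> M" unfolding M_def N_def using c c' by auto
  have "\<forall>W\<in>Eys. \<exists>b. b \<in> H1 \<and> \<bar>\<phi> W b\<bar> > M \<and> (\<forall>V\<in>Eys. V \<noteq> W \<longrightarrow> \<bar>\<phi> V b\<bar> \<le> c')"
  proof
    fix W assume W: "W \<in> Eys"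
    note WS = EysD[OF W]
    obtain p where p: "p \<in> mspace (C W)" "mdist (C W) (\<pi> W \<one>) p > M + c'"
      using unbounded_far[OF WS(2) pi_in[OF WS(1) one_closed]] by blast
    define pts where "pts V = (if V = W then p else \<pi> V \<one>)" for V
    have pts: "pts V \<in> mspace (C V)" if "V \<in> Eys" for V unfolding pts_def using p(1) EysD(1)[OF that] by simp
    have pw: "pairwise orth Eys" using Eys_orthogonal by (simp add: pairwise_def)
    have sub: "Eys \<subseteq> \<SS>" using EysD(1) by blast
    from partial_realisation[OF sub pw pts] obtain x where x: "x \<in> mspace (word_metric G A)"
      "\<forall>V\<in>Eys. mdist (C V) (\<pi> V x) (pts V) \<le> E" by blast
    have xc: "x \<in> carrier G" using x(1) word_metric(1) by simp
    obtain h where h: "h \<in> H1" "\<forall>V\<in>\<SS>. dd V h x \<le> R" using R(2) xc by blast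
    have hc: "h \<in> carrier G" using h(1) H1 by blast
    have tri: "dd V \<one> h \<le> dd V \<one> x + R" "dd V \<one> x \<le> dd V \<one> h + R" if V: "V \<in> Eys" for V
      using dd_triangle[OF EysD(1)[OF V] one_closed xc hc] dd_triangle[OF EysD(1)[OF V] one_closed hc xc]
        bspec[OF h(2) EysD(1)[OF V]] dd_commute[of V x h] by linarith+
    have ph: "\<bar>\<bar>\<phi> V h\<bar> - dd V \<one> h\<bar> \<le> c" if V: "V \<in> Eys" for V
      using rough[OF V one_closed hc] \<phi>1[OF V] by simp
    have "dd W \<one> x > M + c' - E"
      using mdist_triangle[OF pi_in[OF WS(1) one_closed] pi_in[OF WS(1) xc] p(1)] p(2) bspec[OF x(2) W]
      unfolding dd_def pts_def by simp
    then have "\<bar>\<phi> W h\<bar> > M" using ph[OF W] tri[OF W] unfolding c'_def by linarith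
    moreover have "\<bar>\<phi> V h\<bar> \<le> c'" if V: "V \<in> Eys" "V \<noteq> W" for V
    proof -
      have "dd V \<one> x \<le> E" using bspec[OF x(2) V(1)] V(2) mdist_commute[of "C V" "\<pi> V x" "\<pi> V \<one>"]
        unfolding dd_def pts_def by simp
      then show ?thesis using ph[OF V(1)] tri[OF V(1)] unfolding c'_def by linarith
    qed
    ultimately show "\<exists>b. b \<in> H1 \<and> \<bar>\<phi> W b\<bar> > M \<and> (\<forall>V\<in>Eys. V \<noteq> W \<longrightarrow> \<bar>\<phi> V b\<bar> \<le> c')" using h(1) by blast
  qed
  from bchoice[OF this] obtain bb where
    bb: "\<forall>W\<in>Eys. bb W \<in> H1 \<and> \<bar>\<phi> W (bb W)\<bar> > M \<and> (\<forall>V\<in>Eys. V \<noteq> W \<longrightarrow> \<bar>\<phi> V (bb W)\<bar> \<le> c')" ..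
  have off: "\<bar>\<phi> V (bb W)\<bar> \<le> c'" if "V \<in> Eys" "W \<in> Eys" "V \<noteq> W" for V W using bb that by blast
  have inj: "inj_on bb Eys"
  proof (rule inj_onI, rule ccontr)
    fix V W assume V: "V \<in> Eys" and W: "W \<in> Eys" and eq: "bb V = bb W" and ne: "V \<noteq> W"
    have "\<bar>\<phi> V (bb V)\<bar> > M" using bb V by blast
    then show False using off[OF V W ne] M(1) unfolding eq by linarith
  qed
  define B where "B = bb ` Eys"
  have B: "finite B" "B \<subseteq> H1" "card B = card Eys"
    unfolding B_def using finite_Eys bb card_image[OF inj] by auto
  have "int_independent ?K B"
    unfolding int_independent_def
  proof (intro conjI allI impI)
    show "B \<subseteq> carrier ?K" using B(2) H1(2) by auto
    show "finite B" by (rule B(1))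
    fix n :: "'g \<Rightarrow> int" assume one: "finprod ?K (\<lambda>b. b [^]\<^bsub>?K\<^esub> n b) B = \<one>\<^bsub>?K\<^esub>"
    show "\<forall>b\<in>B. n b = 0"
    proof (rule ccontr)
      assume no: "\<not> (\<forall>b\<in>B. n b = 0)"
      then have "B \<noteq> {}" by blast
      define m where "m = Max ((\<lambda>b. \<bar>n b\<bar>) ` B)"
      have le: "\<bar>n b\<bar> \<le> m" if "b \<in> B" for b unfolding m_def using B(1) that by simp
      have "m \<in> (\<lambda>b. \<bar>n b\<bar>) ` B" unfolding m_def using B(1) \<open>B \<noteq> {}\<close> by (intro Max_in) auto
      then obtain b0 where b0: "b0 \<in> B" "m = \<bar>n b0\<bar>" by blast
      obtain b1 where "b1 \<in> B" "n b1 \<noteq> 0" using no by blast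
      then have m1: "1 \<le> m" using le[of b1] by linarith
      obtain W where W: "W \<in> Eys" "b0 = bb W" using b0(1) unfolding B_def by blast
      define t where "t b = of_int (n b) * \<phi> W b" for b
      define \<mu> where "\<mu> = real_of_int m"
      have \<mu>: "1 \<le> \<mu>" unfolding \<mu>_def using m1 by simp
      have le': "\<bar>real_of_int (n b)\<bar> \<le> \<mu>" if "b \<in> B" for b unfolding \<mu>_def using le[OF that] by linarith
      have "\<bar>\<phi> W \<one> - (\<Sum>b\<in>B. t b)\<bar> \<le> (\<Sum>b\<in>B. (\<bar>of_int (n b)\<bar> + 2) * c)"
        using conjunct2[OF finprod[OF W(1) B(1,2), of n]] unfolding one t_def by simp
      also have "\<dots> \<le> of_nat (card B) * (3 * \<mu> * c)"
      proof (rule sum_bounded_above)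
        fix b assume "b \<in> B"
        then have "\<bar>real_of_int (n b)\<bar> + 2 \<le> 3 * \<mu>" using le' \<mu> by fastforce
        then show "(\<bar>of_int (n b)\<bar> + 2) * c \<le> 3 * \<mu> * c" using c by (intro mult_right_mono)
      qed
      finally have tot: "\<bar>\<Sum>b\<in>B. t b\<bar> \<le> N * (3 * \<mu> * c)" using \<phi>1[OF W(1)] B(3) unfolding N_def by simp
      have "\<bar>\<Sum>b\<in>B - {b0}. t b\<bar> \<le> (\<Sum>b\<in>B - {b0}. \<bar>t b\<bar>)" by (rule sum_abs)
      also have "\<dots> \<le> of_nat (card (B - {b0})) * (\<mu> * c')"
      proof (rule sum_bounded_above)
        fix b assume b: "b \<in> B - {b0}"
        then obtain V where V: "V \<in> Eys" "b = bb V" "V \<noteq> W" using W(2) unfolding B_def by blast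
        have "\<bar>\<phi> W b\<bar> \<le> c'" using off[OF W(1) V(1)] V by blast
        then show "\<bar>t b\<bar> \<le> \<mu> * c'" unfolding t_def abs_mult using le' b \<mu> by (intro mult_mono) auto
      qed
      also have "\<dots> \<le> N * (\<mu> * c')"
        unfolding N_def B(3)[symmetric] using card_mono[OF B(1), of "B - {b0}"] \<mu> c' by (intro mult_right_mono) auto
      finally have rest: "\<bar>\<Sum>b\<in>B - {b0}. t b\<bar> \<le> N * (\<mu> * c')" .
      have "(\<Sum>b\<in>B. t b) = t b0 + (\<Sum>b\<in>B - {b0}. t b)" using sum.remove[OF B(1) b0(1)] .
      then have "\<bar>t b0\<bar> \<le> N * (3 * \<mu> * c) + N * (\<mu> * c')" using tot rest by linarith
      also have "\<dots> = \<mu> * (N * (3 * c + c'))" by (simp add: algebra_simps)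
      also have "\<dots> \<le> \<mu> * M" using M(2) \<mu> by (intro mult_left_mono) auto
      finally have "\<bar>t b0\<bar> \<le> \<mu> * M" .
      moreover have "\<bar>t b0\<bar> = \<mu> * \<bar>\<phi> W b0\<bar>" unfolding t_def abs_mult \<mu>_def b0(2) by simp
      ultimately have "\<bar>\<phi> W b0\<bar> \<le> M" using \<mu> by simp
      then show False using bb W by fastforce
    qed
  qed
  then show ?thesis using B(3) by blast
qed

lemma rank_eq_number_of_eyries:
  assumes ql: "\<forall>W\<in>Eys. quasiline (C W)" and H: "abelian_finite_index G H"
  shows "abelian_rank (G\<lparr>carrier := H\<rparr>) = enat (card Eys)"
  unfolding abelian_rank_def
proof (rule antisym)
  show "(SUP B \<in> {B. int_independent (G\<lparr>carrier := H\<rparr>) B}. enat (card B)) \<le> enat (card Eys)"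
    using independent_card_le[OF ql H] by (intro SUP_least) auto
  obtain B where "int_independent (G\<lparr>carrier := H\<rparr>) B" "card B = card Eys"
    using independent_exists[OF ql H] by blast
  then show "enat (card Eys) \<le> (SUP B \<in> {B. int_independent (G\<lparr>carrier := H\<rparr>) B}. enat (card B))"
    by (intro SUP_upper2[of B]) auto
qed

lemma quasilines_iff_all_domains:
  "(\<forall>W\<in>Eys. quasiline (C W)) \<longleftrightarrow> (\<forall>U\<in>\<SS>. bounded_space (C U) \<or> quasiline (C U))"
proof
  assume ql: "\<forall>W\<in>Eys. quasiline (C W)"
  show "\<forall>U\<in>\<SS>. bounded_space (C U) \<or> quasiline (C U)"
  proof (intro ballI)
    fix U assume U: "U \<in> \<SS>"
    show "bounded_space (C U) \<or> quasiline (C U)"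
    proof (cases "bounded_space (C U)")
      case False
      then obtain W where W: "W \<in> Eys" "nest U W" using nested_in_eyrie[OF U] by blast
      then have "U = W" using no_unbounded_below_quasiline[OF W(1) _ U False W(2)] ql by blast
      then show ?thesis using ql W(1) by blast
    qed simp
  qed
next
  assume "\<forall>U\<in>\<SS>. bounded_space (C U) \<or> quasiline (C U)"
  then show "\<forall>W\<in>Eys. quasiline (C W)" using EysD by blast
qed

end

theorem corollary4p2:
  fixes G :: "('g, 'b) monoid_scheme"
    and A :: "'g set"
    and \<SS> :: "'d set"
    and E :: real
    and C :: "'d \<Rightarrow> 'p metric"
    and \<pi> :: "'d \<Rightarrow> 'g \<Rightarrow> 'p"
    and nest orth :: "'d \<Rightarrow> 'd \<Rightarrow> bool"
    and rho :: "'d \<Rightarrow> 'd \<Rightarrow> 'p set"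
    and rhomap :: "'d \<Rightarrow> 'd \<Rightarrow> 'p \<Rightarrow> 'p set"
    and act :: "'g \<Rightarrow> 'd \<Rightarrow> 'd"
    and mv :: "'g \<Rightarrow> 'd \<Rightarrow> 'p \<Rightarrow> 'p"
  assumes "HHG G A \<SS> E C \<pi> nest orth rho rhomap act mv"
  shows "(virtually_abelian G \<longleftrightarrow> (\<forall>W\<in>eyries \<SS> C nest. quasiline (C W)))
       \<and> ((\<forall>W\<in>eyries \<SS> C nest. quasiline (C W)) \<longleftrightarrow>
            (\<forall>U\<in>\<SS>. bounded_space (C U) \<or> quasiline (C U)))
       \<and> (virtually_abelian G \<longrightarrow>
            finite (eyries \<SS> C nest) \<and>
            (\<forall>H. abelian_finite_index G H \<longrightarrow>
               abelian_rank (G\<lparr>carrier := H\<rparr>) = enat (card (eyries \<SS> C nest))))"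
proof -
  interpret HHG G A \<SS> E C \<pi> nest orth rho rhomap act mv by (rule assms)
  have "virtually_abelian G \<longleftrightarrow> (\<forall>W\<in>Eys. quasiline (C W))"
    using virtually_abelian_imp_quasiline quasilines_imp_virtually_abelian
    unfolding virtually_abelian_def by blast
  moreover have "abelian_rank (G\<lparr>carrier := H\<rparr>) = enat (card Eys)" if "abelian_finite_index G H" for H
    using rank_eq_number_of_eyries[OF _ that] virtually_abelian_imp_quasiline[OF that] by blast
  ultimately show ?thesis using quasilines_iff_all_domains finite_Eys by blast
qed

end
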